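(* Let $K$ be a field, let $a,b$ be positive integers, let $R=K[x,y,z,w]/(x^az-y^2,\ x^aw^b-yz,\ w^by-z^2)$ be a quotient of a polynomial ring over $K$, and let $\mathfrak m=(x,y,z,w)R$. Then the following hold. (1) $R$ is a two-dimensional Cohen--Macaulay ring, and $\mathfrak m^2=(x,w)\mathfrak m\subseteq (x,w)R$. (2) $R$ is an integral domain if at least one of $a$ or $b$ is not divisible by $3$. In particular, in this case, $R_{\mathfrak m}$ is an analytically unramified Cohen--Macaulay local domain. (3) The conductor of $R_{\mathfrak m}$ is contained in the parameter ideal $(x,w)R_{\mathfrak m}$ if $a,b\ge 3$. In particular, if $a,b\ge 3$ and $R$ has positive characteristic, the parameter test ideal of $R_{\mathfrak m}$ is contained in $(x,w)R_{\mathfrak m}$.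
   Context: All rings are commutative and Noetherian. - The conductor of a reduced ring $S$ with total ring of fractions $Q$ and integral closure $\overline S$ (in $Q$) is $(S:_Q\overline S)=\{u\in Q\mid u\overline S\subseteq S\}$. - A local ring is analytically unramified if its completion is reduced. - A parameter ideal is an ideal $J$ generated by $\operatorname{ht}J$ elements. - In a ring $S$ of prime characteristic $p$, the tight closure $J^*$ of an ideal $J$ is the set of $s\in S$ for which there is $c\in S$, not in any minimal prime of $S$, such that $cs^{p^e}\in J^{[p^e]}$ for all $e\gg0$, where $J^{[p^e]}$ is the ideal generated by the $p^e$-th powers of elements of $J$. The parameter test ideal of a local ring $S$ of prime characteristic is the ideal of all $c\in S$ with $cJ^*\subseteq J$ for every parameter ideal $J$. *)

theory Defs
  imports
    "HOL-Algebra.Algebra"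
    "HOL-Algebra.Algebraic_Closure_Type"
    "HOL-Library.Poly_Mapping"
    "HOL-Library.Extended_Nat"
begin

section \<open>Localization\<close>

text \<open>The fraction \<open>r/s\<close> is the class of \<open>(r, s)\<close> in \<open>carrier R \<times> T\<close>, where two pairs are
  equivalent if \<open>t r s' = t r' s\<close> for some \<open>t \<in> T\<close>.  The set \<open>T\<close> is meant to be multiplicatively
  closed and to contain \<open>1\<close>.\<close>

definition fraction :: "('a, 'm) ring_scheme \<Rightarrow> 'a set \<Rightarrow> 'a \<Rightarrow> 'a \<Rightarrow> ('a \<times> 'a) set" where
  "fraction R T r s =
    {(r', s'). r' \<in> carrier R \<and> s' \<in> T \<and>
       (\<exists>t\<in>T. t \<otimes>\<^bsub>R\<^esub> (r \<otimes>\<^bsub>R\<^esub> s') = t \<otimes>\<^bsub>R\<^esub> (r' \<otimes>\<^bsub>R\<^esub> s))}"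

text \<open>The unions below run over all representatives of the two classes; each representative
  contributes the same class.\<close>

definition localization :: "('a, 'm) ring_scheme \<Rightarrow> 'a set \<Rightarrow> ('a \<times> 'a) set ring" where
  "localization R T =
    \<lparr> carrier = {fraction R T r s | r s. r \<in> carrier R \<and> s \<in> T},
      monoid.mult = (\<lambda>U V. \<Union>(r, s)\<in>U. \<Union>(r', s')\<in>V. fraction R T (r \<otimes>\<^bsub>R\<^esub> r') (s \<otimes>\<^bsub>R\<^esub> s')),
      one = fraction R T \<one>\<^bsub>R\<^esub> \<one>\<^bsub>R\<^esub>,
      ring.zero = fraction R T \<zero>\<^bsub>R\<^esub> \<one>\<^bsub>R\<^esub>,
      add = (\<lambda>U V. \<Union>(r, s)\<in>U. \<Union>(r', s')\<in>V.
               fraction R T ((r \<otimes>\<^bsub>R\<^esub> s') \<oplus>\<^bsub>R\<^esub> (r' \<otimes>\<^bsub>R\<^esub> s)) (s \<otimes>\<^bsub>R\<^esub> s')) \<rparr>"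

definition localization_map :: "('a, 'm) ring_scheme \<Rightarrow> 'a set \<Rightarrow> 'a \<Rightarrow> ('a \<times> 'a) set" where
  "localization_map R T r = fraction R T r \<one>\<^bsub>R\<^esub>"

definition localization_at :: "('a, 'm) ring_scheme \<Rightarrow> 'a set \<Rightarrow> ('a \<times> 'a) set ring" where
  "localization_at R P = localization R (carrier R - P)"

definition localization_at_map :: "('a, 'm) ring_scheme \<Rightarrow> 'a set \<Rightarrow> 'a \<Rightarrow> ('a \<times> 'a) set" where
  "localization_at_map R P = localization_map R (carrier R - P)"

definition nonzerodivisors :: "('a, 'm) ring_scheme \<Rightarrow> 'a set" where
  "nonzerodivisors R =
    {s \<in> carrier R. \<forall>r\<in>carrier R. s \<otimes>\<^bsub>R\<^esub> r = \<zero>\<^bsub>R\<^esub> \<longrightarrow> r = \<zero>\<^bsub>R\<^esub>}"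

definition total_fractions :: "('a, 'm) ring_scheme \<Rightarrow> ('a \<times> 'a) set ring" where
  "total_fractions R = localization R (nonzerodivisors R)"

definition total_fractions_map :: "('a, 'm) ring_scheme \<Rightarrow> 'a \<Rightarrow> ('a \<times> 'a) set" where
  "total_fractions_map R = localization_map R (nonzerodivisors R)"


section \<open>Integral closure and conductor\<close>

text \<open>Polynomials are coefficient lists with the leading coefficient first, as in
  \<^theory>\<open>HOL-Algebra.Polynomials\<close>.\<close>

definition integral_over :: "('a, 'm) ring_scheme \<Rightarrow> 'a set \<Rightarrow> 'a \<Rightarrow> bool" where
  "integral_over Q A u \<longleftrightarrow>
    (\<exists>p. p \<noteq> [] \<and> set p \<subseteq> A \<and> hd p = \<one>\<^bsub>Q\<^esub> \<and> ring.eval Q p u = \<zero>\<^bsub>Q\<^esub>)"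

definition integral_closure :: "('a, 'm) ring_scheme \<Rightarrow> ('a \<times> 'a) set set" where
  "integral_closure S =
    {u \<in> carrier (total_fractions S).
       integral_over (total_fractions S) (total_fractions_map S ` carrier S) u}"

text \<open>The conductor is a subset of the total ring of fractions, in which \<open>S\<close> is identified with its
  image.  The formula makes sense whether or not \<open>S\<close> is reduced.\<close>

definition conductor :: "('a, 'm) ring_scheme \<Rightarrow> ('a \<times> 'a) set set" where
  "conductor S =
    {u \<in> carrier (total_fractions S). \<forall>v\<in>integral_closure S.
       u \<otimes>\<^bsub>total_fractions S\<^esub> v \<in> total_fractions_map S ` carrier S}"


section \<open>Dimension and height\<close>

definition prime_chain :: "('a, 'm) ring_scheme \<Rightarrow> (nat \<Rightarrow> 'a set) \<Rightarrow> nat \<Rightarrow> bool" where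
  "prime_chain R P n \<longleftrightarrow>
    (\<forall>i\<le>n. primeideal (P i) R) \<and> (\<forall>i<n. P i \<subset> P (Suc i))"

text \<open>The supremum of the empty set is \<open>0\<close> in \<^typ>\<open>enat\<close>, so the zero ring gets dimension \<open>0\<close>;
  the infimum of the empty set is \<open>\<infinity>\<close>, so the unit ideal has height \<open>\<infinity>\<close>.\<close>

definition krull_dim :: "('a, 'm) ring_scheme \<Rightarrow> enat" where
  "krull_dim R = Sup {enat n | n. \<exists>P. prime_chain R P n}"

definition prime_height :: "('a, 'm) ring_scheme \<Rightarrow> 'a set \<Rightarrow> enat" where
  "prime_height R p = Sup {enat n | n. \<exists>P. prime_chain R P n \<and> P n = p}"

definition ideal_height :: "('a, 'm) ring_scheme \<Rightarrow> 'a set \<Rightarrow> enat" where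
  "ideal_height R J = Inf {prime_height R p | p. primeideal p R \<and> J \<subseteq> p}"

definition minimal_prime :: "('a, 'm) ring_scheme \<Rightarrow> 'a set \<Rightarrow> bool" where
  "minimal_prime R p \<longleftrightarrow>
    primeideal p R \<and> (\<forall>q. primeideal q R \<and> q \<subseteq> p \<longrightarrow> q = p)"

definition parameter_ideal :: "('a, 'm) ring_scheme \<Rightarrow> 'a set \<Rightarrow> bool" where
  "parameter_ideal S J \<longleftrightarrow>
    (\<exists>A. finite A \<and> A \<subseteq> carrier S \<and> J = Idl\<^bsub>S\<^esub> A \<and> enat (card A) = ideal_height S J)"


section \<open>Cohen--Macaulay rings\<close>

text \<open>Local rings are Noetherian by convention.\<close>

definition local_ring :: "('a, 'm) ring_scheme \<Rightarrow> bool" where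
  "local_ring S \<longleftrightarrow> cring S \<and> noetherian_ring S \<and> (\<exists>!M. maximalideal M S)"

definition max_ideal :: "('a, 'm) ring_scheme \<Rightarrow> 'a set" where
  "max_ideal S = (THE M. maximalideal M S)"

definition regular_sequence :: "('a, 'm) ring_scheme \<Rightarrow> 'a list \<Rightarrow> bool" where
  "regular_sequence S xs \<longleftrightarrow>
    set xs \<subseteq> carrier S \<and> Idl\<^bsub>S\<^esub> (set xs) \<noteq> carrier S \<and>
    (\<forall>i<length xs. \<forall>r\<in>carrier S.
       xs ! i \<otimes>\<^bsub>S\<^esub> r \<in> Idl\<^bsub>S\<^esub> (set (take i xs)) \<longrightarrow> r \<in> Idl\<^bsub>S\<^esub> (set (take i xs)))"

definition depth :: "('a, 'm) ring_scheme \<Rightarrow> enat" where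
  "depth S = Sup {enat (length xs) | xs. regular_sequence S xs \<and> set xs \<subseteq> max_ideal S}"

definition cohen_macaulay_local :: "('a, 'm) ring_scheme \<Rightarrow> bool" where
  "cohen_macaulay_local S \<longleftrightarrow> local_ring S \<and> depth S = krull_dim S"

definition cohen_macaulay_ring :: "('a, 'm) ring_scheme \<Rightarrow> bool" where
  "cohen_macaulay_ring R \<longleftrightarrow> cring R \<and> noetherian_ring R \<and>
    (\<forall>M. maximalideal M R \<longrightarrow> cohen_macaulay_local (localization_at R M))"


section \<open>Completion\<close>

text \<open>The inverse limit of the quotients by the powers of \<open>I\<close>.  Elements of the quotients are cosets,
  and the coset \<open>f (n + 1)\<close> maps to \<open>f n\<close> exactly if it is contained in it.\<close>

definition adic_completion :: "('a, 'm) ring_scheme \<Rightarrow> 'a set \<Rightarrow> (nat \<Rightarrow> 'a set) ring" where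
  "adic_completion S I =
    (let Q = (\<lambda>n::nat. S Quot (I [^]\<^bsub>ideals_set S\<^esub> n)) in
     \<lparr> carrier = {f. \<forall>n. f n \<in> carrier (Q n) \<and> f (Suc n) \<subseteq> f n},
       monoid.mult = (\<lambda>f g n. f n \<otimes>\<^bsub>Q n\<^esub> g n),
       one = (\<lambda>n. \<one>\<^bsub>Q n\<^esub>),
       ring.zero = (\<lambda>n. \<zero>\<^bsub>Q n\<^esub>),
       add = (\<lambda>f g n. f n \<oplus>\<^bsub>Q n\<^esub> g n) \<rparr>)"

definition reduced_ring :: "('a, 'm) ring_scheme \<Rightarrow> bool" where
  "reduced_ring S \<longleftrightarrow>
    (\<forall>s\<in>carrier S. \<forall>n::nat. s [^]\<^bsub>S\<^esub> n = \<zero>\<^bsub>S\<^esub> \<longrightarrow> s = \<zero>\<^bsub>S\<^esub>)"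

definition analytically_unramified :: "('a, 'm) ring_scheme \<Rightarrow> bool" where
  "analytically_unramified S \<longleftrightarrow>
    local_ring S \<and> reduced_ring (adic_completion S (max_ideal S))"


section \<open>Tight closure\<close>

definition ring_char :: "('a, 'm) ring_scheme \<Rightarrow> nat" where
  "ring_char S =
    (if \<exists>n::nat. n > 0 \<and> [n] \<cdot>\<^bsub>S\<^esub> \<one>\<^bsub>S\<^esub> = \<zero>\<^bsub>S\<^esub>
     then LEAST n::nat. n > 0 \<and> [n] \<cdot>\<^bsub>S\<^esub> \<one>\<^bsub>S\<^esub> = \<zero>\<^bsub>S\<^esub> else 0)"

definition frobenius_power :: "('a, 'm) ring_scheme \<Rightarrow> 'a set \<Rightarrow> nat \<Rightarrow> 'a set" where
  "frobenius_power S J q = Idl\<^bsub>S\<^esub> ((\<lambda>j. j [^]\<^bsub>S\<^esub> q) ` J)"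

text \<open>Only meaningful for \<open>S\<close> of prime characteristic.\<close>

definition tight_closure :: "('a, 'm) ring_scheme \<Rightarrow> 'a set \<Rightarrow> 'a set" where
  "tight_closure S J =
    {s \<in> carrier S. \<exists>c\<in>carrier S. (\<forall>p. minimal_prime S p \<longrightarrow> c \<notin> p) \<and>
       (\<exists>e0. \<forall>e\<ge>e0. c \<otimes>\<^bsub>S\<^esub> s [^]\<^bsub>S\<^esub> (ring_char S ^ e) \<in> frobenius_power S J (ring_char S ^ e))}"

definition parameter_test_ideal :: "('a, 'm) ring_scheme \<Rightarrow> 'a set" where
  "parameter_test_ideal S =
    {c \<in> carrier S. \<forall>J. parameter_ideal S J \<longrightarrow> (\<forall>s\<in>tight_closure S J. c \<otimes>\<^bsub>S\<^esub> s \<in> J)}"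


section \<open>The ring \<open>K[x,y,z,w]/(x\<^sup>az - y\<^sup>2, x\<^sup>aw\<^sup>b - yz, w\<^sup>by - z\<^sup>2)\<close>\<close>

datatype variable = Var_x | Var_y | Var_z | Var_w

text \<open>The monoid algebra over \<open>'k\<close> of the exponent vectors \<^typ>\<open>variable \<Rightarrow>\<^sub>0 nat\<close>,
  with convolution as multiplication.\<close>

type_synonym 'k poly4 = "(variable \<Rightarrow>\<^sub>0 nat) \<Rightarrow>\<^sub>0 'k"

definition polyvar :: "variable \<Rightarrow> 'k::field poly4" where
  "polyvar v = Poly_Mapping.single (Poly_Mapping.single v 1) 1"

definition relation_ideal :: "nat \<Rightarrow> nat \<Rightarrow> 'k::field poly4 set" where
  "relation_ideal a b =
    (let x = polyvar Var_x; y = polyvar Var_y; z = polyvar Var_z; w = polyvar Var_w in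
     Idl\<^bsub>ring_of_type_algebra\<^esub> {x ^ a * z - y ^ 2, x ^ a * w ^ b - y * z, w ^ b * y - z ^ 2})"

definition quotient_ring :: "nat \<Rightarrow> nat \<Rightarrow> 'k::field poly4 set ring" where
  "quotient_ring a b = ring_of_type_algebra Quot relation_ideal a b"

definition quotient_var :: "nat \<Rightarrow> nat \<Rightarrow> variable \<Rightarrow> 'k::field poly4 set" where
  "quotient_var a b v = relation_ideal a b +>\<^bsub>ring_of_type_algebra\<^esub> polyvar v"

end

theory Submission
  imports Defs "HOL-Library.Numeral_Type" "HOL-Library.Product_Plus"
begin

text \<open>
  The ring \<open>R\<close> is free over \<open>A = K[x, w]\<close> with basis \<open>1, y, z\<close>; this is seen on monomials, where
  \<open>y\<close> and \<open>z\<close> behave like \<open>x\<^bsup>2a/3\<^esup>w\<^bsup>b/3\<^esup>\<close> and \<open>x\<^bsup>a/3\<^esup>w\<^bsup>2b/3\<^esup>\<close> times a cube root of unity.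

  Any three elements of \<open>R\<close> are algebraically dependent over \<open>K\<close>, by counting coefficients, and hence
  there is no chain of four prime ideals.  Every maximal ideal of \<open>R\<close> meets \<open>K[x]\<close> in a nonzero ideal, and so
  contains a prime element of \<open>K[x]\<close> together with a polynomial of \<open>A\<close> that it does not divide: this is a regular
  sequence of length two, as \<open>R\<close> is free over \<open>A\<close>.  A regular sequence gives a chain of prime ideals
  of the same length, so all localizations at maximal ideals are Cohen--Macaulay of dimension two.

  If \<open>3\<close> does not divide both \<open>a\<close> and \<open>b\<close>, then for suitable weights of \<open>x\<close> and \<open>w\<close> the three
  leading terms of the norm form of \<open>p + q y + s z\<close> have orders that are pairwise incongruent
  modulo \<open>3\<close>, so they do not cancel.  Hence the norm vanishes only at \<open>0\<close>, and its weighted order is a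
  valuation on \<open>R\<close> whose filtration is linearly equivalent to that by powers of the maximal ideal;
  so the completion has no nilpotent elements.

  If \<open>a, b \<ge> 3\<close>, then \<open>z\<^sup>3 \<in> x\<^sup>3R\<close> and \<open>y\<^sup>3 \<in> w\<^sup>3R\<close>.  Therefore \<open>z/x\<close> and \<open>y/w\<close> are integral, and
  \<open>z\<close> and \<open>y\<close> are in the tight closures of all parameter ideals containing \<open>x\<close> and \<open>w\<close>, respectively.
  Elements \<open>u\<close> of the conductor or of the parameter test ideal thus satisfy
  \<open>u z \<in> (x, w\<^bsup>b+1\<^esup>)\<close> and \<open>u y \<in> (x\<^bsup>a+1\<^esup>, w)\<close>, and comparing coordinates yields \<open>u \<in> (x, w)\<close>.
\<close>



section \<open>Prime ideals and regular sequences\<close>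

text \<open>Everything is derived from the multiplication table y^2 = x^a z, y z = x^a w^b, z^2 =
  w^b y of a free A-module; the presentation by relations enters only to produce it. Freeness makes
  ideals generated by elements of A coordinatewise, and the norm carries questions about R down to
  A. The cube root of unity is a separate variable g with g^3 = 1: if 3 divides a and b, then
  x^(2a/3) w^(b/3) is itself in A, and only the exponent of g keeps 1, y, z independent. In the last
  step the exponents b + 1 and a + 1 matter. Multiplication by z moves the coordinates (p, q, s) to
  (x^a w^b q, w^b s, p). Modulo (x, w) this says nothing about s, but modulo (x, w^(b+1)) it forces
  the constant term of s to vanish.\<close>

lemma (in cring) ideal_of_mult_closed:
  assumes sub: "I \<subseteq> carrier R" and zero: "\<zero> \<in> I"
    and add: "\<And>u v. u \<in> I \<Longrightarrow> v \<in> I \<Longrightarrow> u \<oplus> v \<in> I"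
    and mult: "\<And>u v. u \<in> I \<Longrightarrow> v \<in> carrier R \<Longrightarrow> u \<otimes> v \<in> I"
  shows "ideal I R"
proof (rule idealI[OF ring_axioms])
  show "subgroup I (add_monoid R)"
  proof (rule add.subgroupI)
    fix u assume u: "u \<in> I"
    then have "u \<otimes> (\<ominus> \<one>) = \<ominus> u" using sub by (auto simp: r_minus)
    then show "\<ominus> u \<in> I" using mult[OF u, of "\<ominus> \<one>"] by simp
  qed (use assms in auto)
  fix u v assume uv: "u \<in> I" "v \<in> carrier R"
  then show "u \<otimes> v \<in> I" by (rule mult)
  then show "v \<otimes> u \<in> I" using m_comm[of u v] uv sub by auto
qed

text \<open>Krull's argument: an ideal maximal among those that contain \<open>I\<close> and miss
  \<open>T\<close> is prime. If a and b are outside it, then \<open>T\<close> contains some p + r a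
  and q + s b with p, q in the ideal. Their product is in \<open>T\<close>, and it would also be in
  the ideal if a b were.\<close>

lemma (in cring) ex_primeideal_avoiding:
  assumes I: "ideal I R" and T: "T \<subseteq> carrier R" "\<one> \<in> T"
    and mult: "\<And>s t. s \<in> T \<Longrightarrow> t \<in> T \<Longrightarrow> s \<otimes> t \<in> T"
    and disj: "I \<inter> T = {}"
  shows "\<exists>P. primeideal P R \<and> I \<subseteq> P \<and> P \<inter> T = {}"
proof -
  let ?A = "{J. ideal J R \<and> I \<subseteq> J \<and> J \<inter> T = {}}"
  have "\<exists>M\<in>?A. \<forall>J\<in>?A. M \<subseteq> J \<longrightarrow> J = M"
  proof (rule subset_Zorn_nonempty)
    show "?A \<noteq> {}" using I disj by auto
    fix C assume C: "C \<noteq> {}" "subset.chain ?A C"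
    have "subset.chain {I. ideal I R} C"
      using C(2) unfolding pred_on.chain_def by auto
    then have "ideal (\<Union>C) R" using chain_Union_is_ideal[of C] C(1) by simp
    moreover have "C \<subseteq> ?A" using C(2) unfolding pred_on.chain_def by auto
    ultimately show "\<Union>C \<in> ?A" using C(1) by blast
  qed
  then obtain P where PA: "P \<in> ?A" and P_max: "\<forall>J\<in>?A. P \<subseteq> J \<longrightarrow> J = P" by (elim bexE)
  have P: "ideal P R" "I \<subseteq> P" "P \<inter> T = {}" using PA by simp_all
  have max: "J = P" if "ideal J R" "J \<inter> T = {}" "P \<subseteq> J" for J
  proof -
    have "J \<in> ?A" using that P(2) by auto
    then show ?thesis using P_max that(3) by blast
  qed
  interpret P: ideal P R by fact
  have meets: "\<exists>p\<in>P. \<exists>r\<in>carrier R. p \<oplus> r \<otimes> a \<in> T" if a: "a \<in> carrier R" "a \<notin> P" for a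
  proof -
    have id: "ideal (P <+> PIdl a) R"
      using a cgenideal_ideal P(1) add_ideals by blast
    have "P \<subseteq> P <+> PIdl a"
    proof
      fix p assume p: "p \<in> P"
      have "\<zero> \<in> PIdl a" using a(1) cgenideal_ideal ideal.axioms(1) additive_subgroup.zero_closed by blast
      moreover have "p = p \<oplus> \<zero>" using P.Icarr[OF p] by simp
      ultimately show "p \<in> P <+> PIdl a" unfolding set_add_def' using p by blast
    qed
    moreover have "a \<in> P <+> PIdl a"
    proof -
      have "a = \<zero> \<oplus> a" using a(1) by simp
      then show ?thesis unfolding set_add_def' using P.zero_closed cgenideal_self[OF a(1)] by blast
    qed
    ultimately have "(P <+> PIdl a) \<inter> T \<noteq> {}" using max[OF id] a by blast
    then show ?thesis unfolding set_add_def' cgenideal_def by blast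
  qed
  have "primeideal P R"
  proof (rule primeidealI[OF P(1) is_cring])
    show "carrier R \<noteq> P" using P(3) T by auto
    fix a b assume ab: "a \<in> carrier R" "b \<in> carrier R" "a \<otimes> b \<in> P"
    show "a \<in> P \<or> b \<in> P"
    proof (rule ccontr)
      assume neg: "\<not> ?thesis"
      obtain p r where p: "p \<in> P" "r \<in> carrier R" "p \<oplus> r \<otimes> a \<in> T" using meets[OF ab(1)] neg by auto
      obtain q s where q: "q \<in> P" "s \<in> carrier R" "q \<oplus> s \<otimes> b \<in> T" using meets[OF ab(2)] neg by auto
      have c: "p \<in> carrier R" "q \<in> carrier R" using p q P.Icarr by auto
      have "(p \<oplus> r \<otimes> a) \<otimes> (q \<oplus> s \<otimes> b) = (q \<oplus> s \<otimes> b) \<otimes> p \<oplus> (r \<otimes> a \<otimes> q \<oplus> (r \<otimes> s) \<otimes> (a \<otimes> b))"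
        using c p(2) q(2) ab by algebra
      moreover have "(q \<oplus> s \<otimes> b) \<otimes> p \<oplus> (r \<otimes> a \<otimes> q \<oplus> (r \<otimes> s) \<otimes> (a \<otimes> b)) \<in> P"
        using c p q ab by (intro P.a_closed P.I_l_closed[OF p(1)] P.I_l_closed[OF q(1)] P.I_l_closed[OF ab(3)]) auto
      ultimately show False using mult[OF p(3) q(3)] P(3) by auto
    qed
  qed
  then show ?thesis using P by blast
qed

lemma (in cring) ex_primeideal_superset:
  assumes "ideal I R" "I \<noteq> carrier R"
  shows "\<exists>P. primeideal P R \<and> I \<subseteq> P"
proof -
  have "\<one> \<notin> I" using assms ideal.one_imp_carrier by blast
  then show ?thesis using ex_primeideal_avoiding[OF assms(1), of "{\<one>}"] by auto
qed

text \<open>The multiplicative set generated by \<open>x\<close> and the complement of \<open>P\<close> avoids \<open>I\<close>.\<close>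

lemma (in cring) ex_smaller_primeideal:
  assumes P: "primeideal P R" and I: "ideal I R" "I \<subseteq> P" and x: "x \<in> P"
    and nzd: "\<And>r. r \<in> carrier R \<Longrightarrow> x \<otimes> r \<in> I \<Longrightarrow> r \<in> I"
  shows "\<exists>Q. primeideal Q R \<and> I \<subseteq> Q \<and> Q \<subset> P"
proof -
  interpret P: primeideal P R by fact
  have xc: "x \<in> carrier R" using x P.Icarr by blast
  define T where "T = {x [^] n \<otimes> s | (n::nat) s. s \<in> carrier R - P}" for n :: nat
  have one: "\<one> \<in> carrier R - P" using P.I_notcarr P.one_imp_carrier by blast
  define T where "T = {x [^] n \<otimes> s | (n::nat) s. s \<in> carrier R - P}"
  have "\<exists>Q. primeideal Q R \<and> I \<subseteq> Q \<and> Q \<inter> T = {}"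
  proof (rule ex_primeideal_avoiding[OF I(1)])
    show "T \<subseteq> carrier R" unfolding T_def using xc by auto
    have "\<one> = x [^] (0::nat) \<otimes> \<one>" by simp
    then show "\<one> \<in> T" unfolding T_def using one by blast
    fix s t assume "s \<in> T" "t \<in> T"
    then obtain m n u v where uv: "s = x [^] (m::nat) \<otimes> u" "t = x [^] (n::nat) \<otimes> v"
      "u \<in> carrier R - P" "v \<in> carrier R - P" unfolding T_def by blast
    have "s \<otimes> t = x [^] (m + n) \<otimes> (u \<otimes> v)"
      using uv xc by (simp add: nat_pow_mult[symmetric] m_ac)
    moreover have "u \<otimes> v \<in> carrier R - P" using uv P.I_prime by auto
    ultimately show "s \<otimes> t \<in> T" unfolding T_def by blast
  next
    have "x [^] (n::nat) \<otimes> s \<notin> I" if "s \<in> carrier R - P" for n s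
    proof (induction n)
      case 0 then show ?case using that I by auto
    next
      case (Suc n)
      have "x [^] Suc n \<otimes> s = x \<otimes> (x [^] n \<otimes> s)" using xc that by (simp add: m_ac)
      then show ?case using nzd[of "x [^] n \<otimes> s"] Suc that xc by auto
    qed
    then show "I \<inter> T = {}" unfolding T_def by blast
  qed
  then obtain Q where Q: "primeideal Q R" "I \<subseteq> Q" "Q \<inter> T = {}" by blast
  interpret Q: primeideal Q R by fact
  have "s \<in> T" if "s \<in> carrier R - P" for s
  proof -
    have "s = x [^] (0::nat) \<otimes> s" using that by simp
    then show ?thesis unfolding T_def using that by blast
  qed
  then have "Q \<subseteq> P" using Q Q.Icarr by blast
  moreover have "x \<in> T"
  proof -
    have "x = x [^] (1::nat) \<otimes> \<one>" using xc by simp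
    then show ?thesis unfolding T_def using one by blast
  qed
  ultimately have "Q \<subset> P" using Q x by blast
  then show ?thesis using Q by blast
qed

text \<open>Otherwise \<open>ex_smaller_primeideal\<close> with the zero ideal would yield a prime
  strictly below \<open>P\<close>. This makes nonzerodivisors admissible multipliers in the
  definition of tight closure.\<close>

lemma (in cring) nonzerodivisor_notin_minimal_prime:
  assumes "minimal_prime R P" "x \<in> nonzerodivisors R"
  shows "x \<notin> P"
proof
  assume x: "x \<in> P"
  have "primeideal P R" using assms unfolding minimal_prime_def by blast
  then interpret P: primeideal P R .
  have "\<exists>Q. primeideal Q R \<and> {\<zero>} \<subseteq> Q \<and> Q \<subset> P"
    by (rule ex_smaller_primeideal[OF P.primeideal zeroideal _ x])
       (use assms in \<open>auto simp: nonzerodivisors_def P.zero_closed\<close>)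
  then show False using assms unfolding minimal_prime_def by blast
qed

text \<open>The sequence is consumed from its last element: it is a nonzerodivisor modulo the
  preceding ones, so \<open>P\<close> strictly contains a prime that still contains those. The chain
  ends at the prescribed \<open>P\<close>, as is needed for heights.\<close>

lemma (in cring) regular_sequence_prime_chain:
  assumes "set xs \<subseteq> carrier R"
    and "\<And>i r. i < length xs \<Longrightarrow> r \<in> carrier R \<Longrightarrow>
       xs ! i \<otimes> r \<in> Idl (set (take i xs)) \<Longrightarrow> r \<in> Idl (set (take i xs))"
    and "primeideal P R" "set xs \<subseteq> P"
  shows "\<exists>C. prime_chain R C (length xs) \<and> C (length xs) = P"
  using assms
proof (induction xs arbitrary: P rule: rev_induct)
  case Nil
  then show ?case by (intro exI[of _ "\<lambda>_. P"]) (auto simp: prime_chain_def)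
next
  case (snoc x xs)
  interpret P: primeideal P R by fact
  have xs: "set xs \<subseteq> carrier R" using snoc.prems by auto
  have idl: "ideal (Idl (set xs)) R" using genideal_ideal[OF xs] .
  have "\<exists>Q. primeideal Q R \<and> Idl (set xs) \<subseteq> Q \<and> Q \<subset> P"
  proof (rule ex_smaller_primeideal[OF P.primeideal idl])
    show "Idl (set xs) \<subseteq> P" using snoc.prems genideal_minimal[OF P.is_ideal] by auto
    show "x \<in> P" using snoc.prems by auto
    show "r \<in> Idl (set xs)" if "r \<in> carrier R" "x \<otimes> r \<in> Idl (set xs)" for r
      using snoc.prems(2)[of "length xs" r] that by simp
  qed
  then obtain Q where Q: "primeideal Q R" "Idl (set xs) \<subseteq> Q" "Q \<subset> P" by blast
  have "\<exists>C. prime_chain R C (length xs) \<and> C (length xs) = Q"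
  proof (rule snoc.IH[OF xs _ Q(1)])
    show "set xs \<subseteq> Q" using Q(2) genideal_self[OF xs] by blast
    show "r \<in> Idl (set (take i xs))" if "i < length xs" "r \<in> carrier R"
      "xs ! i \<otimes> r \<in> Idl (set (take i xs))" for i r
      using snoc.prems(2)[of i r] that by (simp add: nth_append)
  qed
  then obtain C where C: "prime_chain R C (length xs)" "C (length xs) = Q" by blast
  show ?case
    by (rule exI[of _ "\<lambda>i. if i \<le> length xs then C i else P"])
       (use C Q P.primeideal in \<open>auto simp: prime_chain_def not_less_eq_eq less_Suc_eq_le le_Suc_eq\<close>)
qed

lemma (in cring) regular_sequence_imp_chain:
  assumes "regular_sequence R xs"
  shows "\<exists>C. prime_chain R C (length xs)"
proof -
  have xs: "set xs \<subseteq> carrier R" "Idl (set xs) \<noteq> carrier R"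
    using assms unfolding regular_sequence_def by auto
  obtain P where P: "primeideal P R" "Idl (set xs) \<subseteq> P"
    using ex_primeideal_superset genideal_ideal xs by blast
  have "\<exists>C. prime_chain R C (length xs) \<and> C (length xs) = P"
    by (rule regular_sequence_prime_chain[OF xs(1) _ P(1)])
       (use assms P genideal_self[OF xs(1)] in \<open>auto simp: regular_sequence_def\<close>)
  then show ?thesis by blast
qed

lemma krull_dim_eqI:
  assumes "prime_chain R C n" "\<And>D m. prime_chain R D m \<Longrightarrow> m \<le> n"
  shows "krull_dim R = enat n"
  unfolding krull_dim_def
  by (rule Sup_eqI) (use assms in auto)

lemma prime_height_eqI:
  assumes "prime_chain R C n" "C n = P" "\<And>D m. prime_chain R D m \<Longrightarrow> m \<le> n"
  shows "prime_height R P = enat n"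
  unfolding prime_height_def
  by (rule Sup_eqI) (use assms in auto)


section \<open>Rings of fractions\<close>

locale fraction_ring = cring R for R (structure) +
  fixes T
  assumes T_sub: "T \<subseteq> carrier R" and T_one: "\<one> \<in> T"
    and T_mult: "s \<in> T \<Longrightarrow> t \<in> T \<Longrightarrow> s \<otimes> t \<in> T"
begin

abbreviation fr where "fr \<equiv> fraction R T"
abbreviation L where "L \<equiv> localization R T"
abbreviation loc where "loc \<equiv> localization_map R T"

lemma T_carrier [simp]: "t \<in> T \<Longrightarrow> t \<in> carrier R"
  using T_sub by blast

lemma fraction_refl: "r \<in> carrier R \<Longrightarrow> s \<in> T \<Longrightarrow> (r, s) \<in> fr r s"
  unfolding fraction_def using T_one by auto

lemma fraction_trans:
  assumes c: "r \<in> carrier R" "r' \<in> carrier R" "r'' \<in> carrier R" "s \<in> T" "s' \<in> T" "s'' \<in> T"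
    and t: "t \<in> T" "t \<otimes> (r \<otimes> s') = t \<otimes> (r' \<otimes> s)"
    and u: "u \<in> T" "u \<otimes> (r' \<otimes> s'') = u \<otimes> (r'' \<otimes> s')"
  shows "\<exists>v\<in>T. v \<otimes> (r \<otimes> s'') = v \<otimes> (r'' \<otimes> s)"
proof (intro bexI)
  \<comment> \<open>\<open>t\<close> and \<open>u\<close> witness the two given equalities; the
    middle denominator \<open>s'\<close> is needed to pass through both of them.\<close>
  show "t \<otimes> u \<otimes> s' \<in> T" using t u c T_mult by auto
  have "t \<otimes> u \<otimes> s' \<otimes> (r \<otimes> s'') = u \<otimes> s'' \<otimes> (t \<otimes> (r \<otimes> s'))"
    using c t(1) u(1) by (simp add: m_ac)
  also have "\<dots> = t \<otimes> s \<otimes> (u \<otimes> (r' \<otimes> s''))" unfolding t(2) using c t(1) u(1) by (simp add: m_ac)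
  also have "\<dots> = t \<otimes> u \<otimes> s' \<otimes> (r'' \<otimes> s)" unfolding u(2) using c t(1) u(1) by (simp add: m_ac)
  finally show "t \<otimes> u \<otimes> s' \<otimes> (r \<otimes> s'') = t \<otimes> u \<otimes> s' \<otimes> (r'' \<otimes> s)" .
qed

lemma fraction_eq:
  assumes "r \<in> carrier R" "r' \<in> carrier R" "s \<in> T" "s' \<in> T"
  shows "fr r s = fr r' s' \<longleftrightarrow> (\<exists>t\<in>T. t \<otimes> (r \<otimes> s') = t \<otimes> (r' \<otimes> s))" (is "?l \<longleftrightarrow> ?r")
proof
  assume ?l
  then have "(r', s') \<in> fr r s" using fraction_refl assms by simp
  then show ?r unfolding fraction_def by auto
next
  assume ?r
  then obtain t where t: "t \<in> T" "t \<otimes> (r \<otimes> s') = t \<otimes> (r' \<otimes> s)" by blast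
  have "(p, q) \<in> fr r s \<longleftrightarrow> (p, q) \<in> fr r' s'" for p q
  proof
    assume "(p, q) \<in> fr r s"
    then obtain u where "p \<in> carrier R" "q \<in> T" "u \<in> T" "u \<otimes> (r \<otimes> q) = u \<otimes> (p \<otimes> s)"
      unfolding fraction_def by auto
    then show "(p, q) \<in> fr r' s'"
      using fraction_trans[OF assms(2,1) _ assms(4,3), of p q t u] t unfolding fraction_def by auto
  next
    assume "(p, q) \<in> fr r' s'"
    then obtain u where "p \<in> carrier R" "q \<in> T" "u \<in> T" "u \<otimes> (r' \<otimes> q) = u \<otimes> (p \<otimes> s')"
      unfolding fraction_def by auto
    then show "(p, q) \<in> fr r s"
      using fraction_trans[OF assms(1,2) _ assms(3,4), of p q t u] t unfolding fraction_def by auto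
  qed
  then show ?l by auto
qed

lemma fraction_mem:
  assumes "r \<in> carrier R" "s \<in> T"
  shows "(r', s') \<in> fr r s \<longleftrightarrow> r' \<in> carrier R \<and> s' \<in> T \<and> fr r' s' = fr r s"
  using fraction_eq[OF assms(1) _ assms(2), of r' s'] unfolding fraction_def by auto

text \<open>The operations of \<open>localization\<close> are unions over all representatives. If
  every representative contributes the same set, the union collapses to it, since the given
  representative itself occurs.\<close>

lemma fraction_Union:
  assumes c: "r \<in> carrier R" "r' \<in> carrier R" "s \<in> T" "s' \<in> T"
    and g: "\<And>p q p' q'. p \<in> carrier R \<Longrightarrow> p' \<in> carrier R \<Longrightarrow> q \<in> T \<Longrightarrow> q' \<in> T \<Longrightarrow>
        fr p q = fr r s \<Longrightarrow> fr p' q' = fr r' s' \<Longrightarrow> g p q p' q' = g r s r' s'"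
  shows "(\<Union>(p, q)\<in>fr r s. \<Union>(p', q')\<in>fr r' s'. g p q p' q') = g r s r' s'" (is "?U = _")
proof
  have *: "g p q p' q' = g r s r' s'" if "(p, q) \<in> fr r s" "(p', q') \<in> fr r' s'" for p q p' q'
    using that g[of p p' q q'] by (simp add: fraction_mem c)
  show "?U \<subseteq> g r s r' s'" using * by auto
  have "(r, s) \<in> fr r s" "(r', s') \<in> fr r' s'" using fraction_refl c by auto
  then show "g r s r' s' \<subseteq> ?U" by blast
qed

lemma fraction_mult:
  assumes c: "r \<in> carrier R" "r' \<in> carrier R" "s \<in> T" "s' \<in> T"
  shows "fr r s \<otimes>\<^bsub>L\<^esub> fr r' s' = fr (r \<otimes> r') (s \<otimes> s')"
proof -
  have "fr (p \<otimes> p') (q \<otimes> q') = fr (r \<otimes> r') (s \<otimes> s')"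
    if d: "p \<in> carrier R" "p' \<in> carrier R" "q \<in> T" "q' \<in> T"
      and e: "fr p q = fr r s" "fr p' q' = fr r' s'" for p q p' q'
  proof -
    obtain t where t: "t \<in> T" "t \<otimes> (p \<otimes> s) = t \<otimes> (r \<otimes> q)"
      using e(1) fraction_eq[OF d(1) c(1) d(3) c(3)] by blast
    obtain u where u: "u \<in> T" "u \<otimes> (p' \<otimes> s') = u \<otimes> (r' \<otimes> q')"
      using e(2) fraction_eq[OF d(2) c(2) d(4) c(4)] by blast
    have "t \<otimes> u \<otimes> (p \<otimes> p' \<otimes> (s \<otimes> s')) = (t \<otimes> (p \<otimes> s)) \<otimes> (u \<otimes> (p' \<otimes> s'))"
      using c d t(1) u(1) by (simp add: m_ac)
    also have "\<dots> = t \<otimes> u \<otimes> (r \<otimes> r' \<otimes> (q \<otimes> q'))"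
      unfolding t(2) u(2) using c d t(1) u(1) by (simp add: m_ac)
    finally have "t \<otimes> u \<otimes> (p \<otimes> p' \<otimes> (s \<otimes> s')) = t \<otimes> u \<otimes> (r \<otimes> r' \<otimes> (q \<otimes> q'))" .
    then show ?thesis using c d t(1) u(1) T_mult by (subst fraction_eq) auto
  qed
  then show ?thesis unfolding localization_def
    using fraction_Union[OF c, of "\<lambda>p q p' q'. fr (p \<otimes> p') (q \<otimes> q')"] by simp
qed

lemma fraction_add:
  assumes c: "r \<in> carrier R" "r' \<in> carrier R" "s \<in> T" "s' \<in> T"
  shows "fr r s \<oplus>\<^bsub>L\<^esub> fr r' s' = fr (r \<otimes> s' \<oplus> r' \<otimes> s) (s \<otimes> s')"
proof -
  have "fr (p \<otimes> q' \<oplus> p' \<otimes> q) (q \<otimes> q') = fr (r \<otimes> s' \<oplus> r' \<otimes> s) (s \<otimes> s')"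
    if d: "p \<in> carrier R" "p' \<in> carrier R" "q \<in> T" "q' \<in> T"
      and e: "fr p q = fr r s" "fr p' q' = fr r' s'" for p q p' q'
  proof -
    obtain t where t: "t \<in> T" "t \<otimes> (p \<otimes> s) = t \<otimes> (r \<otimes> q)"
      using e(1) fraction_eq[OF d(1) c(1) d(3) c(3)] by blast
    obtain u where u: "u \<in> T" "u \<otimes> (p' \<otimes> s') = u \<otimes> (r' \<otimes> q')"
      using e(2) fraction_eq[OF d(2) c(2) d(4) c(4)] by blast
    have "t \<otimes> u \<otimes> ((p \<otimes> q' \<oplus> p' \<otimes> q) \<otimes> (s \<otimes> s'))
        = u \<otimes> q' \<otimes> s' \<otimes> (t \<otimes> (p \<otimes> s)) \<oplus> t \<otimes> q \<otimes> s \<otimes> (u \<otimes> (p' \<otimes> s'))"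
      using c d t(1) u(1) by (simp add: m_ac l_distr r_distr)
    also have "\<dots> = t \<otimes> u \<otimes> ((r \<otimes> s' \<oplus> r' \<otimes> s) \<otimes> (q \<otimes> q'))"
      unfolding t(2) u(2) using c d t(1) u(1) by (simp add: m_ac l_distr r_distr)
    finally have "t \<otimes> u \<otimes> ((p \<otimes> q' \<oplus> p' \<otimes> q) \<otimes> (s \<otimes> s'))
        = t \<otimes> u \<otimes> ((r \<otimes> s' \<oplus> r' \<otimes> s) \<otimes> (q \<otimes> q'))" .
    then show ?thesis using c d t(1) u(1) T_mult by (subst fraction_eq) auto
  qed
  then show ?thesis unfolding localization_def
    using fraction_Union[OF c, of "\<lambda>p q p' q'. fr (p \<otimes> q' \<oplus> p' \<otimes> q) (q \<otimes> q')"] by simp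
qed

lemma fraction_carrier: "carrier L = {fr r s | r s. r \<in> carrier R \<and> s \<in> T}"
  and fraction_one: "\<one>\<^bsub>L\<^esub> = fr \<one> \<one>" and fraction_zero: "\<zero>\<^bsub>L\<^esub> = fr \<zero> \<one>"
  by (simp_all add: localization_def)

lemma fraction_closed [simp]: "r \<in> carrier R \<Longrightarrow> s \<in> T \<Longrightarrow> fr r s \<in> carrier L"
  unfolding fraction_carrier by blast

lemma fraction_cases:
  assumes "u \<in> carrier L"
  obtains r s where "r \<in> carrier R" "s \<in> T" "u = fr r s"
  using assms unfolding fraction_carrier by blast

lemma fraction_eqI:
  assumes "r \<in> carrier R" "r' \<in> carrier R" "s \<in> T" "s' \<in> T" "r \<otimes> s' = r' \<otimes> s"
  shows "fr r s = fr r' s'"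
  using assms T_one by (subst fraction_eq) auto

lemma fraction_cancel:
  assumes "r \<in> carrier R" "s \<in> T" "t \<in> T"
  shows "fr (t \<otimes> r) (t \<otimes> s) = fr r s"
  using assms T_mult by (intro fraction_eqI) (auto simp: m_ac)

lemma cring_L: "cring L"
proof (rule cringI)
  show "abelian_group L"
  proof (rule abelian_groupI)
    fix u v assume "u \<in> carrier L" "v \<in> carrier L"
    then show "u \<oplus>\<^bsub>L\<^esub> v \<in> carrier L"
      by (elim fraction_cases) (auto simp: fraction_add T_mult)
  next
    show "\<zero>\<^bsub>L\<^esub> \<in> carrier L" by (simp add: fraction_zero T_one)
  next
    fix u v w assume "u \<in> carrier L" "v \<in> carrier L" "w \<in> carrier L"
    then show "u \<oplus>\<^bsub>L\<^esub> v \<oplus>\<^bsub>L\<^esub> w = u \<oplus>\<^bsub>L\<^esub> (v \<oplus>\<^bsub>L\<^esub> w)"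
      by (elim fraction_cases)
         (auto simp: fraction_add T_mult m_ac l_distr r_distr a_ac intro!: fraction_eqI)
  next
    fix u v assume "u \<in> carrier L" "v \<in> carrier L"
    then show "u \<oplus>\<^bsub>L\<^esub> v = v \<oplus>\<^bsub>L\<^esub> u"
      by (elim fraction_cases) (auto simp: fraction_add T_mult m_ac a_ac)
  next
    fix u assume "u \<in> carrier L"
    then show "\<zero>\<^bsub>L\<^esub> \<oplus>\<^bsub>L\<^esub> u = u"
      by (elim fraction_cases) (auto simp: fraction_add fraction_zero T_mult T_one)
  next
    fix u assume "u \<in> carrier L"
    then obtain r s where u: "r \<in> carrier R" "s \<in> T" "u = fr r s" by (elim fraction_cases)
    have "fr (\<ominus> r) s \<oplus>\<^bsub>L\<^esub> u = fr (\<ominus> r \<otimes> s \<oplus> r \<otimes> s) (s \<otimes> s)"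
      using u by (simp add: fraction_add)
    also have "\<dots> = \<zero>\<^bsub>L\<^esub>" unfolding fraction_zero
      using u by (intro fraction_eqI) (auto simp: T_mult T_one l_minus l_neg)
    finally show "\<exists>v\<in>carrier L. v \<oplus>\<^bsub>L\<^esub> u = \<zero>\<^bsub>L\<^esub>" using u by (intro bexI[of _ "fr (\<ominus> r) s"]) auto
  qed
  show "comm_monoid L"
  proof (rule comm_monoidI)
    fix u v assume "u \<in> carrier L" "v \<in> carrier L"
    then show "u \<otimes>\<^bsub>L\<^esub> v \<in> carrier L"
      by (elim fraction_cases) (auto simp: fraction_mult T_mult)
  next
    show "\<one>\<^bsub>L\<^esub> \<in> carrier L" by (simp add: fraction_one T_one)
  next
    fix u v w assume "u \<in> carrier L" "v \<in> carrier L" "w \<in> carrier L"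
    then show "u \<otimes>\<^bsub>L\<^esub> v \<otimes>\<^bsub>L\<^esub> w = u \<otimes>\<^bsub>L\<^esub> (v \<otimes>\<^bsub>L\<^esub> w)"
      by (elim fraction_cases) (auto simp: fraction_mult T_mult m_ac)
  next
    fix u assume "u \<in> carrier L"
    then show "\<one>\<^bsub>L\<^esub> \<otimes>\<^bsub>L\<^esub> u = u"
      by (elim fraction_cases) (auto simp: fraction_mult fraction_one T_mult T_one)
  next
    fix u v assume "u \<in> carrier L" "v \<in> carrier L"
    then show "u \<otimes>\<^bsub>L\<^esub> v = v \<otimes>\<^bsub>L\<^esub> u"
      by (elim fraction_cases) (auto simp: fraction_mult T_mult m_ac)
  qed
  fix u v w assume "u \<in> carrier L" "v \<in> carrier L" "w \<in> carrier L"
  then obtain r s p q k l where c: "r \<in> carrier R" "s \<in> T" "p \<in> carrier R" "q \<in> T" "k \<in> carrier R" "l \<in> T"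
    and u: "u = fr r s" "v = fr p q" "w = fr k l" by (metis fraction_cases)
  have "(u \<oplus>\<^bsub>L\<^esub> v) \<otimes>\<^bsub>L\<^esub> w = fr ((r \<otimes> q \<oplus> p \<otimes> s) \<otimes> k) ((s \<otimes> q) \<otimes> l)"
    using c unfolding u by (simp add: fraction_add fraction_mult T_mult)
  also have "\<dots> = fr ((r \<otimes> k) \<otimes> (q \<otimes> l) \<oplus> (p \<otimes> k) \<otimes> (s \<otimes> l)) ((s \<otimes> l) \<otimes> (q \<otimes> l))"
    using c by (intro fraction_eqI) (auto simp: T_mult m_ac l_distr r_distr)
  also have "\<dots> = u \<otimes>\<^bsub>L\<^esub> w \<oplus>\<^bsub>L\<^esub> v \<otimes>\<^bsub>L\<^esub> w"
    using c unfolding u by (simp add: fraction_add fraction_mult T_mult)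
  finally show "(u \<oplus>\<^bsub>L\<^esub> v) \<otimes>\<^bsub>L\<^esub> w = u \<otimes>\<^bsub>L\<^esub> w \<oplus>\<^bsub>L\<^esub> v \<otimes>\<^bsub>L\<^esub> w" .
qed

sublocale L: cring L by (rule cring_L)

lemma loc_def: "loc r = fr r \<one>" by (simp add: localization_map_def)

lemma loc_hom: "loc \<in> ring_hom R L"
  by (rule ring_hom_memI)
     (auto simp: loc_def fraction_mult fraction_add fraction_one T_one)

sublocale loc: ring_hom_cring R L loc
  by unfold_locales (rule loc_hom)

lemma fraction_eq_loc:
  assumes "r \<in> carrier R" "s \<in> T"
  shows "fr r s = loc r \<otimes>\<^bsub>L\<^esub> fr \<one> s" "fr r s \<otimes>\<^bsub>L\<^esub> loc s = loc r"
proof -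
  show "fr r s = loc r \<otimes>\<^bsub>L\<^esub> fr \<one> s"
    using assms T_one by (simp add: loc_def fraction_mult)
  have "fr r s \<otimes>\<^bsub>L\<^esub> loc s = fr (r \<otimes> s) s" using assms T_one by (simp add: loc_def fraction_mult)
  also have "\<dots> = loc r" unfolding loc_def using assms T_one by (intro fraction_eqI) auto
  finally show "fr r s \<otimes>\<^bsub>L\<^esub> loc s = loc r" .
qed

lemma fraction_eq_zero:
  assumes "r \<in> carrier R" "s \<in> T"
  shows "fr r s = \<zero>\<^bsub>L\<^esub> \<longleftrightarrow> (\<exists>t\<in>T. t \<otimes> r = \<zero>)"
  using assms T_one by (simp add: fraction_zero fraction_eq)

lemma fraction_pow:
  assumes "r \<in> carrier R" "s \<in> T"
  shows "s [^] (n::nat) \<in> T" "fr r s [^]\<^bsub>L\<^esub> n = fr (r [^] n) (s [^] n)"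
proof -
  show *: "s [^] (n::nat) \<in> T" for n by (induction n) (use assms T_one T_mult in auto)
  show "fr r s [^]\<^bsub>L\<^esub> n = fr (r [^] n) (s [^] n)"
    by (induction n) (use assms * in \<open>auto simp: fraction_mult fraction_one\<close>)
qed

subsection \<open>Extension and contraction of ideals\<close>

definition ext :: "'a set \<Rightarrow> ('a \<times> 'a) set set" where
  "ext I = {fr r s | r s. r \<in> I \<and> s \<in> T}"

definition contr :: "('a \<times> 'a) set set \<Rightarrow> 'a set" where
  "contr J = {r \<in> carrier R. loc r \<in> J}"

text \<open>The multiplier \<open>t\<close> accounts for the other representatives: the fraction may
  have a numerator in \<open>I\<close> without the given numerator being in
  \<open>I\<close>.\<close>

lemma fraction_mem_ext:
  assumes I: "ideal I R" and c: "r \<in> carrier R" "s \<in> T"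
  shows "fr r s \<in> ext I \<longleftrightarrow> (\<exists>t\<in>T. t \<otimes> r \<in> I)"
proof
  interpret I: ideal I R by fact
  assume "fr r s \<in> ext I"
  then obtain p q where p: "p \<in> I" "q \<in> T" "fr r s = fr p q" unfolding ext_def by auto
  then obtain t where t: "t \<in> T" "t \<otimes> (r \<otimes> q) = t \<otimes> (p \<otimes> s)"
    using c I.Icarr by (auto simp: fraction_eq)
  have "(t \<otimes> q) \<otimes> r = (t \<otimes> s) \<otimes> p"
    using t p c I.Icarr[OF p(1)] by (simp add: m_ac)
  also have "\<dots> \<in> I" using t p c by (intro I.I_l_closed) auto
  finally show "\<exists>t\<in>T. t \<otimes> r \<in> I" using T_mult[OF t(1) p(2)] by blast
next
  assume "\<exists>t\<in>T. t \<otimes> r \<in> I"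
  then obtain t where t: "t \<in> T" "t \<otimes> r \<in> I" by blast
  have "fr r s = fr (t \<otimes> r) (t \<otimes> s)" using fraction_cancel[of r s t] c t by simp
  then show "fr r s \<in> ext I"
    unfolding ext_def using t(2) T_mult[OF t(1) c(2)] by blast
qed

lemma ideal_ext:
  assumes I: "ideal I R"
  shows "ideal (ext I) L"
proof -
  interpret I: ideal I R by fact
  have mult: "u \<otimes>\<^bsub>L\<^esub> v \<in> ext I" if u: "u \<in> ext I" and v: "v \<in> carrier L" for u v
  proof -
    obtain r s where r: "r \<in> I" "s \<in> T" "u = fr r s" using u unfolding ext_def by blast
    obtain p q where p: "p \<in> carrier R" "q \<in> T" "v = fr p q" using v by (elim fraction_cases)
    have "u \<otimes>\<^bsub>L\<^esub> v = fr (r \<otimes> p) (s \<otimes> q)" using r p I.Icarr[OF r(1)] by (simp add: fraction_mult)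
    then show ?thesis using I.I_r_closed[OF r(1) p(1)] T_mult[OF r(2) p(2)] unfolding ext_def by blast
  qed
  show ?thesis
  proof (rule L.ideal_of_mult_closed)
    show "ext I \<subseteq> carrier L" unfolding ext_def using I.Icarr by auto
    show "\<zero>\<^bsub>L\<^esub> \<in> ext I" unfolding ext_def fraction_zero using I.zero_closed T_one by blast
    fix u v assume "u \<in> ext I" "v \<in> ext I"
    then obtain r s p q where r: "r \<in> I" "s \<in> T" "u = fr r s" and p: "p \<in> I" "q \<in> T" "v = fr p q"
      unfolding ext_def by blast
    have "r \<otimes> q \<oplus> p \<otimes> s \<in> I" using r p by (intro I.a_closed I.I_r_closed) auto
    then show "u \<oplus>\<^bsub>L\<^esub> v \<in> ext I"
      using r p I.Icarr T_mult unfolding ext_def by (auto simp: fraction_add)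
  qed (rule mult)
qed

lemma ideal_contr:
  assumes "ideal J L"
  shows "ideal (contr J) R"
  using loc.ring.ideal_vimage[OF assms] unfolding contr_def by simp

lemma fraction_mem_iff_contr:
  assumes J: "ideal J L" and c: "r \<in> carrier R" "s \<in> T"
  shows "fr r s \<in> J \<longleftrightarrow> r \<in> contr J"
proof -
  interpret J: ideal J L by fact
  show ?thesis
    using J.I_r_closed[of "fr r s" "loc s"] J.I_r_closed[of "loc r" "fr \<one> s"] c
      fraction_eq_loc[OF c] T_one unfolding contr_def by auto
qed

text \<open>Every ideal of the localization is determined by its contraction. Through this, finite
  generation and strict inclusions pass between \<open>R\<close> and \<open>L\<close>.\<close>

lemma ext_contr:
  assumes J: "ideal J L"
  shows "ext (contr J) = J"
proof -
  interpret J: ideal J L by fact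
  have c: "r \<in> contr J \<Longrightarrow> r \<in> carrier R" for r unfolding contr_def by simp
  show ?thesis
  proof
    show "ext (contr J) \<subseteq> J" unfolding ext_def using fraction_mem_iff_contr[OF J] c by auto
    show "J \<subseteq> ext (contr J)"
    proof
      fix u assume u: "u \<in> J"
      then obtain r s where "r \<in> carrier R" "s \<in> T" "u = fr r s"
        using fraction_cases[OF J.Icarr[OF u]] by blast
      then show "u \<in> ext (contr J)" using u fraction_mem_iff_contr[OF J] unfolding ext_def by auto
    qed
  qed
qed

lemma genideal_loc:
  assumes A: "A \<subseteq> carrier R"
  shows "Idl\<^bsub>L\<^esub> (loc ` A) = ext (Idl A)"
proof
  have lA: "loc ` A \<subseteq> carrier L" using A by auto
  have idl: "ideal (Idl A) R" by (rule genideal_ideal[OF A])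
  show "Idl\<^bsub>L\<^esub> (loc ` A) \<subseteq> ext (Idl A)"
    by (rule L.genideal_minimal[OF ideal_ext[OF idl]])
       (use genideal_self[OF A] T_one in \<open>auto simp: ext_def loc_def\<close>)
  have idL: "ideal (Idl\<^bsub>L\<^esub> (loc ` A)) L" by (rule L.genideal_ideal[OF lA])
  have "Idl A \<subseteq> contr (Idl\<^bsub>L\<^esub> (loc ` A))"
    by (rule genideal_minimal[OF ideal_contr[OF idL]])
       (use A L.genideal_self[OF lA] in \<open>auto simp: contr_def\<close>)
  then have "ext (Idl A) \<subseteq> ext (contr (Idl\<^bsub>L\<^esub> (loc ` A)))" unfolding ext_def by blast
  then show "ext (Idl A) \<subseteq> Idl\<^bsub>L\<^esub> (loc ` A)" using ext_contr[OF idL] by simp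
qed

lemma noetherian_L:
  assumes "noetherian_ring R"
  shows "noetherian_ring L"
proof (rule L.noetherian_ringI)
  fix J assume J: "ideal J L"
  obtain A where A: "A \<subseteq> carrier R" "finite A" "contr J = Idl A"
    using noetherian_ring.finetely_gen[OF assms ideal_contr[OF J]] by blast
  then have "J = Idl\<^bsub>L\<^esub> (loc ` A)" using genideal_loc ext_contr[OF J] by simp
  then show "\<exists>A\<subseteq>carrier L. finite A \<and> J = Idl\<^bsub>L\<^esub> A"
    using A by (intro exI[of _ "loc ` A"]) auto
qed

lemma primeideal_contr:
  assumes "primeideal P L"
  shows "primeideal (contr P) R"
proof -
  interpret P: primeideal P L by fact
  show ?thesis
  proof (rule primeidealI[OF ideal_contr[OF P.is_ideal] is_cring])
    have "\<one> \<notin> contr P" unfolding contr_def using P.I_notcarr P.one_imp_carrier by auto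
    then show "carrier R \<noteq> contr P" by auto
    fix a b assume "a \<in> carrier R" "b \<in> carrier R" "a \<otimes> b \<in> contr P"
    then show "a \<in> contr P \<or> b \<in> contr P"
      unfolding contr_def using P.I_prime[of "loc a" "loc b"] by auto
  qed
qed

text \<open>Contraction keeps inclusions strict because \<open>ext\<close> recovers the ideals; so a
  bound on chains in \<open>R\<close> bounds those in every localization.\<close>

lemma prime_chain_contr:
  assumes "prime_chain L C n"
  shows "prime_chain R (\<lambda>i. contr (C i)) n"
  unfolding prime_chain_def
proof (intro conjI allI impI)
  have id: "ideal (C i) L" if "i \<le> n" for i
    using assms that unfolding prime_chain_def primeideal_def by blast
  show "primeideal (contr (C i)) R" if "i \<le> n" for i
    using assms that primeideal_contr unfolding prime_chain_def by blast
  fix i assume i: "i < n"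
  then have "C i \<subset> C (Suc i)" using assms unfolding prime_chain_def by blast
  moreover have "contr (C i) \<noteq> contr (C (Suc i))"
  proof
    assume "contr (C i) = contr (C (Suc i))"
    then have "ext (contr (C i)) = ext (contr (C (Suc i)))" by simp
    then have "C i = C (Suc i)"
      using ext_contr[OF id[of i]] ext_contr[OF id[of "Suc i"]] i by simp
    then show False using \<open>C i \<subset> C (Suc i)\<close> by simp
  qed
  ultimately show "contr (C i) \<subset> contr (C (Suc i))" unfolding contr_def by auto
qed

lemma domain_L:
  assumes "domain R" "\<zero> \<notin> T"
  shows "domain L"
proof (rule domainI[OF cring_L])
  interpret domain R by fact
  show "\<one>\<^bsub>L\<^esub> \<noteq> \<zero>\<^bsub>L\<^esub>"
    using fraction_eq_zero[of \<one> \<one>] T_one assms(2) by (auto simp: fraction_one)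
  fix u v assume uv: "u \<otimes>\<^bsub>L\<^esub> v = \<zero>\<^bsub>L\<^esub>" "u \<in> carrier L" "v \<in> carrier L"
  then obtain r s p q where r: "r \<in> carrier R" "s \<in> T" "u = fr r s"
    and p: "p \<in> carrier R" "q \<in> T" "v = fr p q" by (metis fraction_cases)
  then obtain t where "t \<in> T" "t \<otimes> (r \<otimes> p) = \<zero>"
    using uv(1) by (auto simp: fraction_mult fraction_eq_zero T_mult)
  then have "r = \<zero> \<or> p = \<zero>" using r p assms(2) integral[of t "r \<otimes> p"] integral[of r p] by auto
  then show "u = \<zero>\<^bsub>L\<^esub> \<or> v = \<zero>\<^bsub>L\<^esub>"
    using r p T_one by (auto simp: fraction_eq_zero intro!: bexI[of _ \<one>])
qed

end

lemma fraction_ring_nonzerodivisors: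
  assumes "cring R"
  shows "fraction_ring R (nonzerodivisors R)"
proof -
  interpret cring R by fact
  show ?thesis
  proof unfold_locales
    show "nonzerodivisors R \<subseteq> carrier R" unfolding nonzerodivisors_def by blast
    have "r = \<zero>\<^bsub>R\<^esub>" if "r \<in> carrier R" "\<one>\<^bsub>R\<^esub> \<otimes>\<^bsub>R\<^esub> r = \<zero>\<^bsub>R\<^esub>" for r
      using that(2) unfolding l_one[OF that(1)] .
    then show "\<one>\<^bsub>R\<^esub> \<in> nonzerodivisors R" unfolding nonzerodivisors_def using one_closed by blast
    fix s t assume st: "s \<in> nonzerodivisors R" "t \<in> nonzerodivisors R"
    have "r = \<zero>\<^bsub>R\<^esub>" if "r \<in> carrier R" "s \<otimes>\<^bsub>R\<^esub> t \<otimes>\<^bsub>R\<^esub> r = \<zero>\<^bsub>R\<^esub>" for r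
    proof -
      have "s \<otimes>\<^bsub>R\<^esub> (t \<otimes>\<^bsub>R\<^esub> r) = \<zero>\<^bsub>R\<^esub>" using that st m_assoc[of s t r] unfolding nonzerodivisors_def by (metis (no_types, lifting) mem_Collect_eq)
      then show ?thesis using st that(1) m_closed[of t r] unfolding nonzerodivisors_def by blast
    qed
    then show "s \<otimes>\<^bsub>R\<^esub> t \<in> nonzerodivisors R"
      using st m_closed unfolding nonzerodivisors_def by blast
  qed
qed

subsection \<open>Localization at a prime ideal\<close>

locale local_fraction_ring = cring R + P: primeideal P R for R (structure) and P
begin

sublocale fraction_ring R "carrier R - P"
proof unfold_locales
  show "\<one> \<in> carrier R - P" using P.I_notcarr P.one_imp_carrier by blast
  show "s \<otimes> t \<in> carrier R - P" if "s \<in> carrier R - P" "t \<in> carrier R - P" for s t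
    using that P.I_prime by auto
qed auto

lemma fraction_mem_ext_P:
  assumes "r \<in> carrier R" "s \<in> carrier R - P"
  shows "fr r s \<in> ext P \<longleftrightarrow> r \<in> P"
  using assms P.I_prime T_one by (auto simp: fraction_mem_ext[OF P.is_ideal] intro!: bexI[of _ \<one>])

text \<open>A fraction whose numerator lies outside \<open>P\<close> is a unit: exchange numerator
  and denominator.\<close>

lemma ideal_L_proper:
  assumes J: "ideal J L" "J \<noteq> carrier L"
  shows "J \<subseteq> ext P"
proof
  interpret J: ideal J L by fact
  fix u assume u: "u \<in> J"
  then obtain r s where r: "r \<in> carrier R" "s \<in> carrier R - P" "u = fr r s"
    using fraction_cases[OF J.Icarr[OF u]] by blast
  show "u \<in> ext P"
  proof (rule ccontr)
    assume "u \<notin> ext P"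
    then have rP: "r \<in> carrier R - P" using fraction_mem_ext_P r by auto
    have "u \<otimes>\<^bsub>L\<^esub> fr s r = fr (r \<otimes> s) (s \<otimes> r)" using r rP by (simp add: fraction_mult)
    also have "\<dots> = \<one>\<^bsub>L\<^esub>"
      unfolding fraction_one using r rP T_mult T_one by (intro fraction_eqI) (auto simp: m_ac)
    finally have "u \<otimes>\<^bsub>L\<^esub> fr s r = \<one>\<^bsub>L\<^esub>" .
    moreover have "u \<otimes>\<^bsub>L\<^esub> fr s r \<in> J" using u rP r by (intro J.I_r_closed) auto
    ultimately show False using J.one_imp_carrier J(2) by simp
  qed
qed

lemma ext_P_proper: "ext P \<noteq> carrier L"
proof
  assume "ext P = carrier L"
  then have "fr \<one> \<one> \<in> ext P" using fraction_closed[OF one_closed T_one] by blast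
  then have "\<one> \<in> P" using fraction_mem_ext_P[OF one_closed T_one] by blast
  then show False using T_one by blast
qed

lemma maximalideal_L_iff: "maximalideal M L \<longleftrightarrow> M = ext P"
proof
  have id: "ideal (ext P) L" by (rule ideal_ext[OF P.is_ideal])
  assume "maximalideal M L"
  then interpret M: maximalideal M L .
  have "M \<subseteq> ext P" using ideal_L_proper M.is_ideal M.I_notcarr by blast
  moreover have "ext P \<subseteq> carrier L" using ideal.Icarr[OF id] by blast
  ultimately show "M = ext P"
    using M.I_maximal[OF id] ext_P_proper by blast
next
  have id: "ideal (ext P) L" by (rule ideal_ext[OF P.is_ideal])
  assume "M = ext P"
  moreover have "maximalideal (ext P) L"
  proof (rule maximalidealI[OF id])
    show "carrier L \<noteq> ext P" using ext_P_proper by (rule not_sym)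
    fix J assume "ideal J L" "ext P \<subseteq> J" "J \<subseteq> carrier L"
    then show "J = ext P \<or> J = carrier L" using ideal_L_proper by blast
  qed
  ultimately show "maximalideal M L" by simp
qed

lemma max_ideal_L: "max_ideal L = ext P"
  unfolding max_ideal_def maximalideal_L_iff by simp

lemma local_ring_L:
  assumes "noetherian_ring R"
  shows "local_ring L"
  using cring_L noetherian_L[OF assms] by (simp add: local_ring_def maximalideal_L_iff)

lemma primeideal_ext_P: "primeideal (ext P) L"
  by (rule L.maximalideal_prime) (simp add: maximalideal_L_iff)

end


section \<open>A criterion for two-dimensional Cohen--Macaulay localizations\<close>

lemma (in ring) genideal_empty: "Idl {} = {\<zero>}"
proof
  show "Idl {} \<subseteq> {\<zero>}" by (rule genideal_minimal[OF zeroideal]) simp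
  show "{\<zero>} \<subseteq> Idl {}"
    using additive_subgroup.zero_closed[OF ideal.axioms(1)[OF genideal_ideal[of "{}"]]] by simp
qed

text \<open>The pair bounds depth and dimension from below by 2. Chains of primes bound both from
  above: the dimension by contraction to \<open>R\<close>, the depth because a regular sequence
  yields a chain of its length. The chain in \<open>R\<close> is recorded because it also gives the
  dimension of \<open>R\<close>.\<close>

lemma (in local_fraction_ring) regular_pair_localization:
  assumes noeth: "noetherian_ring R" and dim: "\<And>C n. prime_chain R C n \<Longrightarrow> n \<le> 2"
    and f: "f \<in> P" "\<And>r. r \<in> carrier R \<Longrightarrow> f \<otimes> r = \<zero> \<Longrightarrow> r = \<zero>"
    and g: "g \<in> P" "\<And>r. r \<in> carrier R \<Longrightarrow> g \<otimes> r \<in> Idl {f} \<Longrightarrow> r \<in> Idl {f}"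
  shows "krull_dim L = 2" "cohen_macaulay_local L" "prime_height L (ext P) = 2"
    "\<exists>C. prime_chain R C 2"
proof -
  have fg: "f \<in> carrier R" "g \<in> carrier R" using f g P.Icarr by auto
  have If: "ideal (Idl {f}) R" using genideal_ideal fg by simp
  have sub: "{loc f, loc g} \<subseteq> ext P"
    using f(1) g(1) fg fraction_mem_ext_P[of _ \<one>] T_one by (simp add: loc_def)
  have max: "max_ideal L = ext P" by (rule max_ideal_L)
  have Idf: "Idl\<^bsub>L\<^esub> {loc f} = ext (Idl {f})" using genideal_loc[of "{f}"] fg by simp
  have nz: "u = \<zero>\<^bsub>L\<^esub>" if u: "u \<in> carrier L" "loc f \<otimes>\<^bsub>L\<^esub> u = \<zero>\<^bsub>L\<^esub>" for u
  proof -
    obtain r s where r: "r \<in> carrier R" "s \<in> carrier R - P" "u = fr r s"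
      using fraction_cases[OF u(1)] by blast
    have "fr (f \<otimes> r) s = \<zero>\<^bsub>L\<^esub>"
      using u(2) r fg T_one fraction_mult[of f r \<one> s] by (simp add: loc_def)
    then obtain t where t: "t \<in> carrier R - P" "t \<otimes> (f \<otimes> r) = \<zero>"
      using fraction_eq_zero[of "f \<otimes> r" s] r fg by auto
    have "f \<otimes> (t \<otimes> r) = t \<otimes> (f \<otimes> r)" using t(1) r fg by (simp add: m_ac)
    then have "t \<otimes> r = \<zero>" using f(2)[of "t \<otimes> r"] t r by simp
    then show ?thesis using fraction_eq_zero[of r s] r t(1) by auto
  qed
  have gz: "u \<in> ext (Idl {f})" if u: "u \<in> carrier L" "loc g \<otimes>\<^bsub>L\<^esub> u \<in> ext (Idl {f})" for u
  proof -
    obtain r s where r: "r \<in> carrier R" "s \<in> carrier R - P" "u = fr r s"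
      using fraction_cases[OF u(1)] by blast
    have "fr (g \<otimes> r) s \<in> ext (Idl {f})"
      using u(2) r fg T_one fraction_mult[of g r \<one> s] by (simp add: loc_def)
    then obtain t where t: "t \<in> carrier R - P" "t \<otimes> (g \<otimes> r) \<in> Idl {f}"
      using fraction_mem_ext[OF If, of "g \<otimes> r" s] r fg by auto
    have "g \<otimes> (t \<otimes> r) = t \<otimes> (g \<otimes> r)" using t(1) r fg by (simp add: m_ac)
    then have "t \<otimes> r \<in> Idl {f}" using g(2)[of "t \<otimes> r"] t r by simp
    then show ?thesis using fraction_mem_ext[OF If, of r s] r t(1) by auto
  qed
  have reg: "r \<in> Idl\<^bsub>L\<^esub> (set (take i [loc f, loc g]))"
    if il: "i < length [loc f, loc g]" and "r \<in> carrier L"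
      "[loc f, loc g] ! i \<otimes>\<^bsub>L\<^esub> r \<in> Idl\<^bsub>L\<^esub> (set (take i [loc f, loc g]))" for i r
  proof -
    consider "i = 0" | "i = 1" using il by (auto simp: less_Suc_eq)
    then show ?thesis
    proof cases
      case 1
      then show ?thesis using that nz[of r] by (simp add: L.genideal_empty)
    next
      case 2
      then show ?thesis using that gz[of r] Idf by simp
    qed
  qed
  have carr: "set [loc f, loc g] \<subseteq> carrier L" using fg by simp
  have "\<exists>C. prime_chain L C (length [loc f, loc g]) \<and> C (length [loc f, loc g]) = ext P"
    using sub by (intro L.regular_sequence_prime_chain[OF carr reg primeideal_ext_P]) auto
  then obtain C where C: "prime_chain L C 2" "C 2 = ext P" by (auto simp: numeral_2_eq_2)
  have bound: "n \<le> 2" if "prime_chain L D n" for D n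
    using dim[OF prime_chain_contr[OF that]] .
  show kd: "krull_dim L = 2" using krull_dim_eqI[OF C(1) bound] by (simp add: numeral_eq_enat)
  show "prime_height L (ext P) = 2" using prime_height_eqI[OF C bound] by (simp add: numeral_eq_enat)
  show "\<exists>C. prime_chain R C 2" using prime_chain_contr[OF C(1)] by blast
  have idl: "ideal (ext P) L" by (rule ideal_ext[OF P.is_ideal])
  have "Idl\<^bsub>L\<^esub> (set [loc f, loc g]) \<subseteq> ext P"
    using sub by (intro L.genideal_minimal[OF idl]) auto
  then have "Idl\<^bsub>L\<^esub> (set [loc f, loc g]) \<noteq> carrier L"
    using ext_P_proper ideal.Icarr[OF idl] by (metis subsetI subset_antisym)
  then have "regular_sequence L [loc f, loc g]"
    unfolding regular_sequence_def using carr reg by blast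
  moreover have "n \<le> 2" if "regular_sequence L xs" "length xs = n" for xs n
    using L.regular_sequence_imp_chain[OF that(1)] bound that(2) by blast
  moreover have "set [loc f, loc g] \<subseteq> ext P" "enat 2 = enat (length [loc f, loc g])"
    using sub by auto
  ultimately have "depth L = enat 2"
    unfolding depth_def max
    by (intro Sup_eqI) (blast | force)+
  then show "cohen_macaulay_local L"
    unfolding cohen_macaulay_local_def using kd local_ring_L[OF noeth] by (simp add: numeral_eq_enat)
qed


alias degree = Polynomial.degree
alias order = Polynomial.order
alias lead_coeff = Polynomial.lead_coeff

section \<open>The basis theorem\<close>

text \<open>The ascending chain condition for the ideals generated by the initial segments of a
  sequence; it is equivalent to being Noetherian.\<close>

definition noeth :: "'a::comm_ring_1 itself \<Rightarrow> bool" where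
  "noeth _ \<longleftrightarrow> (\<forall>a :: nat \<Rightarrow> 'a. \<exists>n u. a n = (\<Sum>j<n. u j * a j))"

lemma noeth_field: "noeth TYPE('k::field)"
  unfolding noeth_def
proof
  fix a :: "nat \<Rightarrow> 'k"
  show "\<exists>n u. a n = (\<Sum>j<n. u j * a j)"
  proof (cases "a 0 = 0")
    case True
    then show ?thesis by (intro exI[of _ 0]) simp
  next
    case False
    then show ?thesis by (intro exI[of _ 1] exI[of _ "\<lambda>_. a 1 / a 0"]) simp
  qed
qed

definition initial_ideal :: "(nat \<Rightarrow> 'a::comm_ring_1) \<Rightarrow> nat \<Rightarrow> 'a set" where
  "initial_ideal f n = {\<Sum>j<n. u j * f j | u. True}"

lemma initial_idealI: "(\<Sum>j<n. u j * f j) \<in> initial_ideal f n"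
  unfolding initial_ideal_def by blast

lemma initial_ideal_add: "s \<in> initial_ideal f n \<Longrightarrow> t \<in> initial_ideal f n \<Longrightarrow> s + t \<in> initial_ideal f n"
proof -
  assume "s \<in> initial_ideal f n" "t \<in> initial_ideal f n"
  then obtain u v where "s = (\<Sum>j<n. u j * f j)" "t = (\<Sum>j<n. v j * f j)" by (auto simp: initial_ideal_def)
  then have "s + t = (\<Sum>j<n. (u j + v j) * f j)" by (simp add: sum.distrib distrib_right)
  then show ?thesis by (metis initial_idealI)
qed

lemma initial_ideal_mult: "s \<in> initial_ideal f n \<Longrightarrow> c * s \<in> initial_ideal f n"
proof -
  assume "s \<in> initial_ideal f n"
  then obtain u where "s = (\<Sum>j<n. u j * f j)" by (auto simp: initial_ideal_def)
  then have "c * s = (\<Sum>j<n. (c * u j) * f j)" by (simp add: sum_distrib_left mult.assoc)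
  then show ?thesis by (metis initial_idealI)
qed

lemma initial_ideal_zero: "0 \<in> initial_ideal f n"
  unfolding initial_ideal_def by (auto intro!: exI[of _ "\<lambda>_. 0"])

lemma initial_ideal_sum: "(\<And>j. j < (m::nat) \<Longrightarrow> s j \<in> initial_ideal f n) \<Longrightarrow> (\<Sum>j<m. s j) \<in> initial_ideal f n"
  by (induction m) (auto simp: initial_ideal_zero intro: initial_ideal_add)

lemma initial_ideal_mono: "m \<le> n \<Longrightarrow> initial_ideal f m \<subseteq> initial_ideal f n"
proof
  fix s assume "m \<le> n" "s \<in> initial_ideal f m"
  then obtain u where "s = (\<Sum>j<m. u j * f j)" by (auto simp: initial_ideal_def)
  also have "\<dots> = (\<Sum>j<n. (if j < m then u j else 0) * f j)"
    using \<open>m \<le> n\<close> by (intro sum.mono_neutral_cong_left) auto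
  finally show "s \<in> initial_ideal f n" by (metis initial_idealI)
qed

lemma initial_ideal_self: "j < n \<Longrightarrow> f j \<in> initial_ideal f n"
proof -
  assume j: "j < n"
  have "(\<Sum>i<n. (if i = j then 1 else 0) * f i) = (\<Sum>i<n. if i = j then f i else 0)"
    by (rule sum.cong) auto
  then have "f j = (\<Sum>i<n. (if i = j then 1 else 0) * f i)" using j by simp
  then show ?thesis by (metis initial_idealI)
qed

lemma initial_ideal_subset:
  "(\<And>j. j < m \<Longrightarrow> f j \<in> initial_ideal g n) \<Longrightarrow> initial_ideal f m \<subseteq> initial_ideal g n"
  by (auto simp: initial_ideal_def[of f m] intro!: initial_ideal_sum initial_ideal_mult)

lemma initial_ideal_cong: "(\<And>j. j < n \<Longrightarrow> f j = g j) \<Longrightarrow> initial_ideal f n = initial_ideal g n"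
  unfolding initial_ideal_def by (metis (no_types, lifting) lessThan_iff sum.cong)

text \<open>Hilbert's argument: in an ideal which is not finitely generated choose successively elements of
  minimal degree outside the ideal generated by the previous ones; a relation between their leading
  coefficients lowers the degree.\<close>

lemma noeth_poly:
  assumes "noeth TYPE('a::comm_ring_1)"
  shows "noeth TYPE('a poly)"
proof (rule ccontr)
  assume "\<not> ?thesis"
  then obtain g :: "nat \<Rightarrow> 'a poly" where g: "\<And>n. g n \<notin> initial_ideal g n"
    unfolding noeth_def initial_ideal_def by fastforce
  define I where "I = (\<Union>n. initial_ideal g n)"
  have I_add: "s + t \<in> I" if st: "s \<in> I" "t \<in> I" for s t
  proof -
    obtain m n where "s \<in> initial_ideal g m" "t \<in> initial_ideal g n" using st by (auto simp: I_def)
    then have "s + t \<in> initial_ideal g (max m n)"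
      using initial_ideal_mono[of m "max m n" g] initial_ideal_mono[of n "max m n" g]
      by (intro initial_ideal_add) auto
    then show ?thesis unfolding I_def by blast
  qed
  have I_mult: "c * s \<in> I" if "s \<in> I" for c s
    using that initial_ideal_mult unfolding I_def by blast
  define Q where "Q f n r \<longleftrightarrow> r \<in> I \<and> r \<notin> initial_ideal f n \<and>
      (\<forall>s. s \<in> I \<and> s \<notin> initial_ideal f n \<longrightarrow> degree r \<le> degree s)" for f n r
  have "\<exists>f. \<forall>n. Q f n (f n)"
  proof (rule dependent_wellorder_choice)
    fix r and f h :: "nat \<Rightarrow> 'a poly" and n :: nat
    assume "\<And>y. y < n \<Longrightarrow> f y = h y"
    then show "Q f n r = Q h n r" using initial_ideal_cong[of n f h] unfolding Q_def by simp
  next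
    fix n :: nat and f :: "nat \<Rightarrow> 'a poly"
    assume "\<And>y. y < n \<Longrightarrow> Q f y (f y)"
    then have "\<And>y. y < n \<Longrightarrow> \<exists>N. f y \<in> initial_ideal g N" unfolding Q_def I_def by blast
    then obtain N where N: "\<And>y. y < n \<Longrightarrow> f y \<in> initial_ideal g (N y)" by metis
    define M where "M = Max (insert 0 (N ` {..<n}))"
    have "f y \<in> initial_ideal g M" if "y < n" for y
    proof -
      have "N y \<le> M" unfolding M_def using that by (intro Max_ge) auto
      then show ?thesis using N[OF that] initial_ideal_mono by blast
    qed
    then have "initial_ideal f n \<subseteq> initial_ideal g M" by (rule initial_ideal_subset)
    then have "g M \<in> I \<and> g M \<notin> initial_ideal f n"
      using g[of M] initial_ideal_self[of M "Suc M" g] unfolding I_def by blast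
    from ex_has_least_nat[of "\<lambda>s. s \<in> I \<and> s \<notin> initial_ideal f n", OF this, of degree]
    show "\<exists>r. Q f n r" unfolding Q_def by blast
  qed
  then obtain f where f: "\<And>n. Q f n (f n)" by blast
  let ?d = "\<lambda>n. degree (f n)"
  let ?a = "\<lambda>n. poly.coeff (f n) (?d n)"
  obtain n u where u: "?a n = (\<Sum>j<n. u j * ?a j)"
    using assms[unfolded noeth_def, rule_format, of ?a] by auto
  \<comment> \<open>\<open>f n\<close> was already a candidate at stage \<open>j\<close>, where
    \<open>f j\<close> had the least degree. So the degrees do not decrease, and the shifts by
    \<open>?d n - ?d j\<close> in \<open>q\<close> make sense.\<close>
  have d: "?d j \<le> ?d n" if "j < n" for j
    using f[of j] f[of n] initial_ideal_mono[of j n f] that unfolding Q_def by (meson less_imp_le subsetD)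
  define q where "q = (\<Sum>j<n. Polynomial.monom (u j) (?d n - ?d j) * f j)"
  have "q \<in> initial_ideal f n" unfolding q_def by (intro initial_ideal_sum initial_ideal_mult initial_ideal_self)
  have "f j \<in> I" for j using f unfolding Q_def by blast
  then have "s \<in> I" if "s \<in> initial_ideal f m" for s m
  proof -
    have "(\<Sum>j<k. v j * f j) \<in> I" for k :: nat and v
    proof (induction k)
      case 0
      show ?case using initial_ideal_zero[of g 0] unfolding I_def by auto
    qed (simp add: I_add I_mult \<open>\<And>j. f j \<in> I\<close>)
    then show ?thesis using that unfolding initial_ideal_def by blast
  qed
  with \<open>q \<in> initial_ideal f n\<close> have "q \<in> I" by blast
  define r where "r = f n - q"
  have "r = f n + (-1) * q" unfolding r_def by simp
  then have "r \<in> I" using I_add[OF \<open>\<And>j. f j \<in> I\<close> I_mult[OF \<open>q \<in> I\<close>]] by metis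
  moreover have "r \<notin> initial_ideal f n"
  proof
    assume "r \<in> initial_ideal f n"
    then have "r + q \<in> initial_ideal f n" using \<open>q \<in> initial_ideal f n\<close> by (rule initial_ideal_add)
    then show False using f[of n] unfolding Q_def r_def by simp
  qed
  ultimately have le: "?d n \<le> degree r" and "r \<noteq> 0"
    using f[of n] initial_ideal_zero[of f n] unfolding Q_def by auto
  have cq: "poly.coeff (Polynomial.monom (u j) (?d n - ?d j) * f j) (?d n) = u j * ?a j" if "j < n" for j
    using d[OF that] by (simp add: coeff_monom_mult)
  have "poly.coeff q (?d n) = (\<Sum>j<n. u j * ?a j)"
    unfolding q_def coeff_sum by (rule sum.cong) (use cq in auto)
  then have c0: "poly.coeff r (?d n) = 0" unfolding r_def using u by simp
  have "degree q \<le> ?d n"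
    unfolding q_def
  proof (rule degree_sum_le)
    fix j assume "j \<in> {..<n}"
    then have j: "j < n" by simp
    have "degree (Polynomial.monom (u j) (?d n - ?d j) * f j)
        \<le> degree (Polynomial.monom (u j) (?d n - ?d j)) + ?d j" by (rule degree_mult_le)
    also have "\<dots> \<le> ?d n" using degree_monom_le[of "u j" "?d n - ?d j"] d[OF j] by simp
    finally show "degree (Polynomial.monom (u j) (?d n - ?d j) * f j) \<le> ?d n" .
  qed simp
  then have "degree r \<le> ?d n" unfolding r_def by (intro degree_diff_le) auto
  then have "degree r = ?d n" using le by simp
  then show False using c0 \<open>r \<noteq> 0\<close> by (metis leading_coeff_0_iff)
qed

text \<open>This carries the chain condition from a type to a ring with a carrier. An ideal that is
  not finitely generated contains a sequence whose members are never in the ideal generated by the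
  earlier ones, and preimages of this sequence would violate the condition.\<close>

lemma noetherian_ring_image:
  fixes \<phi> :: "'a::comm_ring_1 \<Rightarrow> 'b"
  assumes noeth: "noeth TYPE('a)" and R: "cring R" and surj: "range \<phi> = carrier R"
    and add: "\<And>s t. \<phi> (s + t) = \<phi> s \<oplus>\<^bsub>R\<^esub> \<phi> t" and mult: "\<And>s t. \<phi> (s * t) = \<phi> s \<otimes>\<^bsub>R\<^esub> \<phi> t"
  shows "noetherian_ring R"
proof -
  interpret cring R by fact
  have c: "\<phi> s \<in> carrier R" for s using surj by blast
  have zero: "\<phi> 0 = \<zero>\<^bsub>R\<^esub>" using add[of 0 0] c[of 0] by simp
  show ?thesis
  proof (rule noetherian_ringI, rule ccontr)
    fix I assume I: "ideal I R" and nfg: "\<not> (\<exists>A\<subseteq>carrier R. finite A \<and> I = Idl\<^bsub>R\<^esub> A)"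
    interpret I: ideal I R by fact
    define Q where "Q f n r \<longleftrightarrow> r \<in> I \<and> r \<notin> Idl\<^bsub>R\<^esub> (f ` {..<n})" for f and n :: nat and r
    have "\<exists>f. \<forall>n. Q f n (f n)"
    proof (rule dependent_wellorder_choice)
      fix r and f h :: "nat \<Rightarrow> 'b" and n :: nat
      assume "\<And>y. y < n \<Longrightarrow> f y = h y"
      then have "f ` {..<n} = h ` {..<n}" by auto
      then show "Q f n r = Q h n r" unfolding Q_def by simp
    next
      fix n :: nat and f :: "nat \<Rightarrow> 'b"
      assume "\<And>y. y < n \<Longrightarrow> Q f y (f y)"
      then have fI: "f ` {..<n} \<subseteq> I" unfolding Q_def by blast
      then have "Idl\<^bsub>R\<^esub> (f ` {..<n}) \<subseteq> I" by (rule genideal_minimal[OF I])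
      moreover have "I \<noteq> Idl\<^bsub>R\<^esub> (f ` {..<n})" using nfg fI I.Icarr by blast
      ultimately show "\<exists>r. Q f n r" unfolding Q_def by blast
    qed
    then obtain f where f: "\<And>n. Q f n (f n)" by blast
    have fc: "f n \<in> carrier R" for n using f I.Icarr unfolding Q_def by blast
    then have "\<forall>n. \<exists>t. \<phi> t = f n" using surj by (metis imageE)
    then obtain t where t: "\<And>n. \<phi> (t n) = f n" by metis
    obtain n u where u: "t n = (\<Sum>j<n. u j * t j)" using noeth unfolding noeth_def by blast
    let ?J = "Idl\<^bsub>R\<^esub> (f ` {..<n})"
    have sub: "f ` {..<n} \<subseteq> carrier R" using fc by blast
    interpret J: ideal ?J R by (rule genideal_ideal[OF sub])
    have "\<phi> (\<Sum>j<m. u j * t j) \<in> ?J" if "m \<le> n" for m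
      using that
    proof (induction m)
      case 0
      then show ?case using zero by simp
    next
      case (Suc m)
      have "f m \<in> ?J" using genideal_self[OF sub] Suc.prems by auto
      then have "\<phi> (u m * t m) \<in> ?J" unfolding mult t using c by (intro J.I_l_closed)
      then show ?case using Suc by (simp add: add J.a_closed)
    qed
    then have "f n \<in> ?J" using u t by (metis order_refl)
    then show False using f unfolding Q_def by blast
  qed
qed

section \<open>Evaluation of polynomials in a ring\<close>

text \<open>The coefficients are sent through \<open>h\<close>, which may be an evaluation itself;
  nesting thus evaluates polynomials in several variables.\<close>

definition evalp :: "('r, 'm) ring_scheme \<Rightarrow> ('c::zero \<Rightarrow> 'r) \<Rightarrow> 'r \<Rightarrow> 'c poly \<Rightarrow> 'r" where
  "evalp R h v p = fold_coeffs (\<lambda>c r. h c \<oplus>\<^bsub>R\<^esub> v \<otimes>\<^bsub>R\<^esub> r) p \<zero>\<^bsub>R\<^esub>"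

lemma evalp_0 [simp]: "evalp R h v 0 = \<zero>\<^bsub>R\<^esub>"
  by (simp add: evalp_def)

locale ring_evaluation = cring R for R (structure) +
  fixes h :: "'c::comm_ring_1 \<Rightarrow> 'a" and v
  assumes h_closed: "h c \<in> carrier R" and h_add: "h (c + d) = h c \<oplus> h d"
    and h_mult: "h (c * d) = h c \<otimes> h d" and h_one: "h 1 = \<one>"
    and v_closed: "v \<in> carrier R"
begin

lemma h_zero: "h 0 = \<zero>"
  using h_add[of 0 0] h_closed[of 0] by simp

lemma evalp_pCons: "evalp R h v (pCons c p) = h c \<oplus> v \<otimes> evalp R h v p"
proof (cases "c = 0 \<and> p = 0")
  case True
  then show ?thesis using v_closed h_closed by (simp add: h_zero)
next
  case False
  then show ?thesis unfolding evalp_def by (cases "c = 0") auto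
qed

lemma evalp_closed: "evalp R h v p \<in> carrier R"
  by (induction p) (auto simp: evalp_pCons h_closed v_closed)

lemma evalp_add: "evalp R h v (p + q) = evalp R h v p \<oplus> evalp R h v q"
proof (induction p q rule: poly_induct2)
  case (pCons a p b q)
  have "evalp R h v p \<in> carrier R" "evalp R h v q \<in> carrier R" "h a \<in> carrier R" "h b \<in> carrier R"
    by (auto simp: evalp_closed h_closed)
  then show ?case using v_closed by (simp add: evalp_pCons h_add pCons a_ac r_distr)
qed simp

lemma evalp_smult: "evalp R h v (smult c p) = h c \<otimes> evalp R h v p"
proof (induction p)
  case (pCons a p)
  have "evalp R h v p \<in> carrier R" "h a \<in> carrier R" "h c \<in> carrier R"
    by (auto simp: evalp_closed h_closed)
  then show ?case using v_closed by (simp add: evalp_pCons h_mult pCons m_ac r_distr)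
qed (simp add: h_closed)

lemma evalp_mult: "evalp R h v (p * q) = evalp R h v p \<otimes> evalp R h v q"
proof (induction p)
  case (pCons a p)
  have "evalp R h v p \<in> carrier R" "h a \<in> carrier R" "evalp R h v q \<in> carrier R"
    by (auto simp: evalp_closed h_closed)
  then show ?case using v_closed
    by (simp add: evalp_pCons evalp_add evalp_smult h_zero pCons m_assoc l_distr)
qed (simp add: evalp_closed)

lemma evalp_const: "evalp R h v [:c:] = h c"
  using h_closed v_closed by (simp add: evalp_pCons)

lemma evalp_one: "evalp R h v 1 = \<one>"
  using evalp_const[of 1] by (simp add: h_one one_pCons)

lemma evalp_monom: "evalp R h v (Polynomial.monom c n) = v [^] n \<otimes> h c"
proof (induction n)
  case 0
  show ?case using h_closed by (simp add: monom_0 evalp_const)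
next
  case (Suc n)
  then show ?case using v_closed h_closed by (simp add: monom_Suc evalp_pCons h_zero m_ac)
qed

lemma ring_evaluation_evalp:
  assumes "w \<in> carrier R"
  shows "ring_evaluation R (evalp R h v) w"
  using assms by unfold_locales (auto simp: evalp_closed evalp_add evalp_mult evalp_one)

text \<open>This is the step of the proof that a chain of prime ideals is not longer than the
  transcendence degree: the coefficient is the lowest nonzero one of \<open>p\<close>.\<close>

lemma evalp_mem_primeideal:
  assumes P: "primeideal P R" and Q: "ideal Q R" "P \<subseteq> Q" and v: "v \<in> Q" "v \<notin> P"
    and p: "p \<noteq> 0" "evalp R h v p \<in> P"
  shows "\<exists>c. c \<noteq> 0 \<and> h c \<in> Q"
  using p
proof (induction p)
  case (pCons c p)
  interpret P: primeideal P R by fact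
  interpret Q: ideal Q R by fact
  have e: "h c \<oplus> v \<otimes> evalp R h v p \<in> P" using pCons.prems by (simp add: evalp_pCons)
  show ?case
  proof (cases "c = 0")
    case True
    then have "v \<otimes> evalp R h v p \<in> P" using e v_closed evalp_closed by (simp add: h_zero)
    then have "evalp R h v p \<in> P" using P.I_prime[OF v_closed evalp_closed] v by blast
    moreover have "p \<noteq> 0" using pCons.prems True by auto
    ultimately show ?thesis using pCons.IH by blast
  next
    case False
    have "v \<otimes> evalp R h v p \<in> Q" using v evalp_closed by (intro Q.I_r_closed)
    moreover have "h c = (h c \<oplus> v \<otimes> evalp R h v p) \<ominus> v \<otimes> evalp R h v p"
      using h_closed v_closed evalp_closed by (simp add: a_minus_def a_assoc r_neg)
    moreover have "h c \<oplus> v \<otimes> evalp R h v p \<in> Q" using e Q by blast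
    ultimately have "h c \<in> Q" using Q.a_closed Q.a_inv_closed unfolding a_minus_def by metis
    then show ?thesis using False by blast
  qed
qed simp

end

section \<open>Homogeneous linear systems\<close>

text \<open>Gaussian elimination, one equation at a time: \<open>e\<close> is solved for an unknown
  \<open>w\<close> with nonzero coefficient, which is then substituted into the remaining
  equations.\<close>

lemma homogeneous_system_solution:
  fixes m :: "'e \<Rightarrow> 'u \<Rightarrow> 'k::field"
  assumes "finite E" "finite U" "card E < card U"
  shows "\<exists>c. (\<exists>u\<in>U. c u \<noteq> 0) \<and> (\<forall>e\<in>E. (\<Sum>u\<in>U. c u * m e u) = 0)"
  using assms
proof (induction E arbitrary: U m rule: finite_induct)
  case empty
  then have "U \<noteq> {}" by auto
  then show ?case by (intro exI[of _ "\<lambda>_. 1"]) auto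
next
  case (insert e E)
  show ?case
  proof (cases "\<forall>u\<in>U. m e u = 0")
    case True
    have "card E < card U" using insert by simp
    then obtain c where "\<exists>u\<in>U. c u \<noteq> 0" "\<forall>e\<in>E. (\<Sum>u\<in>U. c u * m e u) = 0"
      using insert.IH[OF insert.prems(1), of m] by blast
    then show ?thesis using True by (intro exI[of _ c]) auto
  next
    case False
    then obtain w where w: "w \<in> U" "m e w \<noteq> 0" by blast
    define V where "V = U - {w}"
    have V: "finite V" "w \<notin> V" "U = insert w V" using insert.prems w unfolding V_def by auto
    have "card E < card V" using insert V by simp
    then obtain c where c: "\<exists>u\<in>V. c u \<noteq> 0"
      "\<forall>i\<in>E. (\<Sum>u\<in>V. c u * (m i u - m i w * m e u / m e w)) = 0"
      using insert.IH[OF V(1), of "\<lambda>i u. m i u - m i w * m e u / m e w"] by blast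
    define d where "d = c (w := - (\<Sum>u\<in>V. c u * m e u) / m e w)"
    have dV: "d u = c u" if "u \<in> V" for u using that V unfolding d_def by auto
    have sum: "(\<Sum>u\<in>U. d u * m i u) = (\<Sum>u\<in>V. c u * m i u) - (\<Sum>u\<in>V. c u * m e u) / m e w * m i w" for i
    proof -
      have "(\<Sum>u\<in>U. d u * m i u) = d w * m i w + (\<Sum>u\<in>V. d u * m i u)" using V by simp
      also have "(\<Sum>u\<in>V. d u * m i u) = (\<Sum>u\<in>V. c u * m i u)" using dV by simp
      finally show ?thesis by (simp add: d_def)
    qed
    have "(\<Sum>u\<in>U. d u * m i u) = 0" if "i \<in> insert e E" for i
    proof (cases "i = e")
      case True
      then show ?thesis using sum w by simp
    next
      case False
      then have "(\<Sum>u\<in>V. c u * (m i u - m i w * m e u / m e w)) = 0" using c that by blast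
      then have "(\<Sum>u\<in>V. c u * m i u) = (\<Sum>u\<in>V. (c u * m e u) * (m i w / m e w))"
        by (simp add: right_diff_distrib sum_subtractf mult_ac)
      also have "\<dots> = (\<Sum>u\<in>V. c u * m e u) / m e w * m i w" by (simp add: sum_distrib_right sum_divide_distrib)
      finally show ?thesis using sum by simp
    qed
    moreover have "\<exists>u\<in>U. d u \<noteq> 0" using c(1) dV V(3) by auto
    ultimately show ?thesis by blast
  qed
qed


section \<open>The free module of rank three\<close>

text \<open>A = K[x, w] is encoded as K[x][w]: x is the inner and w the outer variable. Hence
  \<open>degree\<close> is the degree in w, and the leading coefficient is a polynomial in
  x.\<close>

definition pX :: "'k::field poly poly" where "pX = [:[:0, 1:]:]"
definition pW :: "'k::field poly poly" where "pW = [:0, 1:]"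

text \<open>Multiplicativity of the norm of p + q y + s z for the table y^2 = A z, y z = A B, z^2 =
  B y, verified as a polynomial identity.\<close>

lemma norm_form_mult:
  fixes p q s p' q' s' A B :: "'r::comm_ring_1"
  shows "(p * p' + A * B * (q * s' + s * q')) ^ 3 + (p * q' + q * p' + B * s * s') ^ 3 * A ^ 2 * B
      + (p * s' + s * p' + A * q * q') ^ 3 * A * B ^ 2
      - 3 * (p * p' + A * B * (q * s' + s * q')) * (p * q' + q * p' + B * s * s') * (p * s' + s * p' + A * q * q') * A * B
    = (p ^ 3 + q ^ 3 * A ^ 2 * B + s ^ 3 * A * B ^ 2 - 3 * p * q * s * A * B)
      * (p' ^ 3 + q' ^ 3 * A ^ 2 * B + s' ^ 3 * A * B ^ 2 - 3 * p' * q' * s' * A * B)"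
  by (simp add: algebra_simps power2_eq_square power3_eq_cube)

abbreviation bcoeff :: "'k::zero poly poly \<Rightarrow> nat \<Rightarrow> nat \<Rightarrow> 'k" where
  "bcoeff p j i \<equiv> poly.coeff (poly.coeff p j) i"

text \<open>\<open>emb p q s\<close> stands for \<open>p + q y + s z\<close>.\<close>

locale cubic_ring = cring R for R (structure) +
  fixes emb :: "'k::field poly poly \<Rightarrow> 'k poly poly \<Rightarrow> 'k poly poly \<Rightarrow> 'a"
    and a b :: nat
  assumes a_pos: "a > 0" and b_pos: "b > 0"
    and emb_closed [simp]: "emb p q s \<in> carrier R"
    and emb_surj: "u \<in> carrier R \<Longrightarrow> \<exists>p q s. u = emb p q s"
    and emb_eq [simp]: "emb p q s = emb p' q' s' \<longleftrightarrow> p = p' \<and> q = q' \<and> s = s'"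
    and emb_add: "emb p q s \<oplus> emb p' q' s' = emb (p + p') (q + q') (s + s')"
    and emb_mult: "emb p q s \<otimes> emb p' q' s' =
      emb (p * p' + pX ^ a * pW ^ b * (q * s' + s * q'))
          (p * q' + q * p' + pW ^ b * s * s') (p * s' + s * p' + pX ^ a * q * q')"
    and emb_one: "emb 1 0 0 = \<one>"
begin

lemma emb_cases:
  assumes "u \<in> carrier R"
  obtains p q s where "u = emb p q s"
  using emb_surj[OF assms] by blast

lemma emb_zero: "emb 0 0 0 = \<zero>"
  using emb_add[of 0 0 0 0 0 0] by simp

lemma emb_minus: "\<ominus> emb p q s = emb (-p) (-q) (-s)"
proof -
  have "emb p q s \<oplus> emb (-p) (-q) (-s) = \<zero>" by (simp add: emb_add emb_zero)
  then show ?thesis using add.inv_equality[of "emb (-p) (-q) (-s)" "emb p q s"] a_comm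
    by (simp add: a_inv_def)
qed

definition \<iota> :: "'k poly poly \<Rightarrow> 'a" where "\<iota> p = emb p 0 0"

lemma iota_closed [simp]: "\<iota> p \<in> carrier R"
  and iota_add: "\<iota> (p + q) = \<iota> p \<oplus> \<iota> q" and iota_mult: "\<iota> (p * q) = \<iota> p \<otimes> \<iota> q"
  and iota_one: "\<iota> 1 = \<one>" and iota_minus: "\<iota> (- p) = \<ominus> \<iota> p" and iota_zero: "\<iota> 0 = \<zero>"
  by (simp_all add: \<iota>_def emb_add emb_mult emb_one emb_minus emb_zero)

lemma iota_diff: "\<iota> (p - q) = \<iota> p \<ominus> \<iota> q"
  using iota_add[of p "-q"] by (simp add: iota_minus a_minus_def)

lemma iota_pow: "\<iota> (p ^ n) = \<iota> p [^] n"
  by (induction n) (simp_all add: iota_one iota_mult m_comm)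

lemma iota_emb: "\<iota> c \<otimes> emb p q s = emb (c * p) (c * q) (c * s)"
  by (simp add: \<iota>_def emb_mult)

lemma emb_decomp: "emb p q s = \<iota> p \<oplus> (\<iota> q \<otimes> emb 0 1 0 \<oplus> \<iota> s \<otimes> emb 0 0 1)"
  unfolding iota_emb by (simp add: emb_add \<iota>_def)

text \<open>R is an image of the polynomial ring in four variables: \<iota> evaluates K[x, w], and
  the two further variables go to y and z.\<close>

lemma noetherian: "noetherian_ring R"
proof -
  interpret i: ring_evaluation R \<iota> "emb 0 1 0"
    by unfold_locales (auto simp: iota_add iota_mult iota_one)
  interpret j: ring_evaluation R "evalp R \<iota> (emb 0 1 0)" "emb 0 0 1"
    by (rule i.ring_evaluation_evalp) simp
  let ?f = "evalp R (evalp R \<iota> (emb 0 1 0)) (emb 0 0 1)"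
  have "emb p q s = ?f [:[:p, q:], [:s:]:]" for p q s
    by (simp add: j.evalp_pCons i.evalp_pCons emb_zero[symmetric] \<iota>_def emb_add emb_mult)
  then have "range ?f = carrier R" using j.evalp_closed emb_surj by (metis image_subsetI rangeI subsetI subset_antisym)
  moreover have "noeth TYPE('k poly poly poly poly)" by (intro noeth_poly noeth_field)
  ultimately show ?thesis
    using noetherian_ring_image[OF _ is_cring, of ?f] j.evalp_add j.evalp_mult by blast
qed

subsection \<open>The norm\<close>

text \<open>The determinant over A of multiplication by p + q y + s z in the basis 1, y, z.\<close>

definition norm3 :: "'k poly poly \<Rightarrow> 'k poly poly \<Rightarrow> 'k poly poly \<Rightarrow> 'k poly poly" where
  "norm3 p q s = p ^ 3 + q ^ 3 * (pX ^ a) ^ 2 * pW ^ b + s ^ 3 * pX ^ a * (pW ^ b) ^ 2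
     - 3 * p * q * s * pX ^ a * pW ^ b"

text \<open>The second factor is the product of the other two conjugates, in which y and z are
  multiplied by the primitive cube roots of unity. Consequently every ideal of R contains the norms
  of its elements.\<close>

lemma emb_mult_adjoint:
  "emb p q s \<otimes> emb (p ^ 2 - q * s * pX ^ a * pW ^ b) (s ^ 2 * pW ^ b - p * q) (q ^ 2 * pX ^ a - p * s)
    = \<iota> (norm3 p q s)"
  unfolding \<iota>_def norm3_def emb_mult emb_eq
  by (intro conjI) (simp_all add: algebra_simps power2_eq_square power3_eq_cube)

lemma norm3_mult:
  "norm3 (p * p' + pX ^ a * pW ^ b * (q * s' + s * q'))
      (p * q' + q * p' + pW ^ b * s * s') (p * s' + s * p' + pX ^ a * q * q')
    = norm3 p q s * norm3 p' q' s'"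
  unfolding norm3_def by (rule norm_form_mult)

subsection \<open>Ideals generated by elements of the polynomial ring\<close>

lemma emb_mem_Idl:
  "emb p q s \<in> Idl {\<iota> g} \<longleftrightarrow> g dvd p \<and> g dvd q \<and> g dvd s"
proof -
  have "Idl {\<iota> g} = PIdl (\<iota> g)" by (simp add: cgenideal_eq_genideal)
  also have "\<dots> = {\<iota> g \<otimes> r | r. r \<in> carrier R}"
    unfolding cgenideal_def using m_comm[OF iota_closed] by (metis (no_types, opaque_lifting) iota_closed)
  finally have *: "Idl {\<iota> g} = {\<iota> g \<otimes> r | r. r \<in> carrier R}" .
  show ?thesis unfolding *
  proof
    assume "emb p q s \<in> {\<iota> g \<otimes> r | r. r \<in> carrier R}"
    then obtain r where "r \<in> carrier R" "emb p q s = \<iota> g \<otimes> r" by blast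
    then obtain p' q' s' where "emb p q s = \<iota> g \<otimes> emb p' q' s'" by (metis emb_cases)
    then show "g dvd p \<and> g dvd q \<and> g dvd s" by (simp add: iota_emb)
  next
    assume "g dvd p \<and> g dvd q \<and> g dvd s"
    then obtain p' q' s' where "p = g * p'" "q = g * q'" "s = g * s'" by (auto elim!: dvdE)
    then have "emb p q s = \<iota> g \<otimes> emb p' q' s'" by (simp add: iota_emb)
    then show "emb p q s \<in> {\<iota> g \<otimes> r | r. r \<in> carrier R}" using emb_closed by blast
  qed
qed

definition comb :: "'k poly poly \<Rightarrow> 'k poly poly \<Rightarrow> 'k poly poly \<Rightarrow> bool" where
  "comb f g p \<longleftrightarrow> (\<exists>u v. p = f * u + g * v)"

lemma comb_add: "comb f g p \<Longrightarrow> comb f g q \<Longrightarrow> comb f g (p + q)"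
proof -
  assume "comb f g p" "comb f g q"
  then obtain u v u' v' where "p = f * u + g * v" "q = f * u' + g * v'" unfolding comb_def by blast
  then have "p + q = f * (u + u') + g * (v + v')" by (simp add: algebra_simps)
  then show ?thesis unfolding comb_def by blast
qed

lemma comb_mult: "comb f g p \<Longrightarrow> comb f g (c * p)"
proof -
  assume "comb f g p"
  then obtain u v where "p = f * u + g * v" unfolding comb_def by blast
  then have "c * p = f * (c * u) + g * (c * v)" by (simp add: algebra_simps)
  then show ?thesis unfolding comb_def by blast
qed

lemma comb_mult': "comb f g p \<Longrightarrow> comb f g (p * c)"
  using comb_mult[of f g p c] by (simp add: mult.commute)

lemma comb_gen: "comb f g f" "comb f g g" "comb f g 0"
proof -
  have "f = f * 1 + g * 0" "g = f * 0 + g * 1" "0 = f * 0 + g * 0" by simp_all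
  then show "comb f g f" "comb f g g" "comb f g 0" unfolding comb_def by blast+
qed

text \<open>By freeness: R-multiples of f and g have all coordinates in the ideal (f, g) of A, and
  conversely coordinates in (f, g) may be multiplied by 1, y and z.\<close>

lemma emb_mem_Idl2:
  "emb p q s \<in> Idl {\<iota> f, \<iota> g} \<longleftrightarrow> comb f g p \<and> comb f g q \<and> comb f g s"
proof
  let ?I = "{emb p q s | p q s. comb f g p \<and> comb f g q \<and> comb f g s}"
  have mult: "u \<otimes> v \<in> ?I" if uv: "u \<in> ?I" "v \<in> carrier R" for u v
  proof -
    obtain p q s where u: "u = emb p q s" "comb f g p" "comb f g q" "comb f g s" using uv(1) by blast
    obtain p' q' s' where v: "v = emb p' q' s'" using emb_cases[OF uv(2)] by blast
    have "comb f g (p * p' + pX ^ a * pW ^ b * (q * s' + s * q'))"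
      "comb f g (p * q' + q * p' + pW ^ b * s * s')" "comb f g (p * s' + s * p' + pX ^ a * q * q')"
      using u(2-) by (auto intro!: comb_add intro: comb_mult comb_mult')
    then show ?thesis unfolding u(1) v emb_mult by blast
  qed
  have "ideal ?I R"
  proof (rule ideal_of_mult_closed[OF _ _ _ mult])
    show "?I \<subseteq> carrier R" by auto
    show "\<zero> \<in> ?I" unfolding emb_zero[symmetric] using comb_gen(3) by blast
    fix u v assume "u \<in> ?I" "v \<in> ?I"
    then obtain p q s p' q' s' where e: "u = emb p q s" "v = emb p' q' s'"
      and c: "comb f g p" "comb f g q" "comb f g s" "comb f g p'" "comb f g q'" "comb f g s'" by blast
    have "comb f g (p + p')" "comb f g (q + q')" "comb f g (s + s')" using c comb_add by auto
    then show "u \<oplus> v \<in> ?I" unfolding e emb_add by blast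
  qed
  moreover have "{\<iota> f, \<iota> g} \<subseteq> ?I" unfolding \<iota>_def using comb_gen[of f g] by blast
  ultimately have "Idl {\<iota> f, \<iota> g} \<subseteq> ?I" by (rule genideal_minimal)
  then show "emb p q s \<in> Idl {\<iota> f, \<iota> g} \<Longrightarrow> comb f g p \<and> comb f g q \<and> comb f g s" by auto
  interpret I: ideal "Idl {\<iota> f, \<iota> g}" R by (rule genideal_ideal) simp
  have gen: "\<iota> f \<in> Idl {\<iota> f, \<iota> g}" "\<iota> g \<in> Idl {\<iota> f, \<iota> g}" using genideal_self[of "{\<iota> f, \<iota> g}"] by auto
  have i: "\<iota> p \<in> Idl {\<iota> f, \<iota> g}" if "comb f g p" for p
  proof -
    obtain u v where "p = f * u + g * v" using \<open>comb f g p\<close> unfolding comb_def by blast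
    then show ?thesis using gen by (simp add: iota_add iota_mult I.I_r_closed I.a_closed)
  qed
  assume "comb f g p \<and> comb f g q \<and> comb f g s"
  then show "emb p q s \<in> Idl {\<iota> f, \<iota> g}"
    by (subst emb_decomp) (intro I.a_closed I.I_r_closed i, auto)
qed

subsection \<open>The irrelevant maximal ideal\<close>

definition const_coeff :: "'k poly poly \<Rightarrow> 'k" where
  "const_coeff p = bcoeff p 0 0"

lemma const_coeff_simps [simp]:
  "const_coeff (p + q) = const_coeff p + const_coeff q" "const_coeff (p - q) = const_coeff p - const_coeff q"
  "const_coeff (p * q) = const_coeff p * const_coeff q"
  "const_coeff 0 = 0" "const_coeff 1 = 1" "const_coeff pX = 0" "const_coeff pW = 0"
  "const_coeff (-p) = - const_coeff p" "const_coeff (p ^ n) = const_coeff p ^ n"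
proof -
  show m: "const_coeff (p * q) = const_coeff p * const_coeff q" for p q
    by (simp add: const_coeff_def coeff_mult)
  show o: "const_coeff 1 = 1" by (simp add: const_coeff_def)
  show "const_coeff (p ^ n) = const_coeff p ^ n" by (induction n) (simp_all add: m o)
qed (simp_all add: const_coeff_def pX_def pW_def)

lemma const_coeff_eq_0_iff: "const_coeff p = 0 \<longleftrightarrow> comb pX pW p"
proof
  assume "const_coeff p = 0"
  obtain p0 p' where p: "p = pCons p0 p'" by (cases p)
  obtain c q where q: "p0 = pCons c q" by (cases p0)
  have "c = 0" using \<open>const_coeff p = 0\<close> by (simp add: const_coeff_def p q)
  then have "p = pX * [:q:] + pW * p'" by (simp add: p q pX_def pW_def)
  then show "comb pX pW p" unfolding comb_def by blast
qed (auto simp: comb_def)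

definition \<mm> :: "'a set" where "\<mm> = Idl {\<iota> pX, emb 0 1 0, emb 0 0 1, \<iota> pW}"

lemma m_eq: "\<mm> = {emb p q s | p q s. const_coeff p = 0}"
proof
  let ?I = "{emb p q s | p q s. const_coeff p = 0}"
  have mult: "u \<otimes> v \<in> ?I" if uv: "u \<in> ?I" "v \<in> carrier R" for u v
  proof -
    obtain p q s where u: "u = emb p q s" "const_coeff p = 0" using uv(1) by blast
    obtain p' q' s' where v: "v = emb p' q' s'" using emb_cases[OF uv(2)] by blast
    have "const_coeff (p * p' + pX ^ a * pW ^ b * (q * s' + s * q')) = 0"
      using u(2) a_pos by (simp add: power_0_left)
    then show ?thesis unfolding u(1) v emb_mult by blast
  qed
  have "ideal ?I R"
  proof (rule ideal_of_mult_closed[OF _ _ _ mult])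
    show "?I \<subseteq> carrier R" by auto
    have "const_coeff 0 = 0" by simp
    then show "\<zero> \<in> ?I" unfolding emb_zero[symmetric] by blast
    fix u v assume "u \<in> ?I" "v \<in> ?I"
    then obtain p q s p' q' s' where e: "u = emb p q s" "v = emb p' q' s'"
      and c: "const_coeff p = 0" "const_coeff p' = 0" by blast
    have "const_coeff (p + p') = 0" using c by simp
    then show "u \<oplus> v \<in> ?I" unfolding e emb_add by blast
  qed
  moreover have "{\<iota> pX, emb 0 1 0, emb 0 0 1, \<iota> pW} \<subseteq> ?I"
    unfolding \<iota>_def using const_coeff_simps(4,6,7) by blast
  ultimately show "\<mm> \<subseteq> ?I" unfolding \<mm>_def by (rule genideal_minimal)
  have sub: "{\<iota> pX, emb 0 1 0, emb 0 0 1, \<iota> pW} \<subseteq> carrier R" by simp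
  interpret m: ideal \<mm> R unfolding \<mm>_def by (rule genideal_ideal[OF sub])
  have gen: "\<iota> pX \<in> \<mm>" "emb 0 1 0 \<in> \<mm>" "emb 0 0 1 \<in> \<mm>" "\<iota> pW \<in> \<mm>"
    unfolding \<mm>_def using genideal_self[OF sub] by auto
  show "?I \<subseteq> \<mm>"
  proof
    fix u assume "u \<in> ?I"
    then obtain p q s where u: "u = emb p q s" "const_coeff p = 0" by blast
    then obtain c d where "p = pX * c + pW * d" unfolding const_coeff_eq_0_iff comb_def by blast
    then have "\<iota> p \<in> \<mm>" using gen by (simp add: iota_add iota_mult m.I_r_closed m.a_closed)
    then show "u \<in> \<mm>" unfolding u(1) using gen
      by (subst emb_decomp) (intro m.a_closed m.I_l_closed, auto)
  qed
qed

lemma emb_mem_m: "emb p q s \<in> \<mm> \<longleftrightarrow> const_coeff p = 0"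
  unfolding m_eq by auto

lemma maximalideal_m: "maximalideal \<mm> R"
proof -
  have id: "ideal \<mm> R" unfolding \<mm>_def by (rule genideal_ideal) simp
  interpret m: ideal \<mm> R by (rule id)
  show ?thesis
  proof (rule maximalidealI[OF id])
    have "\<one> \<notin> \<mm>" using emb_mem_m[of 1 0 0] by (simp add: emb_one)
    then show "carrier R \<noteq> \<mm>" using one_closed by blast
    fix J assume J: "ideal J R" "\<mm> \<subseteq> J" "J \<subseteq> carrier R"
    interpret J: ideal J R by fact
    show "J = \<mm> \<or> J = carrier R"
    proof (cases "J \<subseteq> \<mm>")
      case False
      then obtain u where u: "u \<in> J" "u \<notin> \<mm>" by blast
      then obtain p q s where e: "u = emb p q s" using J.Icarr emb_cases by metis
      define c where "c = const_coeff p"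
      have c: "c \<noteq> 0" using u(2) emb_mem_m unfolding e c_def by blast
      have "emb ([:[:c:]:] - p) (-q) (-s) \<in> \<mm>" unfolding emb_mem_m by (simp add: c_def const_coeff_def)
      then have "u \<oplus> emb ([:[:c:]:] - p) (-q) (-s) \<in> J" using J(2) u(1) by (intro J.a_closed) auto
      then have "\<iota> [:[:c:]:] \<in> J" by (simp add: e emb_add \<iota>_def)
      then have "\<iota> [:[:c:]:] \<otimes> \<iota> [:[:1 / c:]:] \<in> J" by (intro J.I_r_closed) auto
      then have "\<one> \<in> J" using c by (simp flip: iota_mult iota_one add: one_pCons)
      then show ?thesis using J.one_imp_carrier by blast
    qed (use J in blast)
  qed
qed

lemma pX_power: "(pX :: 'k poly poly) ^ a = pX * pX ^ (a - Suc 0)"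
  and pW_power: "(pW :: 'k poly poly) ^ b = pW * pW ^ (b - Suc 0)"
  using a_pos b_pos by (simp_all flip: power_Suc)

text \<open>The relations y^2 = x^a z and z^2 = w^b y put y and z into every prime that contains x
  and w. This singles out the prime over the parameter ideals below.\<close>

lemma primeideal_eq_m:
  assumes P: "primeideal P R" and "\<iota> (pX ^ i) \<in> P" "\<iota> (pW ^ j) \<in> P"
  shows "P = \<mm>"
proof -
  interpret P: primeideal P R by fact
  have pow: "u \<in> P" if "u \<in> carrier R" "u [^] (n::nat) \<in> P" for u n
    using that(2)
  proof (induction n)
    case 0
    then show ?case using P.I_notcarr P.one_imp_carrier by simp
  next
    case (Suc n)
    then show ?case using P.I_prime[of "u [^] n" u] that(1) by auto
  qed
  have x: "\<iota> pX \<in> P" by (rule pow[OF iota_closed assms(2)[unfolded iota_pow]])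
  have w: "\<iota> pW \<in> P" by (rule pow[OF iota_closed assms(3)[unfolded iota_pow]])
  have "emb 0 1 0 [^] (2::nat) = \<iota> pX \<otimes> emb 0 0 (pX ^ (a - Suc 0))"
    by (simp add: numeral_2_eq_2 emb_mult iota_emb pX_power flip: emb_one)
  also have "\<dots> \<in> P" using x by (intro P.I_r_closed) auto
  finally have y: "emb 0 1 0 \<in> P" by (rule pow[OF emb_closed])
  have "emb 0 0 1 [^] (2::nat) = \<iota> pW \<otimes> emb 0 (pW ^ (b - Suc 0)) 0"
    by (simp add: numeral_2_eq_2 emb_mult iota_emb pW_power flip: emb_one)
  also have "\<dots> \<in> P" using w by (intro P.I_r_closed) auto
  finally have z: "emb 0 0 1 \<in> P" by (rule pow[OF emb_closed])
  have "\<mm> \<subseteq> P" unfolding \<mm>_def using x y z w by (intro genideal_minimal[OF P.is_ideal]) auto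
  moreover have "P \<subseteq> carrier R" using P.Icarr by blast
  ultimately show ?thesis
    using maximalideal.I_maximal[OF maximalideal_m P.is_ideal] P.I_notcarr by blast
qed

lemma m_square:
  "\<mm> \<cdot>\<^bsub>R\<^esub> \<mm> = (Idl {\<iota> pX, \<iota> pW}) \<cdot>\<^bsub>R\<^esub> \<mm>"
  "(Idl {\<iota> pX, \<iota> pW}) \<cdot>\<^bsub>R\<^esub> \<mm> \<subseteq> Idl {\<iota> pX, \<iota> pW}"
proof -
  let ?I = "Idl {\<iota> pX, \<iota> pW}"
  have m: "ideal \<mm> R" using maximalideal_m by (rule maximalideal.axioms(1))
  have I: "ideal ?I R" by (rule genideal_ideal) simp
  interpret Im: ideal "?I \<cdot>\<^bsub>R\<^esub> \<mm>" R by (rule ideal_prod_is_ideal[OF I m])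
  show "?I \<cdot>\<^bsub>R\<^esub> \<mm> \<subseteq> ?I" using ideal_prod_inter[OF I m] by blast
  have IM: "?I \<subseteq> \<mm>"
  proof
    fix u assume u: "u \<in> ?I"
    then obtain p q s where "u = emb p q s" using ideal.Icarr[OF I] emb_cases by metis
    then show "u \<in> \<mm>" using u by (auto simp: emb_mem_Idl2 emb_mem_m const_coeff_eq_0_iff)
  qed
  have xI: "\<iota> pX \<in> ?I" "\<iota> pW \<in> ?I" using genideal_self[of "{\<iota> pX, \<iota> pW}"] by auto
  have prod: "u \<otimes> v \<in> ?I \<cdot>\<^bsub>R\<^esub> \<mm>" if "u \<in> \<mm>" "v \<in> \<mm>" for u v
  proof -
    have "u \<in> carrier R" "v \<in> carrier R" using that ideal.Icarr[OF m] by auto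
    then obtain p q s p' q' s' where e: "u = emb p q s" "v = emb p' q' s'" by (metis emb_cases)
    have c: "const_coeff p = 0" "const_coeff p' = 0" using that emb_mem_m e by auto
    define u' v' where "u' = emb 0 q s" and "v' = emb 0 q' s'"
    have uv: "u = \<iota> p \<oplus> u'" "v = \<iota> p' \<oplus> v'" by (auto simp: e u'_def v'_def \<iota>_def emb_add)
    have c': "u' \<in> carrier R" "v' \<in> carrier R" "u' \<in> \<mm>" "v' \<in> \<mm>"
      by (auto simp: u'_def v'_def emb_mem_m)
    have "\<iota> p \<in> ?I" "\<iota> p' \<in> ?I"
      unfolding \<iota>_def[of p] \<iota>_def[of p'] emb_mem_Idl2 using c comb_gen(3) by (auto simp: const_coeff_eq_0_iff)
    then have 1: "\<iota> p \<otimes> v \<in> ?I \<cdot>\<^bsub>R\<^esub> \<mm>" "\<iota> p' \<otimes> u' \<in> ?I \<cdot>\<^bsub>R\<^esub> \<mm>"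
      using that c' by (auto intro: ideal_prod.prod)
    \<comment> \<open>Each of y^2, y z and z^2 has a factor x or w to split off. What remains of y z
      is x^(a-1) w^b, which is in \<open>\<mm>\<close> even for a = 1 because b > 0.\<close>
    have "u' \<otimes> v' = \<iota> pX \<otimes> emb (pX ^ (a - Suc 0) * pW ^ b * (q * s' + s * q')) 0 (pX ^ (a - Suc 0) * q * q')
        \<oplus> \<iota> pW \<otimes> emb 0 (pW ^ (b - Suc 0) * s * s') 0"
      unfolding u'_def v'_def emb_mult iota_emb emb_add emb_eq pX_power pW_power by (simp add: mult_ac)
    moreover have "\<iota> pX \<otimes> emb (pX ^ (a - Suc 0) * pW ^ b * (q * s' + s * q')) 0 (pX ^ (a - Suc 0) * q * q') \<in> ?I \<cdot>\<^bsub>R\<^esub> \<mm>"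
      using b_pos by (intro ideal_prod.prod xI) (simp add: emb_mem_m power_0_left)
    moreover have "\<iota> pW \<otimes> emb 0 (pW ^ (b - Suc 0) * s * s') 0 \<in> ?I \<cdot>\<^bsub>R\<^esub> \<mm>"
      by (intro ideal_prod.prod xI) (simp add: emb_mem_m)
    ultimately have 2: "u' \<otimes> v' \<in> ?I \<cdot>\<^bsub>R\<^esub> \<mm>" using Im.a_closed by metis
    have "v \<in> carrier R" by (simp add: e)
    then have "u \<otimes> v = \<iota> p \<otimes> v \<oplus> (\<iota> p' \<otimes> u' \<oplus> u' \<otimes> v')"
      using c' unfolding uv by (simp add: l_distr r_distr m_comm)
    then show ?thesis using 1 2 Im.a_closed by metis
  qed
  show "\<mm> \<cdot>\<^bsub>R\<^esub> \<mm> = ?I \<cdot>\<^bsub>R\<^esub> \<mm>"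
  proof
    show "\<mm> \<cdot>\<^bsub>R\<^esub> \<mm> \<subseteq> ?I \<cdot>\<^bsub>R\<^esub> \<mm>"
    proof
      fix u assume "u \<in> \<mm> \<cdot>\<^bsub>R\<^esub> \<mm>"
      then show "u \<in> ?I \<cdot>\<^bsub>R\<^esub> \<mm>"
        by (induction rule: ideal_prod.induct) (use prod Im.a_closed in auto)
    qed
    show "?I \<cdot>\<^bsub>R\<^esub> \<mm> \<subseteq> \<mm> \<cdot>\<^bsub>R\<^esub> \<mm>"
    proof
      fix u assume "u \<in> ?I \<cdot>\<^bsub>R\<^esub> \<mm>"
      then show "u \<in> \<mm> \<cdot>\<^bsub>R\<^esub> \<mm>"
        by (induction rule: ideal_prod.induct) (use IM in \<open>auto intro: ideal_prod.intros\<close>)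
    qed
  qed
qed

end


section \<open>The dimension is at most two\<close>

definition bideg_le :: "nat \<Rightarrow> 'k::field poly poly \<Rightarrow> bool" where
  "bideg_le d p \<longleftrightarrow> degree p \<le> d \<and> (\<forall>j. degree (poly.coeff p j) \<le> d)"

lemma bideg_le_mono: "bideg_le d p \<Longrightarrow> d \<le> e \<Longrightarrow> bideg_le e p"
  unfolding bideg_le_def by (meson order_trans)

lemma bideg_le_exists: "\<exists>d. bideg_le d p"
proof -
  define d where "d = Max (insert (degree p) ((\<lambda>j. degree (poly.coeff p j)) ` {..degree p}))"
  have "degree (poly.coeff p j) \<le> d" for j
  proof (cases "j \<le> degree p")
    case True
    then show ?thesis unfolding d_def by (intro Max_ge) auto
  next
    case False
    then show ?thesis by (simp add: coeff_eq_0)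
  qed
  moreover have "degree p \<le> d" unfolding d_def by (intro Max_ge) auto
  ultimately show ?thesis unfolding bideg_le_def by blast
qed

lemma bideg_le_add: "bideg_le d p \<Longrightarrow> bideg_le d q \<Longrightarrow> bideg_le d (p + q)"
  unfolding bideg_le_def by (simp add: degree_add_le)

lemma bideg_le_mult: "bideg_le d p \<Longrightarrow> bideg_le e q \<Longrightarrow> bideg_le (d + e) (p * q)"
proof -
  assume p: "bideg_le d p" and q: "bideg_le e q"
  have "degree (p * q) \<le> d + e"
    using degree_mult_le[of p q] p q unfolding bideg_le_def by linarith
  moreover have "degree (poly.coeff (p * q) j) \<le> d + e" for j
    unfolding coeff_mult
  proof (rule degree_sum_le)
    fix i assume "i \<in> {..j}"
    have "degree (poly.coeff p i * poly.coeff q (j - i))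
      \<le> degree (poly.coeff p i) + degree (poly.coeff q (j - i))"
      by (rule degree_mult_le)
    also have "\<dots> \<le> d + e" using p q unfolding bideg_le_def by (intro add_mono) auto
    finally show "degree (poly.coeff p i * poly.coeff q (j - i)) \<le> d + e" .
  qed simp
  ultimately show ?thesis unfolding bideg_le_def by blast
qed

lemma bideg_le_1: "bideg_le 0 1"
  unfolding bideg_le_def by (auto simp: coeff_1 split: if_splits)

lemma bideg_le_0: "bideg_le d 0"
  unfolding bideg_le_def by simp

lemma bideg_le_power: "bideg_le d p \<Longrightarrow> bideg_le (n * d) (p ^ n)"
  by (induction n) (auto simp: bideg_le_1 dest: bideg_le_mult)

lemma bideg_le_pX: "bideg_le 1 pX" and bideg_le_pW: "bideg_le 1 pW"
  unfolding bideg_le_def pX_def pW_def by (auto simp: coeff_pCons split: nat.splits)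

context cubic_ring
begin

definition bd :: "nat \<Rightarrow> 'a \<Rightarrow> bool" where
  "bd d u \<longleftrightarrow> (\<exists>p q s. u = emb p q s \<and> bideg_le d p \<and> bideg_le d q \<and> bideg_le d s)"

lemma bd_mono: "bd d u \<Longrightarrow> d \<le> e \<Longrightarrow> bd e u"
  unfolding bd_def using bideg_le_mono by metis

lemma bd_exists: "u \<in> carrier R \<Longrightarrow> \<exists>d. bd d u"
proof -
  assume "u \<in> carrier R"
  then obtain p q s where u: "u = emb p q s" by (rule emb_cases)
  obtain d e f where "bideg_le d p" "bideg_le e q" "bideg_le f s" using bideg_le_exists by metis
  then have "bideg_le (d + e + f) p" "bideg_le (d + e + f) q" "bideg_le (d + e + f) s"
    using bideg_le_mono by (metis le_add1 le_add2 add.assoc)+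
  then show ?thesis unfolding bd_def u by blast
qed

text \<open>The products of the basis elements 1, y, z bring in at most the factor x^a w^b, so
  degrees are additive up to a constant.\<close>

lemma bd_mult: "bd d u \<Longrightarrow> bd e v \<Longrightarrow> bd (d + e + (a + b)) (u \<otimes> v)"
proof -
  assume "bd d u" "bd e v"
  then obtain p q s p' q' s' where u: "u = emb p q s" "bideg_le d p" "bideg_le d q" "bideg_le d s"
    and v: "v = emb p' q' s'" "bideg_le e p'" "bideg_le e q'" "bideg_le e s'"
    unfolding bd_def by blast
  let ?d = "d + e + (a + b)"
  have m: "bideg_le (d + e) (f * g)" if "bideg_le d f" "bideg_le e g" for f g :: "'k poly poly"
    using that by (rule bideg_le_mult)
  have m': "bideg_le (d + e) (f * g)" if "bideg_le e f" "bideg_le d g" for f g :: "'k poly poly"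
    using bideg_le_mult[OF that] by (simp add: add.commute)
  have A: "bideg_le a (pX ^ a)" using bideg_le_power[OF bideg_le_pX, of a] by simp
  have B: "bideg_le b (pW ^ b)" using bideg_le_power[OF bideg_le_pW, of b] by simp
  have up: "bideg_le ?d f" if "bideg_le (d + e) f" for f :: "'k poly poly"
    using that by (rule bideg_le_mono) simp
  have "bideg_le ?d (pX ^ a * pW ^ b * (q * s' + s * q'))"
    using bideg_le_mult[OF bideg_le_mult[OF A B] bideg_le_add[OF m[OF u(3) v(4)] m[OF u(4) v(3)]]]
    by (simp add: add.commute)
  then have 1: "bideg_le ?d (p * p' + pX ^ a * pW ^ b * (q * s' + s * q'))"
    using up[OF m[OF u(2) v(2)]] bideg_le_add by blast
  have "bideg_le ?d (pW ^ b * s * s')"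
    using bideg_le_mult[OF B m[OF u(4) v(4)]] bideg_le_mono[of "b + (d + e)" "pW ^ b * (s * s')" ?d]
    by (simp add: mult.assoc)
  then have 2: "bideg_le ?d (p * q' + q * p' + pW ^ b * s * s')"
    using up[OF m[OF u(2) v(3)]] up[OF m[OF u(3) v(2)]] bideg_le_add by blast
  have "bideg_le ?d (pX ^ a * q * q')"
    using bideg_le_mult[OF A m[OF u(3) v(3)]] bideg_le_mono[of "a + (d + e)" "pX ^ a * (q * q')" ?d]
    by (simp add: mult.assoc)
  then have 3: "bideg_le ?d (p * s' + s * p' + pX ^ a * q * q')"
    using up[OF m[OF u(2) v(4)]] up[OF m[OF u(4) v(2)]] bideg_le_add by blast
  show ?thesis unfolding bd_def u(1) v(1) emb_mult using 1 2 3 by blast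
qed

lemma bd_pow: "bd d u \<Longrightarrow> bd (n * (d + (a + b))) (u [^] n)"
proof (induction n)
  case 0
  have "bd 0 (emb 1 0 0)" unfolding bd_def using bideg_le_1 bideg_le_0 by blast
  then show ?case by (simp add: emb_one)
next
  case (Suc n)
  then have "bd (n * (d + (a + b)) + d + (a + b)) (u [^] n \<otimes> u)" by (intro bd_mult)
  then show ?case by (simp add: algebra_simps)
qed

text \<open>The coordinates are numbered so that they can index the equations of a linear
  system.\<close>

definition co :: "nat \<Rightarrow> 'a \<Rightarrow> 'k poly poly" where
  "co t u = (THE c. \<exists>p q s. u = emb p q s \<and> c = (if t = 0 then p else if t = 1 then q else s))"

lemma co_emb [simp]: "co t (emb p q s) = (if t = 0 then p else if t = 1 then q else s)"
  unfolding co_def by (rule the_equality) auto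

lemma co_add: "u \<in> carrier R \<Longrightarrow> v \<in> carrier R \<Longrightarrow> co t (u \<oplus> v) = co t u + co t v"
  by (elim emb_cases) (simp add: emb_add)

lemma bideg_le_co: "bd d u \<Longrightarrow> bideg_le d (co t u)"
  unfolding bd_def by auto

lemma co_zero_imp: "u \<in> carrier R \<Longrightarrow> (\<And>t. t < 3 \<Longrightarrow> co t u = 0) \<Longrightarrow> u = \<zero>"
proof -
  assume u: "u \<in> carrier R" and z: "\<And>t. t < 3 \<Longrightarrow> co t u = 0"
  obtain p q s where e: "u = emb p q s" using u by (rule emb_cases)
  show ?thesis using z[of 0] z[of 1] z[of 2] unfolding e by (simp add: emb_zero)
qed

definition \<kappa> :: "'k \<Rightarrow> 'a" where "\<kappa> c = \<iota> [:[:c:]:]"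

lemma co_scale: "u \<in> carrier R \<Longrightarrow> co t (u \<otimes> \<kappa> c) = smult [:c:] (co t u)"
proof -
  assume u: "u \<in> carrier R"
  then obtain p q s where e: "u = emb p q s" by (rule emb_cases)
  have "u \<otimes> \<kappa> c = \<iota> [:[:c:]:] \<otimes> emb p q s" unfolding \<kappa>_def e by (rule m_comm) simp_all
  also have "\<dots> = emb (smult [:c:] p) (smult [:c:] q) (smult [:c:] s)" by (simp add: iota_emb)
  finally show ?thesis by (simp add: e)
qed

lemma ring_evaluation_kappa: "v \<in> carrier R \<Longrightarrow> ring_evaluation R \<kappa> v"
proof
  fix c d :: 'k
  have "[:[:c + d:]:] = [:[:c:]:] + [:[:d:]:]" "[:[:c * d:]:] = [:[:c:]:] * [:[:d:]:]" by simp_all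
  then show "\<kappa> (c + d) = \<kappa> c \<oplus> \<kappa> d" "\<kappa> (c * d) = \<kappa> c \<otimes> \<kappa> d"
    unfolding \<kappa>_def by (simp_all only: iota_add iota_mult)
  show "\<kappa> 1 = \<one>" unfolding \<kappa>_def by (simp flip: one_pCons add: iota_one)
qed (simp_all add: \<kappa>_def)

text \<open>There are \<open>N ^ 3\<close> monomials in the three elements with exponents below
  \<open>N\<close>, but their coordinates have degrees linear in \<open>N\<close> in each of the two
  variables x and w, so only about \<open>N ^ 2\<close> coefficients have to cancel. For large
  \<open>N\<close> there is a nontrivial linear relation.\<close>

lemma algebraically_dependent:
  assumes f: "f0 \<in> carrier R" "f1 \<in> carrier R" "f2 \<in> carrier R"
  shows "\<exists>Q. Q \<noteq> 0 \<and> evalp R (evalp R (evalp R \<kappa> f2) f1) f0 Q = \<zero>"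
proof -
  interpret e2: ring_evaluation R \<kappa> f2 by (rule ring_evaluation_kappa[OF f(3)])
  interpret e1: ring_evaluation R "evalp R \<kappa> f2" f1 by (rule e2.ring_evaluation_evalp[OF f(2)])
  interpret e0: ring_evaluation R "evalp R (evalp R \<kappa> f2) f1" f0 by (rule e1.ring_evaluation_evalp[OF f(1)])
  let ?F = "evalp R (evalp R (evalp R \<kappa> f2) f1) f0"
  obtain d0 d1 d2 where "bd d0 f0" "bd d1 f1" "bd d2 f2" using f bd_exists by metis
  then have bd: "bd (d0 + d1 + d2) f0" "bd (d0 + d1 + d2) f1" "bd (d0 + d1 + d2) f2"
    using bd_mono by (metis le_add1 le_add2 add.assoc)+
  define G where "G = d0 + d1 + d2 + (a + b)"
  \<comment> \<open>As \<open>5 * G * N + 1 \<le> (5 * G + 1) * N\<close>, the number of equations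
    is at most \<open>(N - 1) * N ^ 2\<close>, which is less than the number \<open>N ^ 3\<close> of
    unknowns.\<close>
  define N where "N = 3 * (5 * G + 1) ^ 2 + 1"
  \<comment> \<open>The three powers contribute at most \<open>G * N\<close> each, and each of the
    two products adds \<open>a + b\<close>, which is at most \<open>G * N\<close>.\<close>
  define M where "M = 5 * G * N"
  define V where "V u = f0 [^] fst u \<otimes> (f1 [^] fst (snd u) \<otimes> f2 [^] snd (snd u))" for u :: "nat \<times> nat \<times> nat"
  define mon where "mon u c = Polynomial.monom (Polynomial.monom (Polynomial.monom c (snd (snd u))) (fst (snd u))) (fst u)"
    for u :: "nat \<times> nat \<times> nat" and c :: 'k
  define U where "U = {..<N} \<times> {..<N} \<times> {..<N}"
  define E where "E = {..<3::nat} \<times> {..M} \<times> {..M}"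
  have Vc: "V u \<in> carrier R" for u unfolding V_def using f by simp
  have bdV: "bd M (V u)" if uU: "u \<in> U" for u
  proof -
    obtain i j k where u: "u = (i, j, k)" "i < N" "j < N" "k < N" using uU unfolding U_def by auto
    have "bd (i * G) (f0 [^] i)" "bd (j * G) (f1 [^] j)" "bd (k * G) (f2 [^] k)"
      using bd bd_pow unfolding G_def by blast+
    then have "bd (i * G + (j * G + k * G + (a + b)) + (a + b)) (V u)"
      unfolding V_def u(1) by (simp add: bd_mult)
    moreover have "i * G \<le> N * G" "j * G \<le> N * G" "k * G \<le> N * G"
      using u by (auto intro!: mult_le_mono1)
    moreover have "a + b \<le> G" "G \<le> N * G" unfolding G_def N_def by simp_all
    moreover have "5 * (N * G) = M" unfolding M_def by simp
    ultimately show ?thesis by (elim bd_mono) linarith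
  qed
  have "card E = 3 * (5 * G * N + 1) ^ 2"
    unfolding E_def M_def by (simp add: card_cartesian_product power2_eq_square)
  also have "5 * G * N + 1 \<le> (5 * G + 1) * N" unfolding N_def by simp
  then have "3 * (5 * G * N + 1) ^ 2 \<le> 3 * ((5 * G + 1) * N) ^ 2"
    by (intro mult_le_mono power_mono) auto
  also have "\<dots> = (3 * (5 * G + 1) ^ 2) * N ^ 2" by (simp only: power_mult_distrib mult.assoc)
  also have "\<dots> < N * N ^ 2" unfolding N_def by (intro mult_strict_right_mono) auto
  also have "\<dots> = card U" unfolding U_def by (simp add: card_cartesian_product power2_eq_square)
  finally have "card E < card U" .
  moreover have "finite E" "finite U" unfolding E_def U_def by auto
  ultimately obtain c where c: "\<exists>u\<in>U. c u \<noteq> 0"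
    "\<forall>e\<in>E. (\<Sum>u\<in>U. c u * bcoeff (co (fst e) (V u)) (fst (snd e)) (snd (snd e))) = 0"
    using homogeneous_system_solution[of E U
      "\<lambda>e u. bcoeff (co (fst e) (V u)) (fst (snd e)) (snd (snd e))"] by blast
  define Q where "Q = (\<Sum>u\<in>U. mon u (c u))"
  have Fmon: "?F (mon u d) = V u \<otimes> \<kappa> d" for u d
    unfolding mon_def V_def using f
    by (simp add: e0.evalp_monom e1.evalp_monom e2.evalp_monom m_assoc e2.h_closed)
  have coF: "co t (?F Q) = (\<Sum>u\<in>U. smult [:c u:] (co t (V u)))" for t
  proof -
    have "co t (?F (\<Sum>u\<in>U. mon u (c u))) = (\<Sum>u\<in>U. co t (?F (mon u (c u))))"
      using sum_comp_morphism[of "co t \<circ> ?F" "\<lambda>u. mon u (c u)" U]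
      by (simp add: e0.evalp_add e0.evalp_closed co_add emb_zero[symmetric] comp_def)
    then show ?thesis unfolding Q_def by (simp add: Fmon co_scale Vc)
  qed
  have "co t (?F Q) = 0" if t: "t < 3" for t
  proof (intro poly_eqI)
    fix j i
    have co: "bcoeff (co t (?F Q)) j i
        = (\<Sum>u\<in>U. c u * bcoeff (co t (V u)) j i)"
      unfolding coF coeff_sum by simp
    show "bcoeff (co t (?F Q)) j i = bcoeff 0 j i"
    proof (cases "j \<le> M \<and> i \<le> M")
      case True
      then have "(t, j, i) \<in> E" using t unfolding E_def by simp
      then show ?thesis unfolding co using c(2) by force
    next
      case False
      have "bcoeff (co t (V u)) j i = 0" if "u \<in> U" for u
        using bideg_le_co[OF bdV[OF that], of t] False unfolding bideg_le_def
        by (metis coeff_0 coeff_eq_0 le_less_trans not_le)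
      then show ?thesis unfolding co by simp
    qed
  qed
  then have "?F Q = \<zero>" using co_zero_imp e0.evalp_closed by blast
  moreover have "Q \<noteq> 0"
  proof
    assume "Q = 0"
    obtain w where w: "w \<in> U" "c w \<noteq> 0" using c(1) by blast
    have cm: "bcoeff (poly.coeff (mon u d) (fst w)) (fst (snd w)) (snd (snd w))
        = (if u = w then d else 0)" for u d
      unfolding mon_def by (auto simp: coeff_monom prod_eq_iff)
    have "0 = bcoeff (poly.coeff Q (fst w)) (fst (snd w)) (snd (snd w))"
      using \<open>Q = 0\<close> by simp
    also have "\<dots> = (\<Sum>u\<in>U. if u = w then c u else 0)" unfolding Q_def coeff_sum cm ..
    also have "\<dots> = c w" using w \<open>finite U\<close> by simp
    finally show False using w by simp
  qed
  ultimately show ?thesis by blast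
qed

lemma kappa_unit:
  assumes "ideal J R" "c \<noteq> 0" "\<kappa> c \<in> J"
  shows "J = carrier R"
proof -
  interpret J: ideal J R by fact
  interpret e: ring_evaluation R \<kappa> \<zero> by (rule ring_evaluation_kappa) simp
  have "\<kappa> c \<otimes> \<kappa> (1 / c) \<in> J" using assms(3) e.h_closed by (intro J.I_r_closed)
  then have "\<one> \<in> J" using assms(2) by (simp flip: e.h_mult add: e.h_one)
  then show ?thesis by (rule J.one_imp_carrier)
qed

text \<open>Given four primes of a chain, choose an element in each step from one to the next.
  Climbing the chain, \<open>evalp_mem_primeideal\<close> removes one variable at a time from an
  algebraic relation between the three elements, until a nonzero constant of K lies in the top
  prime.\<close>

lemma prime_chain_le_2:
  assumes C: "prime_chain R C n"
  shows "n \<le> 2"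
proof (rule ccontr)
  assume n: "\<not> n \<le> 2"
  have P: "primeideal (C i) R" if "i \<le> 3" for i using C that n unfolding prime_chain_def by auto
  have S: "C i \<subset> C (Suc i)" if "i < 3" for i using C that n unfolding prime_chain_def by auto
  obtain f0 where f0: "f0 \<in> C 1" "f0 \<notin> C 0" using S[of 0] by auto
  obtain f1 where f1: "f1 \<in> C 2" "f1 \<notin> C 1" using S[of 1] by (auto simp: numeral_2_eq_2)
  obtain f2 where f2: "f2 \<in> C 3" "f2 \<notin> C 2" using S[of 2] by (auto simp: numeral_3_eq_3 numeral_2_eq_2)
  have id: "ideal (C i) R" if "i \<le> 3" for i using P[OF that] by (rule primeideal.axioms(1))
  have f: "f0 \<in> carrier R" "f1 \<in> carrier R" "f2 \<in> carrier R"
    using f0 f1 f2 ideal.Icarr[OF id[of 1]] ideal.Icarr[OF id[of 2]] ideal.Icarr[OF id[of 3]] by auto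
  interpret e2: ring_evaluation R \<kappa> f2 by (rule ring_evaluation_kappa[OF f(3)])
  interpret e1: ring_evaluation R "evalp R \<kappa> f2" f1 by (rule e2.ring_evaluation_evalp[OF f(2)])
  interpret e0: ring_evaluation R "evalp R (evalp R \<kappa> f2) f1" f0 by (rule e1.ring_evaluation_evalp[OF f(1)])
  obtain Q where Q: "Q \<noteq> 0" "evalp R (evalp R (evalp R \<kappa> f2) f1) f0 Q = \<zero>"
    using algebraically_dependent[OF f] by blast
  interpret C0: ideal "C 0" R by (rule id) simp
  have "evalp R (evalp R (evalp R \<kappa> f2) f1) f0 Q \<in> C 0" using Q(2) C0.zero_closed by simp
  moreover have S': "C 0 \<subseteq> C 1" "C 1 \<subseteq> C 2" "C 2 \<subseteq> C 3"
    using S[of 0] S[of 1] S[of 2] by (auto simp: numeral_3_eq_3 numeral_2_eq_2)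
  ultimately obtain c where "c \<noteq> 0" "evalp R (evalp R \<kappa> f2) f1 c \<in> C 1"
    using e0.evalp_mem_primeideal[OF P[of 0] id[of 1] _ f0 Q(1)] by auto
  then obtain d where "d \<noteq> 0" "evalp R \<kappa> f2 d \<in> C 2"
    using e1.evalp_mem_primeideal[OF P[of 1] id[of 2] S'(2) f1] by auto
  then obtain k where "k \<noteq> 0" "\<kappa> k \<in> C 3"
    using e2.evalp_mem_primeideal[OF P[of 2] id[of 3] S'(3) f2] by auto
  then have "C 3 = carrier R" using kappa_unit id[of 3] by simp
  then show False using primeideal.I_notcarr[OF P[of 3]] by simp
qed

end


section \<open>Maximal ideals contain a regular pair\<close>

text \<open>Take the last coefficient q_m that is not divisible by e. Modulo e, the coefficient of F
  q at \<open>degree F + m\<close> is the leading coefficient of F times q_m, and this index is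
  positive because F is not constant.\<close>

lemma dvd_coeff_of_product:
  fixes F q :: "'r::idom poly"
  assumes d: "degree F > 0"
    and cop: "\<And>t. e dvd lead_coeff F * t \<Longrightarrow> e dvd t"
    and dvd: "\<And>j. j > 0 \<Longrightarrow> e dvd poly.coeff (F * q) j"
  shows "e dvd poly.coeff q j"
proof (rule ccontr)
  let ?d = "degree F"
  let ?S = "{m. \<not> e dvd poly.coeff q m}"
  assume "\<not> ?thesis"
  then have ne: "?S \<noteq> {}" by blast
  have "?S \<subseteq> {..degree q}"
  proof
    fix m assume "m \<in> ?S"
    then have "poly.coeff q m \<noteq> 0" by auto
    then show "m \<in> {..degree q}" using le_degree by auto
  qed
  then have fin: "finite ?S" using finite_subset by blast
  define m where "m = Max ?S"
  have m: "\<not> e dvd poly.coeff q m" using Max_in[OF fin ne] unfolding m_def by simp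
  have m': "e dvd poly.coeff q k" if "k > m" for k
  proof (rule ccontr)
    assume "\<not> e dvd poly.coeff q k"
    then have "k \<le> m" unfolding m_def by (intro Max_ge[OF fin]) simp
    then show False using that by simp
  qed
  let ?t = "\<lambda>i. poly.coeff F i * poly.coeff q (?d + m - i)"
  have "poly.coeff (F * q) (?d + m) = (\<Sum>i\<le>?d + m. ?t i)" by (rule coeff_mult)
  also have "\<dots> = ?t ?d + (\<Sum>i\<in>{..?d + m} - {?d}. ?t i)" by (rule sum.remove) auto
  finally have eq: "poly.coeff (F * q) (?d + m) = ?t ?d + (\<Sum>i\<in>{..?d + m} - {?d}. ?t i)" .
  have "e dvd (\<Sum>i\<in>{..?d + m} - {?d}. ?t i)"
  proof (rule dvd_sum)
    fix i assume i: "i \<in> {..?d + m} - {?d}"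
    show "e dvd ?t i"
    proof (cases "i < ?d")
      case True
      then show ?thesis using m'[of "?d + m - i"] by simp
    next
      case False
      then have "poly.coeff F i = 0" using i by (intro coeff_eq_0) auto
      then show ?thesis by simp
    qed
  qed
  moreover have "e dvd poly.coeff (F * q) (?d + m)" using dvd d by simp
  ultimately have "e dvd ?t ?d" unfolding eq using dvd_add_left_iff by blast
  then have "e dvd lead_coeff F * poly.coeff q m" by simp
  then show False using cop m by blast
qed

context cubic_ring
begin

text \<open>R/M is a field, so \<open>M\<close> contains 1 - r g for some r in R. Its norm is also
  in \<open>M\<close> and has the form 1 + g h with h in A: the inverse of g modulo \<open>M\<close>
  can be taken from A.\<close>

lemma maximalideal_comaximal:
  assumes M: "maximalideal M R" and g: "\<iota> g \<notin> M"
  shows "\<exists>h. \<iota> (1 + g * h) \<in> M"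
proof -
  interpret M: maximalideal M R by fact
  have id: "ideal (M <+> PIdl (\<iota> g)) R" using add_ideals M.is_ideal cgenideal_ideal by simp
  have sub: "M \<subseteq> M <+> PIdl (\<iota> g)"
  proof
    fix u assume u: "u \<in> M"
    have "\<zero> \<in> PIdl (\<iota> g)"
      using additive_subgroup.zero_closed[OF ideal.axioms(1)[OF cgenideal_ideal[OF iota_closed]]] .
    moreover have "u = u \<oplus> \<zero>" using M.Icarr[OF u] by simp
    ultimately show "u \<in> M <+> PIdl (\<iota> g)" unfolding set_add_def' using u by blast
  qed
  have "\<iota> g = \<zero> \<oplus> \<iota> g" by simp
  then have "\<iota> g \<in> M <+> PIdl (\<iota> g)"
    unfolding set_add_def' using M.zero_closed cgenideal_self[OF iota_closed[of g]] by blast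
  then have "M <+> PIdl (\<iota> g) = carrier R"
    using M.I_maximal[OF id sub] ideal.Icarr[OF id] g by blast
  then have "\<one> \<in> M <+> PIdl (\<iota> g)" by simp
  then obtain m r where m: "m \<in> M" "r \<in> carrier R" "\<one> = m \<oplus> r \<otimes> \<iota> g"
    unfolding set_add_def' cgenideal_def by blast
  obtain p q s where r: "r = emb p q s" using m(2) by (rule emb_cases)
  obtain p' q' s' where e: "m = emb p' q' s'" using M.Icarr[OF m(1)] by (rule emb_cases)
  have "emb 1 0 0 = emb (p' + p * g) (q' + q * g) (s' + s * g)"
    using m(3) unfolding r e emb_one[symmetric] \<iota>_def by (simp add: emb_mult emb_add)
  then have "p' = 1 - p * g" "q' = - (q * g)" "s' = - (s * g)"
    by (auto simp: algebra_simps eq_neg_iff_add_eq_0)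
  then have m': "m = emb (1 - p * g) (- (q * g)) (- (s * g))" using e by simp
  have "\<iota> (norm3 (1 - p * g) (- (q * g)) (- (s * g))) \<in> M"
    unfolding emb_mult_adjoint[symmetric] m'[symmetric] using m(1) by (intro M.I_r_closed) auto
  moreover define h where "h = - 3 * p + 3 * p ^ 2 * g - p ^ 3 * g ^ 2 - q ^ 3 * g ^ 2 * (pX ^ a) ^ 2 * pW ^ b
     - s ^ 3 * g ^ 2 * pX ^ a * (pW ^ b) ^ 2 - 3 * (1 - p * g) * q * g * s * pX ^ a * pW ^ b"
  have "norm3 (1 - p * g) (- (q * g)) (- (s * g)) = 1 + g * h"
    unfolding norm3_def h_def by (simp add: algebra_simps power2_eq_square power3_eq_cube)
  ultimately show ?thesis by metis
qed

text \<open>Suppose that \<open>M\<close> meets K[x] only in 0, and let F in M \<inter> A have least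
  positive degree in w, with leading coefficient l. All nonzero polynomials in x would be invertible
  modulo \<open>M\<close>, but pseudo-division by F shows that this is possible only for divisors of
  powers of l. A nonunit prime to l gives the contradiction.\<close>

lemma maximalideal_meets_x_line:
  assumes M: "maximalideal M R"
  shows "\<exists>f. f \<noteq> 0 \<and> \<iota> [:f:] \<in> M"
proof (rule ccontr)
  assume "\<not> ?thesis"
  then have no: "f = 0" if "\<iota> [:f:] \<in> M" for f using that by blast
  interpret M: maximalideal M R by fact
  \<comment> \<open>As x is not in \<open>M\<close>, some 1 + x h is. Its constant coefficient is 1,
    so M \<inter> A contains a nonzero element.\<close>
  have "\<iota> [:[:0, 1:]:] \<notin> M" using no[of "[:0, 1:]"] by auto
  then obtain h where h: "\<iota> (1 + [:[:0, 1:]:] * h) \<in> M" using maximalideal_comaximal[OF M] by blast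
  have "const_coeff (1 + pX * h) = 1" by simp
  then have "1 + [:[:0, 1:]:] * h \<noteq> 0" unfolding pX_def[symmetric] by (metis const_coeff_simps(4) zero_neq_one)
  with h have "\<iota> (1 + [:[:0, 1:]:] * h) \<in> M \<and> 1 + [:[:0, 1:]:] * h \<noteq> 0" by blast
  from ex_has_least_nat[of "\<lambda>F. \<iota> F \<in> M \<and> F \<noteq> 0", OF this, of degree]
  obtain F where F: "\<iota> F \<in> M" "F \<noteq> 0"
    and min: "\<And>G. \<iota> G \<in> M \<Longrightarrow> G \<noteq> 0 \<Longrightarrow> degree F \<le> degree G" by blast
  have d: "degree F > 0"
  proof (rule ccontr)
    assume "\<not> ?thesis"
    then obtain f where "F = [:f:]" using degree_eq_zeroE by auto
    then show False using F no by auto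
  qed
  define l where "l = lead_coeff F"
  have l: "l \<noteq> 0" using F unfolding l_def by simp
  \<comment> \<open>As in Euclid's proof, 1 + x l is prime to l; the factor x makes it nonconstant
    even if l is constant.\<close>
  define e where "e = 1 + [:0, 1:] * l"
  have dege: "degree e > 0"
  proof -
    have "degree ([:0, 1:] * l) = Suc (degree l)" using l by (simp add: degree_mult_eq)
    then show ?thesis unfolding e_def by (simp add: degree_add_eq_right)
  qed
  have e_one: "\<not> e dvd 1" using dege by (metis is_unit_iff_degree dvd_0_left_iff less_irrefl zero_neq_one)
  have cop: "e dvd t" if "e dvd l * t" for t
  proof -
    have "t = e * t - [:0, 1:] * (l * t)" unfolding e_def by (simp add: algebra_simps)
    then show ?thesis using that by (metis dvd_diff dvd_mult dvd_triv_left)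
  qed
  have "\<iota> [:e:] \<notin> M" using no[of e] dege by auto
  then obtain u where u: "\<iota> (1 + [:e:] * u) \<in> M" using maximalideal_comaximal[OF M] by blast
  let ?G = "1 + [:e:] * u"
  obtain q r where qr: "pseudo_divmod ?G F = (q, r)" by (cases "pseudo_divmod ?G F")
  define k where "k = Suc (degree ?G) - degree F"
  have div: "smult (l ^ k) ?G = F * q + r" "r = 0 \<or> degree r < degree F"
    using pseudo_divmod[OF F(2) qr] unfolding l_def k_def by auto
  have "r = [:l ^ k:] * ?G - F * q" using div(1) by simp
  then have "\<iota> r = \<iota> [:l ^ k:] \<otimes> \<iota> ?G \<ominus> \<iota> F \<otimes> \<iota> q" by (simp only: iota_diff iota_mult)
  also have "\<dots> \<in> M" unfolding a_minus_def
    using u F by (intro M.a_closed M.a_inv_closed M.I_l_closed M.I_r_closed) auto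
  finally have "r = 0" using min[of r] div(2) leD by blast
  then have Fq: "F * q = smult (l ^ k) ?G" using div(1) by simp
  have co: "poly.coeff (F * q) j = l ^ k * (poly.coeff 1 j + e * poly.coeff u j)" for j
    unfolding Fq by simp
  \<comment> \<open>The coefficients of \<open>F * q\<close> at positive indices are divisible by
    \<open>e\<close>, hence so are all those of \<open>q\<close>; at index 0 this leaves
    \<open>e dvd l ^ k\<close>.\<close>
  have "e dvd poly.coeff q 0"
  proof (rule dvd_coeff_of_product[OF d])
    show "e dvd t" if "e dvd lead_coeff F * t" for t
      using cop[unfolded l_def] that by blast
    show "e dvd poly.coeff (F * q) j" if "j > 0" for j unfolding co using that by simp
  qed
  then have "e dvd poly.coeff (F * q) 0" by (simp add: coeff_mult)
  then have "e dvd l ^ k + e * (l ^ k * poly.coeff u 0)" unfolding co by (simp add: algebra_simps)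
  then have "e dvd l ^ k" by (simp add: dvd_add_left_iff)
  moreover have "\<not> e dvd l ^ n" for n
  proof (induction n)
    case (Suc n)
    then show ?case using cop[of "l ^ n"] by auto
  qed (use e_one in simp)
  ultimately show False by blast
qed

lemma maximalideal_regular_pair:
  assumes M: "maximalideal M R"
  shows "\<exists>f g. \<iota> f \<in> M \<and> \<iota> g \<in> M \<and> prime_elem f \<and> \<not> f dvd g"
proof -
  interpret M: maximalideal M R by fact
  have pM: "primeideal M R" using maximalideal_prime[OF M] .
  interpret P: primeideal M R by fact
  obtain f0 where "\<iota> [:f0:] \<in> M \<and> f0 \<noteq> 0" using maximalideal_meets_x_line[OF M] by blast
  from ex_has_least_nat[of "\<lambda>f. \<iota> [:f:] \<in> M \<and> f \<noteq> 0", OF this, of degree]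
  obtain f where f: "\<iota> [:f:] \<in> M" "f \<noteq> 0"
    and min: "\<And>g. \<iota> [:g:] \<in> M \<Longrightarrow> g \<noteq> 0 \<Longrightarrow> degree f \<le> degree g" by blast
  have one: "\<one> \<notin> M" using M.I_notcarr M.one_imp_carrier by blast
  have const_mult: "\<iota> [:p * q:] = \<iota> [:p:] \<otimes> \<iota> [:q:]" for p q
  proof -
    have "[:p * q:] = [:p:] * [:q:]" by simp
    then show ?thesis by (simp only: iota_mult)
  qed
  have dvd: "f dvd g" if g: "\<iota> [:g:] \<in> M" for g
  proof -
    have "[:g mod f:] = [:g:] - [:f:] * [:g div f:]" by (simp add: minus_div_mult_eq_mod)
    then have "\<iota> [:g mod f:] = \<iota> [:g:] \<ominus> \<iota> [:f:] \<otimes> \<iota> [:g div f:]" by (simp only: iota_diff iota_mult)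
    also have "\<dots> \<in> M" unfolding a_minus_def
      using f g by (intro M.a_closed M.a_inv_closed M.I_r_closed) auto
    finally have "\<iota> [:g mod f:] \<in> M" .
    then have "g mod f = 0" using min[of "g mod f"] degree_mod_less[OF f(2), of g] leD by blast
    then show ?thesis by (simp add: mod_eq_0_iff_dvd)
  qed
  have unit: "\<not> f dvd 1"
  proof
    assume "f dvd 1"
    then obtain g where "1 = f * g" by (elim dvdE)
    then have "\<one> = \<iota> [:f * g:]" using iota_one by (simp flip: one_pCons)
    then have "\<one> = \<iota> [:f:] \<otimes> \<iota> [:g:]" by (simp only: const_mult)
    then show False using one M.I_r_closed[OF f(1) iota_closed] by metis
  qed
  have "prime_elem f"
  proof (rule prime_elemI)
    show "f \<noteq> 0" "\<not> f dvd 1" by fact+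
    fix p q assume "f dvd p * q"
    then obtain t where "p * q = f * t" by (elim dvdE)
    then have "\<iota> [:p:] \<otimes> \<iota> [:q:] = \<iota> [:f:] \<otimes> \<iota> [:t:]" by (simp flip: const_mult)
    then have "\<iota> [:p:] \<otimes> \<iota> [:q:] \<in> M" using M.I_r_closed[OF f(1) iota_closed] by metis
    then have "\<iota> [:p:] \<in> M \<or> \<iota> [:q:] \<in> M" using P.I_prime by simp
    then show "f dvd p \<or> f dvd q" using dvd by blast
  qed
  then have pf: "prime_elem [:f:]" by (rule lift_prime_elem_poly)
  \<comment> \<open>\<open>g\<close> is w if this is in \<open>M\<close>, and otherwise some 1 + w
    h. In both cases one coefficient is 1, so the nonunit \<open>f\<close> of K[x] does not divide
    it.\<close>
  have "\<exists>g. \<iota> g \<in> M \<and> \<not> [:f:] dvd g"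
  proof (cases "\<iota> pW \<in> M")
    case True
    have "\<not> [:f:] dvd pW"
    proof
      assume "[:f:] dvd pW"
      then have "f dvd poly.coeff pW 1" by (simp add: const_poly_dvd_iff)
      then show False using unit by (simp add: pW_def)
    qed
    then show ?thesis using True by blast
  next
    case False
    then obtain h where h: "\<iota> (1 + pW * h) \<in> M" using maximalideal_comaximal[OF M] by blast
    have "\<not> [:f:] dvd 1 + pW * h"
    proof
      assume "[:f:] dvd 1 + pW * h"
      then have "f dvd poly.coeff (1 + pW * h) 0" unfolding const_poly_dvd_iff by blast
      then show False using unit by (simp add: pW_def)
    qed
    then show ?thesis using h by blast
  qed
  then show ?thesis using f(1) pf by blast
qed

lemma prime_elem_regular_pair:
  assumes f: "prime_elem f" and g: "\<not> f dvd g" and r: "r \<in> carrier R"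
  shows "\<iota> f \<otimes> r = \<zero> \<Longrightarrow> r = \<zero>" "\<iota> g \<otimes> r \<in> Idl {\<iota> f} \<Longrightarrow> r \<in> Idl {\<iota> f}"
proof -
  obtain p q s where e: "r = emb p q s" using r by (rule emb_cases)
  show "r = \<zero>" if "\<iota> f \<otimes> r = \<zero>"
    using that prime_elem_not_zeroI[of f] f unfolding e iota_emb emb_zero[symmetric] by (auto simp: prime_elem_def)
  show "r \<in> Idl {\<iota> f}" if "\<iota> g \<otimes> r \<in> Idl {\<iota> f}"
    using that f g unfolding e iota_emb emb_mem_Idl by (simp add: prime_elem_dvd_mult_iff)
qed

end


section \<open>Conductor and tight closure\<close>

text \<open>If \<open>z\<^sup>3 = x\<^sup>3 d\<close> then \<open>z/x\<close> is integral, whence the elements of the conductor multiply \<open>z\<close> into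
  the ideal generated by \<open>x\<close>.\<close>

lemma (in cring) conductor_elements:
  assumes u: "u \<in> conductor R"
  shows "\<exists>\<sigma>\<in>carrier R. u = total_fractions_map R \<sigma> \<and>
    (\<forall>x\<in>nonzerodivisors R. \<forall>z\<in>carrier R. \<forall>d\<in>carrier R.
      z [^] (3::nat) = x [^] (3::nat) \<otimes> d \<longrightarrow> (\<exists>\<tau>\<in>carrier R. \<sigma> \<otimes> z = x \<otimes> \<tau>))"
proof -
  interpret fraction_ring R "nonzerodivisors R" by (rule fraction_ring_nonzerodivisors[OF is_cring])
  have Q: "total_fractions R = L" "total_fractions_map R = loc"
    by (simp_all add: total_fractions_def total_fractions_map_def)
  have uc: "u \<in> carrier L"
    and um: "\<And>v. v \<in> integral_closure R \<Longrightarrow> u \<otimes>\<^bsub>L\<^esub> v \<in> loc ` carrier R"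
    using u unfolding conductor_def Q by auto
  have int: "fr z x \<in> integral_closure R"
    if x: "x \<in> nonzerodivisors R" and z: "z \<in> carrier R" and d: "d \<in> carrier R"
      and e: "z [^] (3::nat) = x [^] (3::nat) \<otimes> d" for x z d
  proof -
    let ?v = "fr z x"
    have v: "?v \<in> carrier L" using x z by simp
    have x3: "x [^] (3::nat) \<in> nonzerodivisors R" by (rule fraction_pow(1)[OF z x])
    have "?v [^]\<^bsub>L\<^esub> (3::nat) = fr (z [^] (3::nat)) (x [^] (3::nat))" by (rule fraction_pow(2)[OF z x])
    also have "\<dots> = fr d \<one>"
      using x3 T_one d z by (intro fraction_eqI) (simp_all add: e m_comm)
    finally have v3: "?v [^]\<^bsub>L\<^esub> (3::nat) = loc d" by (simp add: loc_def)
    \<comment> \<open>The monic polynomial T^3 - d, of which z/x is a root.\<close>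
    let ?p = "[\<one>\<^bsub>L\<^esub>, \<zero>\<^bsub>L\<^esub>, \<zero>\<^bsub>L\<^esub>, \<ominus>\<^bsub>L\<^esub> loc d]"
    have "loc d \<in> carrier L" using d by simp
    then have "L.eval ?p ?v = \<zero>\<^bsub>L\<^esub>" using v v3 by (simp add: L.r_neg numeral_3_eq_3)
    moreover have "set ?p \<subseteq> loc ` carrier R"
    proof -
      have "loc \<one> \<in> loc ` carrier R" "loc \<zero> \<in> loc ` carrier R" "loc (\<ominus> d) \<in> loc ` carrier R"
        using d by (intro imageI; simp)+
      then show ?thesis using d by simp
    qed
    ultimately show ?thesis unfolding integral_closure_def integral_over_def Q
      using v by (intro CollectI conjI exI[of _ ?p]) simp_all
  qed
  have one: "\<one> \<in> nonzerodivisors R" by (rule T_one)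
  \<comment> \<open>Since 1 is integral, an element u = u 1 of the conductor comes from the ring
    itself.\<close>
  have "fr \<one> \<one> \<in> integral_closure R" using int[OF one one_closed one_closed] by simp
  then have "u \<in> loc ` carrier R" using um[of "\<one>\<^bsub>L\<^esub>"] uc by (simp add: fraction_one[symmetric])
  then obtain \<sigma> where \<sigma>: "\<sigma> \<in> carrier R" "u = loc \<sigma>" by blast
  have "\<exists>\<tau>\<in>carrier R. \<sigma> \<otimes> z = x \<otimes> \<tau>"
    if x: "x \<in> nonzerodivisors R" and z: "z \<in> carrier R" and d: "d \<in> carrier R"
      and e: "z [^] (3::nat) = x [^] (3::nat) \<otimes> d" for x z d
  proof -
    obtain \<tau> where \<tau>: "\<tau> \<in> carrier R" "u \<otimes>\<^bsub>L\<^esub> fr z x = loc \<tau>" using um[OF int[OF x z d e]] by blast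
    have "u \<otimes>\<^bsub>L\<^esub> fr z x = fr (\<sigma> \<otimes> z) x"
      unfolding \<sigma>(2) loc_def using \<sigma>(1) z x one fraction_mult[of \<sigma> z "\<one>" x] by simp
    then have "fr (\<sigma> \<otimes> z) x = fr \<tau> \<one>" using \<tau>(2) by (simp add: loc_def)
    then obtain t where t: "t \<in> nonzerodivisors R"
      "t \<otimes> (\<sigma> \<otimes> z \<otimes> \<one>) = t \<otimes> (\<tau> \<otimes> x)"
      using fraction_eq[of "\<sigma> \<otimes> z" \<tau> x "\<one>"] \<sigma>(1) z \<tau>(1) x one by auto
    have c: "t \<in> carrier R" "x \<in> carrier R" using t(1) x by simp_all
    let ?g = "\<sigma> \<otimes> z \<ominus> \<tau> \<otimes> x"
    have "t \<otimes> ?g = \<zero>"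
      using t(2) c \<sigma>(1) z \<tau>(1) by (simp add: a_minus_def r_distr r_minus r_neg)
    then have "?g = \<zero>" using t(1) c \<sigma>(1) z \<tau>(1) unfolding nonzerodivisors_def by blast
    then have "\<sigma> \<otimes> z = \<tau> \<otimes> x" using c \<sigma>(1) z \<tau>(1) by (simp add: r_right_minus_eq)
    then show ?thesis using \<tau>(1) c m_comm by metis
  qed
  then show ?thesis using \<sigma> unfolding Q by blast
qed

text \<open>Morally z/x is a root of T^3 - d, so its powers are multiples by powers of d of 1, z/x
  and (z/x)^2, with common denominator x^2. The induction lowers q by 3.\<close>

lemma (in cring) cube_dvd_imp_power_dvd:
  assumes c: "x \<in> carrier R" "z \<in> carrier R" "d \<in> carrier R"
    and e: "z [^] (3::nat) = x [^] (3::nat) \<otimes> d"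
  shows "\<exists>r\<in>carrier R. x [^] (2::nat) \<otimes> z [^] (q::nat) = x [^] q \<otimes> r"
proof (induction q rule: less_induct)
  case (less q)
  consider "q = 0" | "q = 1" | "q = 2" | "q \<ge> 3" by linarith
  then show ?case
  proof cases
    case 1
    then show ?thesis using c by (intro bexI[of _ "x [^] (2::nat)"]) auto
  next
    case 2
    then show ?thesis using c by (intro bexI[of _ "x \<otimes> z"]) (auto simp: numeral_2_eq_2 m_assoc)
  next
    case 3
    then show ?thesis using c by (intro bexI[of _ "z [^] (2::nat)"]) auto
  next
    case 4
    obtain r where r: "r \<in> carrier R" "x [^] (2::nat) \<otimes> z [^] (q - 3) = x [^] (q - 3) \<otimes> r"
      using less[of "q - 3"] 4 by auto
    have q: "q = (q - 3) + 3" using 4 by simp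
    have "x [^] (2::nat) \<otimes> z [^] q = (x [^] (2::nat) \<otimes> z [^] (q - 3)) \<otimes> z [^] (3::nat)"
      by (subst q) (use c in \<open>simp add: nat_pow_mult[symmetric] m_assoc\<close>)
    also have "\<dots> = (x [^] (q - 3) \<otimes> x [^] (3::nat)) \<otimes> (r \<otimes> d)"
      unfolding r(2) e using c r(1) by (simp add: m_ac)
    also have "x [^] (q - 3) \<otimes> x [^] (3::nat) = x [^] q" using c(1) 4 by (simp add: nat_pow_mult)
    finally show ?thesis using r(1) c by blast
  qed
qed

text \<open>The multiplier required by the definition is x^2, uniformly in the exponent: x^2 z^q is
  a multiple of x^q, which is in the Frobenius power.\<close>

lemma (in cring) mem_tight_closure_of_cube:
  assumes J: "J \<subseteq> carrier R" "x \<in> J" and x: "x \<in> nonzerodivisors R"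
    and c: "z \<in> carrier R" "d \<in> carrier R" and e: "z [^] (3::nat) = x [^] (3::nat) \<otimes> d"
  shows "z \<in> tight_closure R J"
proof -
  interpret N: fraction_ring R "nonzerodivisors R" by (rule fraction_ring_nonzerodivisors[OF is_cring])
  have xc: "x \<in> carrier R" using x by simp
  have x2: "x [^] (2::nat) \<in> nonzerodivisors R" by (rule N.fraction_pow(1)[OF xc x])
  have "x [^] (2::nat) \<otimes> z [^] q \<in> frobenius_power R J q" for q :: nat
  proof -
    obtain r where r: "r \<in> carrier R" "x [^] (2::nat) \<otimes> z [^] q = x [^] q \<otimes> r"
      using cube_dvd_imp_power_dvd[OF xc c e] by blast
    have sub: "(\<lambda>j. j [^] q) ` J \<subseteq> carrier R" using J(1) by auto
    interpret F: ideal "frobenius_power R J q" R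
      unfolding frobenius_power_def by (rule genideal_ideal[OF sub])
    have "x [^] q \<in> frobenius_power R J q"
      unfolding frobenius_power_def using genideal_self[OF sub] J(2) by blast
    then show ?thesis unfolding r(2) using r(1) by (rule F.I_r_closed)
  qed
  moreover have "\<forall>p. minimal_prime R p \<longrightarrow> x [^] (2::nat) \<notin> p"
    using nonzerodivisor_notin_minimal_prime x2 by blast
  ultimately show ?thesis unfolding tight_closure_def using c(1) xc
    by (intro CollectI conjI bexI[of _ "x [^] (2::nat)"] exI[of _ 0]) auto
qed

section \<open>The local ring at the origin\<close>

lemma pX_pow: "pX ^ n = [:[:0, 1:] ^ n:]" and pW_pow: "pW ^ n = Polynomial.monom 1 n"
  unfolding pX_def pW_def by (simp_all add: poly_const_pow monom_altdef)

lemma pX_power_neq_pW_power: "j > 0 \<Longrightarrow> pX ^ i \<noteq> pW ^ j"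
proof
  assume j: "j > 0" and e: "(pX :: 'k::field poly poly) ^ i = pW ^ j"
  have "poly (pX ^ i) 0 = ([:0, 1:] :: 'k poly) ^ i" by (simp add: pX_pow)
  moreover have "poly (pW ^ j) 0 = (0 :: 'k poly)" using j by (simp add: pW_def poly_power)
  ultimately show False using e by simp
qed

lemma pX_nonzero: "pX \<noteq> 0" and pW_nonzero: "pW \<noteq> 0"
  by (simp_all add: pX_def pW_def)

context cubic_ring
begin

sublocale m: local_fraction_ring R \<mm>
  by (intro local_fraction_ring.intro is_cring maximalideal_prime maximalideal_m)

lemma localization_at_m: "localization_at R \<mm> = m.L" "localization_at_map R \<mm> = m.loc"
  by (simp_all add: localization_at_def localization_at_map_def)

lemma maximalideal_localization:
  assumes M: "maximalideal M R"
  shows "cohen_macaulay_local (localization_at R M)" "\<exists>C. prime_chain R C 2"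
    "prime_height (localization_at R M) (fraction_ring.ext R (carrier R - M) M) = 2"
proof -
  interpret M: local_fraction_ring R M
    by (intro local_fraction_ring.intro is_cring maximalideal_prime M)
  obtain f g where fg: "\<iota> f \<in> M" "\<iota> g \<in> M" "prime_elem f" "\<not> f dvd g"
    using maximalideal_regular_pair[OF M] by blast
  have d: "n \<le> 2" if "prime_chain R C n" for C n using that by (rule prime_chain_le_2)
  have f: "r = \<zero>" if "r \<in> carrier R" "\<iota> f \<otimes> r = \<zero>" for r
    using prime_elem_regular_pair(1)[OF fg(3,4) that] .
  have g: "r \<in> Idl {\<iota> f}" if "r \<in> carrier R" "\<iota> g \<otimes> r \<in> Idl {\<iota> f}" for r
    using prime_elem_regular_pair(2)[OF fg(3,4) that] .
  show "cohen_macaulay_local (localization_at R M)" "\<exists>C. prime_chain R C 2"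
    "prime_height (localization_at R M) (fraction_ring.ext R (carrier R - M) M) = 2"
    unfolding localization_at_def
    by (rule M.regular_pair_localization[OF noetherian _ fg(1) _ fg(2)]; (erule d | erule (1) f | erule (1) g))+
qed

lemma krull_dim_R: "krull_dim R = 2"
proof -
  obtain C where C: "prime_chain R C 2" using maximalideal_localization(2)[OF maximalideal_m] by blast
  show ?thesis using krull_dim_eqI[OF C prime_chain_le_2] by (simp add: numeral_eq_enat)
qed

lemma cohen_macaulay_R: "cohen_macaulay_ring R"
  unfolding cohen_macaulay_ring_def
  using is_cring noetherian maximalideal_localization(1) by blast

lemma iota_mult_eq_zero:
  assumes "g \<noteq> 0" "r \<in> carrier R" "\<iota> g \<otimes> r = \<zero>"
  shows "r = \<zero>"
proof -
  obtain p q s where e: "r = emb p q s" using assms(2) by (rule emb_cases)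
  show ?thesis using assms(1,3) unfolding e iota_emb emb_zero[symmetric] by simp
qed

lemma loc_iota_nonzerodivisor:
  assumes "g \<noteq> 0"
  shows "m.loc (\<iota> g) \<in> nonzerodivisors m.L"
proof -
  have "u = \<zero>\<^bsub>m.L\<^esub>" if u: "u \<in> carrier m.L" "m.loc (\<iota> g) \<otimes>\<^bsub>m.L\<^esub> u = \<zero>\<^bsub>m.L\<^esub>" for u
  proof -
    obtain r s where r: "r \<in> carrier R" "s \<in> carrier R - \<mm>" "u = m.fr r s"
      using m.fraction_cases[OF u(1)] by blast
    have "m.fr (\<iota> g \<otimes> r) s = \<zero>\<^bsub>m.L\<^esub>"
      using u(2) r m.T_one m.fraction_mult[of "\<iota> g" r \<one> s] by (simp add: m.loc_def)
    then obtain t where t: "t \<in> carrier R - \<mm>" "t \<otimes> (\<iota> g \<otimes> r) = \<zero>"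
      using m.fraction_eq_zero[of "\<iota> g \<otimes> r" s] r by auto
    have "\<iota> g \<otimes> (t \<otimes> r) = t \<otimes> (\<iota> g \<otimes> r)" using t(1) r by (simp add: m_ac)
    then have "t \<otimes> r = \<zero>" using iota_mult_eq_zero[OF assms, of "t \<otimes> r"] t r by simp
    then show ?thesis using m.fraction_eq_zero[of r s] r t(1) by auto
  qed
  then show ?thesis unfolding nonzerodivisors_def by simp
qed

section \<open>Parameter ideals generated by powers of x and w\<close>

definition pair_ideal :: "nat \<Rightarrow> nat \<Rightarrow> ('a \<times> 'a) set set" where
  "pair_ideal i j = Idl\<^bsub>m.L\<^esub> {m.loc (\<iota> (pX ^ i)), m.loc (\<iota> (pW ^ j))}"

lemma pair_ideal_eq: "pair_ideal i j = m.ext (Idl {\<iota> (pX ^ i), \<iota> (pW ^ j)})"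
  unfolding pair_ideal_def using m.genideal_loc[of "{\<iota> (pX ^ i), \<iota> (pW ^ j)}"] by simp

lemma fraction_mem_pair_ideal:
  assumes "r \<in> carrier R" "s \<in> carrier R - \<mm>"
  shows "m.fr r s \<in> pair_ideal i j \<longleftrightarrow> (\<exists>t\<in>carrier R - \<mm>. t \<otimes> r \<in> Idl {\<iota> (pX ^ i), \<iota> (pW ^ j)})"
  unfolding pair_ideal_eq by (rule m.fraction_mem_ext[OF genideal_ideal assms]) simp

lemma ideal_pair_ideal: "ideal (pair_ideal i j) m.L"
  unfolding pair_ideal_def by (rule m.L.genideal_ideal) simp

lemma pair_ideal_gens: "m.loc (\<iota> (pX ^ i)) \<in> pair_ideal i j" "m.loc (\<iota> (pW ^ j)) \<in> pair_ideal i j"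
  unfolding pair_ideal_def
  using m.L.genideal_self[of "{m.loc (\<iota> (pX ^ i)), m.loc (\<iota> (pW ^ j))}"] by simp_all

text \<open>By \<open>primeideal_eq_m\<close> the maximal ideal is the only prime of the
  localization over the pair, and its height is two.\<close>

lemma parameter_ideal_pair:
  assumes ij: "i > 0" "j > 0"
  shows "parameter_ideal m.L (pair_ideal i j)"
proof -
  let ?A = "{m.loc (\<iota> (pX ^ i)), m.loc (\<iota> (pW ^ j))}"
  have "primeideal P m.L \<and> pair_ideal i j \<subseteq> P \<longleftrightarrow> P = m.ext \<mm>" for P
  proof
    assume P: "primeideal P m.L \<and> pair_ideal i j \<subseteq> P"
    have "m.contr P = \<mm>"
    proof (rule primeideal_eq_m[OF m.primeideal_contr])
      show "primeideal P m.L" using P by blast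
      show "\<iota> (pX ^ i) \<in> m.contr P" "\<iota> (pW ^ j) \<in> m.contr P"
        unfolding m.contr_def using P pair_ideal_gens[where i=i and j=j] by auto
    qed
    then show "P = m.ext \<mm>" using m.ext_contr[of P] P primeideal.axioms(1) by metis
  next
    have "const_coeff (pX ^ i) = 0" "const_coeff (pW ^ j) = 0" using ij by (simp_all add: power_0_left)
    then have "\<iota> (pX ^ i) \<in> \<mm>" "\<iota> (pW ^ j) \<in> \<mm>" unfolding \<iota>_def emb_mem_m by auto
    then have "?A \<subseteq> m.ext \<mm>"
      using m.fraction_mem_ext_P[of _ \<one>] m.T_one by (simp add: m.loc_def)
    then have "pair_ideal i j \<subseteq> m.ext \<mm>"
      unfolding pair_ideal_def by (rule m.L.genideal_minimal[OF m.ideal_ext[OF m.P.is_ideal]])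
    moreover assume "P = m.ext \<mm>"
    ultimately show "primeideal P m.L \<and> pair_ideal i j \<subseteq> P" using m.primeideal_ext_P by blast
  qed
  then have "{prime_height m.L P | P. primeideal P m.L \<and> pair_ideal i j \<subseteq> P} = {prime_height m.L (m.ext \<mm>)}"
    by auto
  also have "prime_height m.L (m.ext \<mm>) = 2"
    using maximalideal_localization(3)[OF maximalideal_m] by (simp add: localization_at_def)
  finally have h: "ideal_height m.L (pair_ideal i j) = 2" unfolding ideal_height_def by simp
  \<comment> \<open>\<open>parameter_ideal\<close> counts a set of generators, so the two have to be
    distinct.\<close>
  have "m.loc (\<iota> (pX ^ i)) \<noteq> m.loc (\<iota> (pW ^ j))"
  proof
    assume e: "m.loc (\<iota> (pX ^ i)) = m.loc (\<iota> (pW ^ j))"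
    have "m.loc (\<iota> (pX ^ i - pW ^ j)) \<otimes>\<^bsub>m.L\<^esub> \<one>\<^bsub>m.L\<^esub> = \<zero>\<^bsub>m.L\<^esub>"
      using e by (simp add: iota_diff a_minus_def m.L.r_neg)
    then have "\<one>\<^bsub>m.L\<^esub> = \<zero>\<^bsub>m.L\<^esub>"
      using loc_iota_nonzerodivisor[of "pX ^ i - pW ^ j"] pX_power_neq_pW_power[OF ij(2)] m.L.one_closed
      unfolding nonzerodivisors_def by (metis (mono_tags, lifting) mem_Collect_eq right_minus_eq)
    then have "\<one>\<^bsub>m.L\<^esub> \<in> m.ext \<mm>"
      using additive_subgroup.zero_closed[OF ideal.axioms(1)[OF m.ideal_ext[OF m.P.is_ideal]]] by simp
    then show False using m.ext_P_proper ideal.one_imp_carrier[OF m.ideal_ext[OF m.P.is_ideal]] by blast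
  qed
  then have "card ?A = 2" by simp
  then have "enat (card ?A) = ideal_height m.L (pair_ideal i j)" unfolding h by (simp add: numeral_eq_enat)
  then show ?thesis unfolding parameter_ideal_def
    by (intro exI[of _ ?A]) (simp add: pair_ideal_def)
qed

text \<open>Compare the coefficients of x^0 w^n: multiples of x and of w^(n+1) contribute
  nothing.\<close>

lemma comb_pX_pW_power: "comb (pX ^ Suc 0) (pW ^ Suc n) (pW ^ n * p) \<Longrightarrow> const_coeff p = 0"
proof -
  assume "comb (pX ^ Suc 0) (pW ^ Suc n) (pW ^ n * p)"
  then obtain u v where "pW ^ n * p = pX * u + pW ^ Suc n * v" unfolding comb_def by auto
  then have "bcoeff (pW ^ n * p) n 0
      = bcoeff (pX * u + pW ^ Suc n * v) n 0" by simp
  then show ?thesis unfolding pW_pow const_coeff_def by (simp add: coeff_monom_mult pX_def)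
qed

text \<open>Set w = 0 and cancel x^n.\<close>

lemma comb_pX_power_pW: "comb (pX ^ Suc n) (pW ^ Suc 0) (pX ^ n * p) \<Longrightarrow> const_coeff p = 0"
proof -
  assume "comb (pX ^ Suc n) (pW ^ Suc 0) (pX ^ n * p)"
  then obtain u v where "pX ^ n * p = pX ^ Suc n * u + pW * v" unfolding comb_def by auto
  then have "poly.coeff (pX ^ n * p) 0 = poly.coeff (pX ^ Suc n * u + pW * v) 0" by simp
  then have "[:0, 1:] ^ n * poly.coeff p 0 = [:0, 1:] ^ n * ([:0, 1:] * poly.coeff u 0)"
    unfolding pX_pow by (simp add: pW_def mult.assoc)
  then have "[:0, 1:] ^ n = (0 :: 'k poly) \<or> poly.coeff p 0 = [:0, 1:] * poly.coeff u 0"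
    by (simp only: mult_cancel_left)
  then have "poly.coeff p 0 = [:0, 1:] * poly.coeff u 0" by simp
  then show ?thesis unfolding const_coeff_def by simp
qed

text \<open>The product with z gives the constant terms of p and s. Multiplication by y moves (p, q,
  s) to (x^a w^b s, p, x^a q), and its last coordinate gives the constant term of q.\<close>

lemma mem_Idl_of_products:
  assumes r: "r \<in> carrier R"
    and z: "r \<otimes> emb 0 0 1 \<in> Idl {\<iota> (pX ^ Suc 0), \<iota> (pW ^ Suc b)}"
    and y: "r \<otimes> emb 0 1 0 \<in> Idl {\<iota> (pX ^ Suc a), \<iota> (pW ^ Suc 0)}"
  shows "r \<in> Idl {\<iota> (pX ^ Suc 0), \<iota> (pW ^ Suc 0)}"
proof -
  obtain p q s where e: "r = emb p q s" using r by (rule emb_cases)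
  have "comb (pX ^ Suc 0) (pW ^ Suc b) (pW ^ b * s)" "comb (pX ^ Suc 0) (pW ^ Suc b) p"
    using z unfolding e emb_mult emb_mem_Idl2 by simp_all
  then have "const_coeff s = 0" "const_coeff p = 0"
    using comb_pX_pW_power by (auto simp: comb_def)
  moreover have "comb (pX ^ Suc a) (pW ^ Suc 0) (pX ^ a * q)"
    using y unfolding e emb_mult emb_mem_Idl2 by simp
  then have "const_coeff q = 0" by (rule comb_pX_power_pW)
  ultimately show ?thesis unfolding e emb_mem_Idl2 by (simp add: const_coeff_eq_0_iff)
qed

lemma mem_pair_ideal_of_products:
  assumes u: "u \<in> carrier m.L"
    and z: "u \<otimes>\<^bsub>m.L\<^esub> m.loc (emb 0 0 1) \<in> pair_ideal (Suc 0) (Suc b)"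
    and y: "u \<otimes>\<^bsub>m.L\<^esub> m.loc (emb 0 1 0) \<in> pair_ideal (Suc a) (Suc 0)"
  shows "u \<in> pair_ideal (Suc 0) (Suc 0)"
proof -
  obtain r s where r: "r \<in> carrier R" "s \<in> carrier R - \<mm>" "u = m.fr r s"
    using m.fraction_cases[OF u] by blast
  have prod: "u \<otimes>\<^bsub>m.L\<^esub> m.loc (emb p q t) = m.fr (r \<otimes> emb p q t) s" for p q t
    unfolding r(3) m.loc_def using r(1,2) m.T_one m.fraction_mult[of r "emb p q t" s \<one>] by simp
  have rc: "r \<otimes> emb p q t \<in> carrier R" for p q t using r(1) by simp
  obtain t1 where t1: "t1 \<in> carrier R - \<mm>"
    "t1 \<otimes> (r \<otimes> emb 0 0 1) \<in> Idl {\<iota> (pX ^ Suc 0), \<iota> (pW ^ Suc b)}"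
    using z unfolding prod fraction_mem_pair_ideal[OF rc r(2)] by blast
  obtain t2 where t2: "t2 \<in> carrier R - \<mm>"
    "t2 \<otimes> (r \<otimes> emb 0 1 0) \<in> Idl {\<iota> (pX ^ Suc a), \<iota> (pW ^ Suc 0)}"
    using y unfolding prod fraction_mem_pair_ideal[OF rc r(2)] by blast
  interpret I1: ideal "Idl {\<iota> (pX ^ Suc 0), \<iota> (pW ^ Suc b)}" R by (rule genideal_ideal) simp
  interpret I2: ideal "Idl {\<iota> (pX ^ Suc a), \<iota> (pW ^ Suc 0)}" R by (rule genideal_ideal) simp
  have c: "t1 \<in> carrier R" "t2 \<in> carrier R" using t1 t2 by auto
  have "t1 \<otimes> t2 \<otimes> r \<in> Idl {\<iota> (pX ^ Suc 0), \<iota> (pW ^ Suc 0)}"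
  proof (rule mem_Idl_of_products)
    show "t1 \<otimes> t2 \<otimes> r \<in> carrier R" using c r(1) by simp
    have "t1 \<otimes> t2 \<otimes> r \<otimes> emb 0 0 1 = t2 \<otimes> (t1 \<otimes> (r \<otimes> emb 0 0 1))" using c r(1) by (simp add: m_ac)
    then show "t1 \<otimes> t2 \<otimes> r \<otimes> emb 0 0 1 \<in> Idl {\<iota> (pX ^ Suc 0), \<iota> (pW ^ Suc b)}"
      using I1.I_l_closed[OF t1(2) c(2)] by (simp only:)
    have "t1 \<otimes> t2 \<otimes> r \<otimes> emb 0 1 0 = t1 \<otimes> (t2 \<otimes> (r \<otimes> emb 0 1 0))" using c r(1) by (simp add: m_ac)
    then show "t1 \<otimes> t2 \<otimes> r \<otimes> emb 0 1 0 \<in> Idl {\<iota> (pX ^ Suc a), \<iota> (pW ^ Suc 0)}"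
      using I2.I_l_closed[OF t2(2) c(1)] by (simp only:)
  qed
  moreover have "t1 \<otimes> t2 \<in> carrier R - \<mm>" using m.T_mult t1(1) t2(1) by blast
  ultimately show ?thesis unfolding r(3) fraction_mem_pair_ideal[OF r(1,2)] by blast
qed

text \<open>z^3 = w^b y z = x^a w^(2b), and x^3 divides x^a. Symmetrically, y^3 = x^(2a) w^b and w^3
  divides w^b.\<close>

lemma cube_z: "a \<ge> 3 \<Longrightarrow> emb 0 0 1 [^] (3::nat) = \<iota> pX [^] (3::nat) \<otimes> \<iota> (pX ^ (a - 3) * pW ^ b * pW ^ b)"
proof -
  assume "a \<ge> 3"
  then have "pX ^ a = pX ^ 3 * (pX ^ (a - 3) :: 'k poly poly)" by (simp flip: power_add)
  moreover have "emb 0 0 1 [^] (3::nat) = \<iota> (pX ^ a * pW ^ b * pW ^ b)"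
    unfolding \<iota>_def by (simp add: numeral_3_eq_3 emb_mult flip: emb_one)
  ultimately show ?thesis by (simp only: iota_mult[symmetric] iota_pow[symmetric] mult.assoc)
qed

lemma cube_y: "b \<ge> 3 \<Longrightarrow> emb 0 1 0 [^] (3::nat) = \<iota> pW [^] (3::nat) \<otimes> \<iota> (pW ^ (b - 3) * pX ^ a * pX ^ a)"
proof -
  assume "b \<ge> 3"
  then have "pW ^ b = pW ^ 3 * (pW ^ (b - 3) :: 'k poly poly)" by (simp flip: power_add)
  moreover have "emb 0 1 0 [^] (3::nat) = \<iota> (pW ^ b * pX ^ a * pX ^ a)"
    unfolding \<iota>_def by (simp add: numeral_3_eq_3 emb_mult mult_ac flip: emb_one)
  ultimately show ?thesis by (simp only: iota_mult[symmetric] iota_pow[symmetric] mult.assoc)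
qed

lemma loc_cube:
  assumes "u \<in> carrier R" "v \<in> carrier R" "w \<in> carrier R" "u [^] (3::nat) = v [^] (3::nat) \<otimes> w"
  shows "m.loc u [^]\<^bsub>m.L\<^esub> (3::nat) = m.loc v [^]\<^bsub>m.L\<^esub> (3::nat) \<otimes>\<^bsub>m.L\<^esub> m.loc w"
  using assms by (metis m.loc.hom_mult m.loc.ring.hom_nat_pow nat_pow_closed)

lemma conductor_subset:
  assumes "a \<ge> 3" "b \<ge> 3"
  shows "conductor m.L \<subseteq> total_fractions_map m.L ` pair_ideal (Suc 0) (Suc 0)"
proof
  fix u assume "u \<in> conductor m.L"
  then obtain \<sigma> where \<sigma>: "\<sigma> \<in> carrier m.L" "u = total_fractions_map m.L \<sigma>"
    and *: "\<And>x z d. x \<in> nonzerodivisors m.L \<Longrightarrow> z \<in> carrier m.L \<Longrightarrow> d \<in> carrier m.L \<Longrightarrow>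
      z [^]\<^bsub>m.L\<^esub> (3::nat) = x [^]\<^bsub>m.L\<^esub> (3::nat) \<otimes>\<^bsub>m.L\<^esub> d \<Longrightarrow> \<exists>\<tau>\<in>carrier m.L. \<sigma> \<otimes>\<^bsub>m.L\<^esub> z = x \<otimes>\<^bsub>m.L\<^esub> \<tau>"
    using m.L.conductor_elements by metis
  have "\<exists>\<tau>\<in>carrier m.L. \<sigma> \<otimes>\<^bsub>m.L\<^esub> m.loc (emb 0 0 1) = m.loc (\<iota> pX) \<otimes>\<^bsub>m.L\<^esub> \<tau>"
    by (rule *[OF loc_iota_nonzerodivisor[OF pX_nonzero] _ _ loc_cube[OF _ _ _ cube_z[OF assms(1)]]]) simp_all
  then have z: "\<sigma> \<otimes>\<^bsub>m.L\<^esub> m.loc (emb 0 0 1) \<in> pair_ideal (Suc 0) (Suc b)"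
    using ideal.I_r_closed[OF ideal_pair_ideal] pair_ideal_gens(1)[of "Suc 0" "Suc b"] by fastforce
  have "\<exists>\<tau>\<in>carrier m.L. \<sigma> \<otimes>\<^bsub>m.L\<^esub> m.loc (emb 0 1 0) = m.loc (\<iota> pW) \<otimes>\<^bsub>m.L\<^esub> \<tau>"
    by (rule *[OF loc_iota_nonzerodivisor[OF pW_nonzero] _ _ loc_cube[OF _ _ _ cube_y[OF assms(2)]]]) simp_all
  then have y: "\<sigma> \<otimes>\<^bsub>m.L\<^esub> m.loc (emb 0 1 0) \<in> pair_ideal (Suc a) (Suc 0)"
    using ideal.I_r_closed[OF ideal_pair_ideal] pair_ideal_gens(2)[of "Suc 0" "Suc a"] by fastforce
  show "u \<in> total_fractions_map m.L ` pair_ideal (Suc 0) (Suc 0)"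
    unfolding \<sigma>(2) using mem_pair_ideal_of_products[OF \<sigma>(1) z y] by blast
qed

lemma parameter_test_ideal_subset:
  assumes "a \<ge> 3" "b \<ge> 3"
  shows "parameter_test_ideal m.L \<subseteq> pair_ideal (Suc 0) (Suc 0)"
proof
  fix c assume c: "c \<in> parameter_test_ideal m.L"
  have cc: "c \<in> carrier m.L"
    and t: "\<And>J s. parameter_ideal m.L J \<Longrightarrow> s \<in> tight_closure m.L J \<Longrightarrow> c \<otimes>\<^bsub>m.L\<^esub> s \<in> J"
    using c unfolding parameter_test_ideal_def by auto
  have sub: "pair_ideal i j \<subseteq> carrier m.L" for i j using ideal.Icarr[OF ideal_pair_ideal] by blast
  have "m.loc (emb 0 0 1) \<in> tight_closure m.L (pair_ideal (Suc 0) (Suc b))"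
    by (rule m.L.mem_tight_closure_of_cube[OF sub _ loc_iota_nonzerodivisor[OF pX_nonzero] _ _
          loc_cube[OF _ _ _ cube_z[OF assms(1)]]])
       (use pair_ideal_gens(1)[of "Suc 0"] in simp_all)
  then have z: "c \<otimes>\<^bsub>m.L\<^esub> m.loc (emb 0 0 1) \<in> pair_ideal (Suc 0) (Suc b)"
    using t parameter_ideal_pair by simp
  have "m.loc (emb 0 1 0) \<in> tight_closure m.L (pair_ideal (Suc a) (Suc 0))"
    by (rule m.L.mem_tight_closure_of_cube[OF sub _ loc_iota_nonzerodivisor[OF pW_nonzero] _ _
          loc_cube[OF _ _ _ cube_y[OF assms(2)]]])
       (use pair_ideal_gens(2)[where j="Suc 0"] in simp_all)
  then have y: "c \<otimes>\<^bsub>m.L\<^esub> m.loc (emb 0 1 0) \<in> pair_ideal (Suc a) (Suc 0)"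
    using t parameter_ideal_pair by simp
  show "c \<in> pair_ideal (Suc 0) (Suc 0)" by (rule mem_pair_ideal_of_products[OF cc z y])
qed

end


section \<open>Reducedness of completions\<close>

lemma ideal_power_0: "I [^]\<^bsub>ideals_set S\<^esub> (0::nat) = carrier S"
  and ideal_power_Suc: "I [^]\<^bsub>ideals_set S\<^esub> Suc n = (I [^]\<^bsub>ideals_set S\<^esub> n) \<cdot>\<^bsub>S\<^esub> I"
  by (simp_all add: nat_pow_def ideals_set_def)

lemma (in ring) ideal_power:
  assumes "ideal I R"
  shows "ideal (I [^]\<^bsub>ideals_set R\<^esub> (n::nat)) R"
proof (induction n)
  case 0
  show ?case unfolding ideal_power_0 by (rule oneideal)
next
  case (Suc n)
  then show ?case unfolding ideal_power_Suc by (rule ideal_prod_is_ideal[OF _ assms])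
qed

lemma (in ring) ideal_power_antimono:
  assumes "ideal I R" "m \<le> n"
  shows "I [^]\<^bsub>ideals_set R\<^esub> (n::nat) \<subseteq> I [^]\<^bsub>ideals_set R\<^esub> (m::nat)"
  using assms(2)
proof (induction n rule: dec_induct)
  case (step n)
  then show ?case
    unfolding ideal_power_Suc using ideal_prod_inter[OF ideal_power[OF assms(1), of n] assms(1)] by blast
qed simp

lemma adic_completion_pow:
  "(f [^]\<^bsub>adic_completion S I\<^esub> (k::nat)) n = f n [^]\<^bsub>S Quot (I [^]\<^bsub>ideals_set S\<^esub> n)\<^esub> k"
  by (induction k) (simp_all add: nat_pow_def adic_completion_def Let_def)

lemma (in ideal) rcoset_pow:
  assumes "u \<in> carrier R" "cring R"
  shows "(I +> u) [^]\<^bsub>R Quot I\<^esub> (k::nat) = I +> (u [^] k)"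
  using ring_hom_ring.hom_nat_pow[OF rcos_ring_hom_ring assms(1)] by simp

text \<open>A coherent sequence is represented at a level above both n and N by a single element u
  of \<open>S\<close>. If the sequence is nonzero at level n, then u is outside the n-th power, so
  its k-th power is nonzero at level N.\<close>

lemma reduced_adic_completion:
  assumes S: "cring S" and I: "ideal I S"
    and crit: "\<And>n k. \<exists>N. \<forall>u\<in>carrier S. u \<notin> I [^]\<^bsub>ideals_set S\<^esub> (n::nat) \<longrightarrow>
        u [^]\<^bsub>S\<^esub> (k::nat) \<notin> I [^]\<^bsub>ideals_set S\<^esub> (N::nat)"
  shows "reduced_ring (adic_completion S I)"
  unfolding reduced_ring_def
proof (intro ballI allI impI)
  interpret cring S by fact
  let ?C = "adic_completion S I" and ?I = "\<lambda>n::nat. I [^]\<^bsub>ideals_set S\<^esub> n"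
  fix f k assume f: "f \<in> carrier ?C" and z: "f [^]\<^bsub>?C\<^esub> (k::nat) = \<zero>\<^bsub>?C\<^esub>"
  have zero: "\<zero>\<^bsub>?C\<^esub> = ?I" by (simp add: adic_completion_def Let_def FactRing_def)
  have fc: "\<exists>u\<in>carrier S. f n = ?I n +>\<^bsub>S\<^esub> u" and fs: "f (Suc n) \<subseteq> f n" for n
    using f by (auto simp: adic_completion_def Let_def FactRing_def A_RCOSETS_def')
  have fmono: "f n \<subseteq> f m" if "m \<le> n" for m n
    using that by (induction n rule: dec_induct) (use fs in auto)
  show "f = \<zero>\<^bsub>?C\<^esub>"
  proof (rule ccontr)
    assume "f \<noteq> \<zero>\<^bsub>?C\<^esub>"
    then obtain n where n: "f n \<noteq> ?I n" unfolding zero fun_eq_iff by blast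
    obtain N where N: "\<And>u. u \<in> carrier S \<Longrightarrow> u \<notin> ?I n \<Longrightarrow> u [^]\<^bsub>S\<^esub> k \<notin> ?I N" using crit[of n k] by blast
    define M where "M = max n N"
    obtain u where u: "u \<in> carrier S" "f M = ?I M +>\<^bsub>S\<^esub> u" using fc by blast
    obtain v where v: "v \<in> carrier S" "f n = ?I n +>\<^bsub>S\<^esub> v" using fc by blast
    interpret IM: ideal "?I M" S by (rule ideal_power[OF I])
    interpret In: ideal "?I n" S by (rule ideal_power[OF I])
    have "u \<in> f M" unfolding u(2) by (rule IM.a_rcos_self[OF u(1)])
    moreover have "f M \<subseteq> f n" by (rule fmono) (simp add: M_def)
    ultimately have "u \<in> f n" by blast
    then have "f n = ?I n +>\<^bsub>S\<^esub> u" using In.a_repr_independence'[of u v] v by simp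
    then have "u \<notin> ?I n" using n In.a_rcos_const by auto
    then have "u [^]\<^bsub>S\<^esub> k \<notin> ?I N" using N u(1) by blast
    moreover have "f M [^]\<^bsub>S Quot ?I M\<^esub> k = ?I M"
      using fun_cong[OF z, of M] unfolding zero by (simp add: adic_completion_pow)
    then have "?I M +>\<^bsub>S\<^esub> (u [^]\<^bsub>S\<^esub> k) = ?I M" unfolding u(2) using IM.rcoset_pow[OF u(1) S] by simp
    then have "u [^]\<^bsub>S\<^esub> k \<in> ?I M" using IM.a_rcos_self[of "u [^]\<^bsub>S\<^esub> k"] u(1) by simp
    then have "u [^]\<^bsub>S\<^esub> k \<in> ?I N" using ideal_power_antimono[OF I, of N M] unfolding M_def by auto
    ultimately show False by blast
  qed
qed

section \<open>A weighted degree valuation\<close>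

text \<open>The substitution \<open>x \<mapsto> x w\<^sup>c\<close> turns the weighted order, for the weights \<open>c\<close> of \<open>x\<close> and
  \<open>1\<close> of \<open>w\<close>, into the order at \<open>w = 0\<close>.\<close>

definition subst_x :: "nat \<Rightarrow> 'k::field poly \<Rightarrow> 'k poly poly" where
  "subst_x c = evalp ring_of_type_algebra (\<lambda>k. [:[:k:]:]) (pX * pW ^ c)"

definition subst_xw :: "nat \<Rightarrow> 'k::field poly poly \<Rightarrow> 'k poly poly" where
  "subst_xw c = evalp ring_of_type_algebra (subst_x c) pW"

lemma ring_evaluation_subst_x:
  "ring_evaluation ring_of_type_algebra (\<lambda>k::'k::field. [:[:k:]:]) (pX * pW ^ c)"
  by (intro ring_evaluation.intro cring_from_type_algebra ring_evaluation_axioms.intro)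
     (simp_all add: ring_of_type_algebra_def one_pCons)

lemma ring_evaluation_subst_xw:
  "ring_evaluation ring_of_type_algebra (subst_x c) (pW :: 'k::field poly poly)"
  unfolding subst_x_def
  by (rule ring_evaluation.ring_evaluation_evalp[OF ring_evaluation_subst_x])
     (simp add: ring_of_type_algebra_def)

lemma subst_x_pCons: "subst_x c (pCons k f) = [:[:k:]:] + pX * pW ^ c * subst_x c f"
  using ring_evaluation.evalp_pCons[OF ring_evaluation_subst_x, of c k f]
  by (simp add: subst_x_def ring_of_type_algebra_def)

lemma subst_xw_pCons: "subst_xw c (pCons f p) = subst_x c f + pW * subst_xw c p"
  using ring_evaluation.evalp_pCons[OF ring_evaluation_subst_xw, of c f p]
  by (simp add: subst_xw_def ring_of_type_algebra_def)

lemma subst_x_0 [simp]: "subst_x c 0 = 0" and subst_xw_0 [simp]: "subst_xw c 0 = 0"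
  by (simp_all add: subst_x_def subst_xw_def ring_of_type_algebra_def)

lemma subst_x_1: "subst_x c 1 = 1"
  by (simp add: one_pCons subst_x_pCons)

lemma subst_xw_add: "subst_xw c (p + q) = subst_xw c p + subst_xw c q"
  using ring_evaluation.evalp_add[OF ring_evaluation_subst_xw, of c p q]
  by (simp add: subst_xw_def ring_of_type_algebra_def)

lemma subst_xw_mult: "subst_xw c (p * q) = subst_xw c p * subst_xw c q"
  using ring_evaluation.evalp_mult[OF ring_evaluation_subst_xw, of c p q]
  by (simp add: subst_xw_def ring_of_type_algebra_def)

lemma subst_xw_1: "subst_xw c 1 = 1"
  using ring_evaluation.evalp_one[OF ring_evaluation_subst_xw, of c]
  by (simp add: subst_xw_def ring_of_type_algebra_def)

lemma subst_xw_minus: "subst_xw c (- p) = - subst_xw c p"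
  using subst_xw_add[of c p "-p"] by (simp add: eq_neg_iff_add_eq_0 add.commute)

lemma subst_xw_diff: "subst_xw c (p - q) = subst_xw c p - subst_xw c q"
  using subst_xw_add[of c p "-q"] by (simp add: subst_xw_minus)

lemma subst_xw_power: "subst_xw c (p ^ n) = subst_xw c p ^ n"
  by (induction n) (simp_all add: subst_xw_1 subst_xw_mult)

lemma subst_xw_3: "subst_xw c (3 :: 'k::field poly poly) = 3"
proof -
  have "(3 :: 'k poly poly) = 1 + 1 + 1" by simp
  then show ?thesis by (simp only: subst_xw_add subst_xw_1)
qed

lemma coeff_subst_x:
  "bcoeff (subst_x c f) n i = (if n = c * i then poly.coeff f i else 0)"
proof (induction f arbitrary: n i)
  case (pCons k f)
  have "bcoeff (pX * pW ^ c * subst_x c f) n i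
      = (if c \<le> n \<and> i > 0 then bcoeff (subst_x c f) (n - c) (i - 1) else 0)"
    unfolding pW_pow pX_def by (cases i) (auto simp: coeff_monom_mult)
  then show ?case unfolding subst_x_pCons using pCons.IH
    by (cases i) (auto simp: coeff_pCons split: nat.splits)
qed simp

text \<open>x^i w^j becomes x^i w^(c i + j). The exponent of x is kept, so no two monomials
  merge.\<close>

lemma coeff_subst_xw:
  assumes "c > 0"
  shows "bcoeff (subst_xw c p) n i
    = (if c * i \<le> n then bcoeff p (n - c * i) i else 0)"
proof (induction p arbitrary: n)
  case (pCons f p)
  show ?case
  proof (cases n)
    case 0
    then show ?thesis using assms by (simp add: subst_xw_pCons coeff_subst_x pW_def)
  next
    case (Suc m)
    have "bcoeff (subst_xw c (pCons f p)) n i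
      = (if n = c * i then poly.coeff f i else 0)
        + (if c * i \<le> m then bcoeff p (m - c * i) i else 0)"
      unfolding subst_xw_pCons using pCons.IH[of m] Suc by (simp add: coeff_subst_x pW_def)
    then show ?thesis using Suc by (auto simp: coeff_pCons Suc_diff_le split: nat.splits)
  qed
qed simp

text \<open>The link between the filtration by weights, which is compared with powers of ideals, and
  divisibility, which behaves well under products.\<close>

lemma pW_power_dvd_subst_xw:
  assumes "c > 0"
  shows "pW ^ n dvd subst_xw c p \<longleftrightarrow> (\<forall>i j. c * i + j < n \<longrightarrow> bcoeff p j i = 0)"
proof -
  have "pW ^ n dvd subst_xw c p \<longleftrightarrow> (\<forall>m<n. poly.coeff (subst_xw c p) m = 0)"
    unfolding pW_pow by (rule monom_1_dvd_iff')
  also have "\<dots> \<longleftrightarrow> (\<forall>m<n. \<forall>i. c * i \<le> m \<longrightarrow> bcoeff p (m - c * i) i = 0)"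
    by (simp add: poly_eq_iff coeff_subst_xw[OF assms])
  also have "\<dots> \<longleftrightarrow> (\<forall>i j. c * i + j < n \<longrightarrow> bcoeff p j i = 0)"
    by (metis add_diff_cancel_left' le_add1 le_add_diff_inverse)
  finally show ?thesis .
qed

lemma subst_xw_eq_0: "c > 0 \<Longrightarrow> subst_xw c p = 0 \<longleftrightarrow> p = 0"
proof
  assume c: "c > 0" and z: "subst_xw c p = 0"
  show "p = 0"
  proof (intro poly_eqI)
    fix j i
    have "pW ^ Suc (c * i + j) dvd subst_xw c p" unfolding z by simp
    then show "bcoeff p j i = bcoeff 0 j i"
      unfolding pW_power_dvd_subst_xw[OF c] by simp
  qed
qed simp

section \<open>Orders at w = 0\<close>

lemma pW_power_dvd_iff_order:
  "pW ^ n dvd F \<longleftrightarrow> F = 0 \<or> n \<le> order 0 F"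
  using order_divides[of 0 n F] by (simp add: pW_def)

lemma order_pX_pW:
  fixes F :: "'k::field poly poly"
  assumes "F \<noteq> 0"
  shows "order 0 (F ^ 3 * pX ^ i * pW ^ j) = 3 * order 0 F + j"
proof -
  have X: "pX ^ i \<noteq> (0 :: 'k poly poly)" and W: "pW ^ j \<noteq> (0 :: 'k poly poly)"
    using pX_nonzero pW_nonzero by auto
  have "order 0 ((pX :: 'k poly poly) ^ i) = 0" by (rule order_0I) (simp add: pX_pow)
  moreover have "order 0 ((pW :: 'k poly poly) ^ j) = j"
    using order_power_n_n[of "0 :: 'k poly" j] by (simp add: pW_def)
  moreover have "order 0 (F ^ 3) = 3 * order 0 F"
    using assms by (simp add: numeral_3_eq_3 order_mult)
  ultimately show ?thesis using assms X W by (simp add: order_mult)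
qed

text \<open>The order at w = 0 is additive on products. The summand 1 covers k = 0, where the power
  of F is 1.\<close>

lemma not_pW_power_dvd_power:
  assumes "\<not> pW ^ m dvd F"
  shows "\<not> pW ^ (k * m + 1) dvd F ^ k"
proof -
  have F: "F \<noteq> 0" "order 0 F < m" using assms by (auto simp: pW_power_dvd_iff_order)
  have "F ^ k \<noteq> 0 \<and> order 0 (F ^ k) = k * order 0 F" for k
    by (induction k) (use F in \<open>auto simp: order_mult\<close>)
  moreover have "k * order 0 F \<le> k * m" using F by simp
  ultimately show ?thesis unfolding pW_power_dvd_iff_order by (metis Suc_eq_plus1 not_less_eq_eq)
qed

lemma pW_dvd_iff: "pW dvd F \<longleftrightarrow> poly.coeff F 0 = 0"
proof -
  have "pW ^ 1 dvd F \<longleftrightarrow> poly.coeff F 0 = 0"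
    unfolding pW_pow by (subst monom_1_dvd_iff') auto
  then show ?thesis by simp
qed

lemma pW_power_dvd_cube: "pW ^ (3 * n) dvd F ^ 3 \<Longrightarrow> pW ^ n dvd F"
  using order_pX_pW[of F 0 0] by (cases "F = 0") (simp_all add: pW_power_dvd_iff_order)

lemma pW_power_dvd_mult_cancel: "pW ^ n dvd G * F \<Longrightarrow> \<not> pW dvd G \<Longrightarrow> pW ^ n dvd F"
proof -
  assume d: "pW ^ n dvd G * F" and G: "\<not> pW dvd G"
  have "G \<noteq> 0" "order 0 G = 0" using G pW_power_dvd_iff_order[of 1 G] by auto
  then show ?thesis using d by (cases "F = 0") (simp_all add: pW_power_dvd_iff_order order_mult)
qed

text \<open>\<open>(n - j + 2) div 3\<close> is (n - j)/3 rounded up, and 0 if n \<le> j.\<close>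

lemma pW_power_dvd_cube_iff:
  "pW ^ n dvd F ^ 3 * pX ^ i * pW ^ j \<longleftrightarrow> pW ^ ((n - j + 2) div 3) dvd F"
proof (cases "F = 0")
  case False
  then have "F ^ 3 * pX ^ i * pW ^ j \<noteq> 0" by (simp add: pX_nonzero pW_nonzero)
  moreover have "n \<le> 3 * m + j \<longleftrightarrow> (n - j + 2) div 3 \<le> m" for m by linarith
  ultimately show ?thesis using False
    by (simp add: pW_power_dvd_iff_order order_pX_pW pX_nonzero pW_nonzero)
qed simp

lemma order_pW_power_mult: "poly.coeff F 0 \<noteq> 0 \<Longrightarrow> order 0 (pW ^ n * F) = n"
proof -
  assume F: "poly.coeff F 0 \<noteq> 0"
  then have "F \<noteq> 0" "order 0 F = 0" by (auto simp: poly_0_coeff_0 intro!: order_0I)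
  then show ?thesis using order_power_n_n[of "0 :: 'a poly" n] pW_nonzero by (simp add: order_mult pW_def)
qed

text \<open>At each order at most one of the three terms is not divisible by one more power of \<open>w\<close>, and then
  neither is the sum.\<close>

lemma pW_power_dvd_norm_terms:
  fixes P Q S T :: "'k::field poly poly"
  assumes T: "T ^ 3 = P * Q * S"
    and PQ: "P \<noteq> 0 \<Longrightarrow> Q \<noteq> 0 \<Longrightarrow> order 0 P \<noteq> order 0 Q"
    and PS: "P \<noteq> 0 \<Longrightarrow> S \<noteq> 0 \<Longrightarrow> order 0 P \<noteq> order 0 S"
    and QS: "Q \<noteq> 0 \<Longrightarrow> S \<noteq> 0 \<Longrightarrow> order 0 Q \<noteq> order 0 S"
    and d: "pW ^ n dvd P + Q + S - 3 * T"
  shows "pW ^ n dvd P \<and> pW ^ n dvd Q \<and> pW ^ n dvd S"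
  using d
proof (induction n)
  case (Suc n)
  have "pW ^ n dvd P + Q + S - 3 * T" using Suc.prems by (rule power_le_dvd) simp
  then have "pW ^ n dvd P" "pW ^ n dvd Q" "pW ^ n dvd S" using Suc.IH by auto
  then obtain P' Q' S' where P: "P = pW ^ n * P'" and Q: "Q = pW ^ n * Q'" and S: "S = pW ^ n * S'"
    by (auto elim!: dvdE)
  have "T ^ 3 = pW ^ (3 * n) * (P' * Q' * S')"
  proof -
    have "pW ^ (3 * n) = ((pW :: 'k poly poly) ^ n) ^ 3" by (simp add: mult.commute flip: power_mult)
    then show ?thesis unfolding T P Q S by (simp add: power3_eq_cube mult_ac)
  qed
  then have "pW ^ n dvd T" by (rule pW_power_dvd_cube[OF dvdI])
  then obtain T' where T': "T = pW ^ n * T'" by (elim dvdE)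
  have w: "pW ^ n \<noteq> (0 :: 'k poly poly)" by (simp add: pW_nonzero)
  have "(pW ^ n) ^ 3 * T' ^ 3 = (pW ^ n) ^ 3 * (P' * Q' * S')"
    using T unfolding T' P Q S by (simp add: power3_eq_cube power_mult_distrib mult_ac)
  then have "T' ^ 3 = P' * Q' * S'" by (simp add: pW_nonzero)
  then have "poly (T' ^ 3) 0 = poly (P' * Q' * S') 0" by simp
  then have t: "poly.coeff T' 0 ^ 3 = poly.coeff P' 0 * poly.coeff Q' 0 * poly.coeff S' 0"
    by (simp flip: poly_0_coeff_0)
  have "pW ^ n * pW dvd pW ^ n * (P' + Q' + S' - 3 * T')"
    using Suc.prems unfolding T' P Q S by (simp add: algebra_simps)
  then have "pW dvd P' + Q' + S' - 3 * T'" using w by (simp only: dvd_mult_cancel_left simp_thms)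
  then have s: "poly.coeff P' 0 + poly.coeff Q' 0 + poly.coeff S' 0 - 3 * poly.coeff T' 0 = 0"
    unfolding pW_dvd_iff by (simp flip: poly_0_coeff_0)
  have ord: "pW ^ n * F \<noteq> 0 \<and> order 0 (pW ^ n * F) = n" if "poly.coeff F 0 \<noteq> 0" for F :: "'k poly poly"
    using order_pW_power_mult[OF that, of n] that by (auto simp: pW_nonzero)
  have "poly.coeff P' 0 = 0 \<or> poly.coeff Q' 0 = 0"
    using PQ ord[of P'] ord[of Q'] unfolding P Q by metis
  moreover have "poly.coeff P' 0 = 0 \<or> poly.coeff S' 0 = 0"
    using PS ord[of P'] ord[of S'] unfolding P S by metis
  moreover have "poly.coeff Q' 0 = 0 \<or> poly.coeff S' 0 = 0"
    using QS ord[of Q'] ord[of S'] unfolding Q S by metis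
  ultimately have "poly.coeff P' 0 = 0 \<and> poly.coeff Q' 0 = 0 \<and> poly.coeff S' 0 = 0"
    using t s by auto
  \<comment> \<open>At most one of the three constant terms could be nonzero. Their product is then
    0, so by \<open>t\<close> the constant term of \<open>T'\<close> vanishes, and \<open>s\<close>
    eliminates the remaining one.\<close>
  then have "pW dvd P'" "pW dvd Q'" "pW dvd S'" unfolding pW_dvd_iff by auto
  then show ?case unfolding P Q S power_Suc2 by (intro conjI mult_dvd_mono) auto
qed simp

text \<open>With weights c and 1 for x and w, the monomial y^3 = x^(2a) w^b has weight r = 2ac + b,
  and z^3 = x^a w^(2b) has weight congruent to 2r modulo 3. If 3 does not divide r, the weights 0,
  r, 2r are pairwise incongruent.\<close>

locale weighted_cubic_ring = cubic_ring +
  fixes c :: nat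
  assumes c_pos: "c > 0" and residue: "(2 * (a * c) + b) mod 3 \<noteq> 0"
begin

abbreviation H where "H \<equiv> subst_xw c"

text \<open>The weight of y^3; likewise \<open>ht_z\<close> is that of z^3. The cubes avoid the
  fractional weights of y and z.\<close>

definition ht_y where "ht_y = 2 * (a * c) + b"
definition ht_z where "ht_z = a * c + 2 * b"

lemma H_pX: "H pX = pX * pW ^ c"
proof -
  have "H pX = subst_x c [:0, 1:]" unfolding pX_def by (simp add: subst_xw_pCons)
  also have "\<dots> = pX * pW ^ c * subst_x c 1" by (simp add: subst_x_pCons one_pCons)
  finally show ?thesis by (simp add: subst_x_1)
qed

lemma H_pW: "H pW = pW"
proof -
  have "H pW = pW * subst_x c 1" by (simp add: subst_xw_pCons one_pCons pW_def)
  then show ?thesis by (simp add: subst_x_1)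
qed

lemma H_norm3:
  "H (norm3 p q s) = H p ^ 3 * pX ^ 0 * pW ^ 0 + H q ^ 3 * pX ^ (2 * a) * pW ^ ht_y + H s ^ 3 * pX ^ a * pW ^ ht_z
    - 3 * (H p * H q * H s * pX ^ a * pW ^ (a * c + b))"
  unfolding norm3_def ht_y_def ht_z_def
  by (simp add: subst_xw_diff subst_xw_add subst_xw_mult subst_xw_power H_pX H_pW subst_xw_3
      power_mult_distrib power_add mult_ac flip: power_mult)

text \<open>Since the orders of the three cubic terms differ, the order of the norm is their
  minimum; the mixed term cannot interfere because its cube is their product. Divisibility of the
  norm thereby splits into conditions on the coordinates.\<close>

lemma pW_power_dvd_norm3:
  "pW ^ n dvd H (norm3 p q s) \<longleftrightarrow> pW ^ ((n + 2) div 3) dvd H p \<and>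
     pW ^ ((n - ht_y + 2) div 3) dvd H q \<and> pW ^ ((n - ht_z + 2) div 3) dvd H s" (is "?l \<longleftrightarrow> ?r")
proof -
  let ?P = "H p ^ 3 * pX ^ 0 * pW ^ 0" and ?Q = "H q ^ 3 * pX ^ (2 * a) * pW ^ ht_y"
    and ?S = "H s ^ 3 * pX ^ a * pW ^ ht_z" and ?T = "H p * H q * H s * pX ^ a * pW ^ (a * c + b)"
  have T: "?T ^ 3 = ?P * ?Q * ?S" unfolding ht_y_def ht_z_def
    by (simp add: power_mult_distrib mult_ac flip: power_mult power_add)
  have r: "?r \<longleftrightarrow> pW ^ n dvd ?P \<and> pW ^ n dvd ?Q \<and> pW ^ n dvd ?S"
    unfolding pW_power_dvd_cube_iff by simp
  show ?thesis unfolding r H_norm3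
  proof
    assume "pW ^ n dvd ?P + ?Q + ?S - 3 * ?T"
    then show "pW ^ n dvd ?P \<and> pW ^ n dvd ?Q \<and> pW ^ n dvd ?S"
    proof (rule pW_power_dvd_norm_terms[OF T, rotated 3])
      have ne: "3 * l + 0 \<noteq> 3 * m + ht_y" "3 * l + 0 \<noteq> 3 * m + ht_z" "3 * l + ht_y \<noteq> 3 * m + ht_z" for l m
        using residue unfolding ht_y_def ht_z_def by presburger+
      show "order 0 ?P \<noteq> order 0 ?Q" if "?P \<noteq> 0" "?Q \<noteq> 0"
      proof -
        have nz: "H p \<noteq> 0" "H q \<noteq> 0" using that by auto
        show ?thesis unfolding order_pX_pW[OF nz(1)] order_pX_pW[OF nz(2)] by (rule ne(1))
      qed
      show "order 0 ?P \<noteq> order 0 ?S" if "?P \<noteq> 0" "?S \<noteq> 0"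
      proof -
        have nz: "H p \<noteq> 0" "H s \<noteq> 0" using that by auto
        show ?thesis unfolding order_pX_pW[OF nz(1)] order_pX_pW[OF nz(2)] by (rule ne(2))
      qed
      show "order 0 ?Q \<noteq> order 0 ?S" if "?Q \<noteq> 0" "?S \<noteq> 0"
      proof -
        have nz: "H q \<noteq> 0" "H s \<noteq> 0" using that by auto
        show ?thesis unfolding order_pX_pW[OF nz(1)] order_pX_pW[OF nz(2)] by (rule ne(3))
      qed
    qed
  next
    assume *: "pW ^ n dvd ?P \<and> pW ^ n dvd ?Q \<and> pW ^ n dvd ?S"
    then have "pW ^ n * pW ^ n * pW ^ n dvd ?P * ?Q * ?S" by (intro mult_dvd_mono) auto
    then have "pW ^ (3 * n) dvd ?T ^ 3" unfolding T by (simp add: numeral_3_eq_3 add.assoc flip: power_add)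
    then have "pW ^ n dvd ?T" by (rule pW_power_dvd_cube)
    then show "pW ^ n dvd ?P + ?Q + ?S - 3 * ?T" using * by (intro dvd_diff dvd_add dvd_mult[of "pW ^ n" ?T 3]) auto
  qed
qed

text \<open>The value of u is the order of \<open>HN u\<close> at w = 0. Keeping the polynomial
  instead of its order avoids a special case for 0.\<close>

definition HN where "HN u = H (norm3 (co 0 u) (co 1 u) (co 2 u))"

lemma HN_emb: "HN (emb p q s) = H (norm3 p q s)"
  by (simp add: HN_def)

lemma HN_mult: "u \<in> carrier R \<Longrightarrow> v \<in> carrier R \<Longrightarrow> HN (u \<otimes> v) = HN u * HN v"
  by (elim emb_cases) (simp add: emb_mult HN_emb norm3_mult subst_xw_mult)

lemma HN_one: "HN \<one> = 1"
  unfolding emb_one[symmetric] HN_emb by (simp add: norm3_def subst_xw_1)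

lemma HN_pow: "u \<in> carrier R \<Longrightarrow> HN (u [^] (k::nat)) = HN u ^ k"
  by (induction k) (simp_all add: HN_one HN_mult)

text \<open>The ultrametric inequality: by \<open>pW_power_dvd_norm3\<close> the condition is a
  divisibility in each coordinate, and these are additive.\<close>

lemma HN_add:
  assumes "u \<in> carrier R" "v \<in> carrier R" "pW ^ n dvd HN u" "pW ^ n dvd HN v"
  shows "pW ^ n dvd HN (u \<oplus> v)"
proof -
  obtain p q s where u: "u = emb p q s" using assms(1) by (rule emb_cases)
  obtain p' q' s' where v: "v = emb p' q' s'" using assms(2) by (rule emb_cases)
  show ?thesis using assms(3,4) unfolding u v emb_add HN_emb pW_power_dvd_norm3 subst_xw_add by auto
qed

lemma HN_eq_zero: "u \<in> carrier R \<Longrightarrow> HN u = 0 \<Longrightarrow> u = \<zero>"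
proof -
  assume "u \<in> carrier R" and z: "HN u = 0"
  then obtain p q s where u: "u = emb p q s" by (elim emb_cases)
  have d: "pW ^ ((n + 2) div 3) dvd H p \<and> pW ^ ((n - ht_y + 2) div 3) dvd H q \<and>
      pW ^ ((n - ht_z + 2) div 3) dvd H s" for n
    using z unfolding u HN_emb pW_power_dvd_norm3[symmetric] by simp
  have zero: "F = 0" if "\<And>n. pW ^ n dvd H F" for F
  proof -
    have "H F = 0" using that[of "Suc (order 0 (H F))"] 
      by (auto simp: pW_power_dvd_iff_order simp del: power_Suc)
    then show ?thesis using subst_xw_eq_0[OF c_pos] by blast
  qed
  have div3: "(3 * n + 2) div 3 = n" for n :: nat by linarith
  have "pW ^ n dvd H p" for n using d[of "3 * n"] by (simp only: div3)
  moreover have "pW ^ n dvd H q" for n using d[of "3 * n + ht_y"] by (simp only: add_diff_cancel_right' div3)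
  moreover have "pW ^ n dvd H s" for n using d[of "3 * n + ht_z"] by (simp only: add_diff_cancel_right' div3)
  ultimately have "p = 0" "q = 0" "s = 0" using zero by blast+
  then show ?thesis by (simp add: u emb_zero)
qed

lemma domain_R: "domain R"
proof (rule domainI[OF is_cring])
  show "\<one> \<noteq> \<zero>" by (simp add: emb_one[symmetric] emb_zero[symmetric])
  fix u v assume "u \<otimes> v = \<zero>" and c: "u \<in> carrier R" "v \<in> carrier R"
  then have "HN u * HN v = HN \<zero>" using HN_mult by metis
  also have "HN \<zero> = 0" unfolding emb_zero[symmetric] HN_emb by (simp add: norm3_def)
  finally show "u = \<zero> \<or> v = \<zero>" using HN_eq_zero c by auto
qed

lemma domain_mL: "domain m.L"
  using m.domain_L[OF domain_R] m.P.zero_closed by blast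

text \<open>y^3 and z^3 have positive weight, so at exponent 1 only the first coordinate is subject
  to a condition.\<close>

lemma HN_m:
  assumes "u \<in> carrier R"
  shows "pW dvd HN u \<longleftrightarrow> u \<in> \<mm>"
proof -
  obtain p q s where u: "u = emb p q s" using assms by (rule emb_cases)
  have "ht_y \<ge> 1" "ht_z \<ge> 1" using b_pos by (auto simp: ht_y_def ht_z_def)
  then have "pW ^ 1 dvd HN u \<longleftrightarrow> pW ^ 1 dvd H p" unfolding u HN_emb pW_power_dvd_norm3 by simp
  also have "\<dots> \<longleftrightarrow> const_coeff p = 0"
    unfolding pW_power_dvd_subst_xw[OF c_pos] using c_pos by (auto simp: const_coeff_def)
  finally show ?thesis unfolding u emb_mem_m by simp
qed

section \<open>Comparison of the valuation with powers of the maximal ideal\<close>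

abbreviation Ipow where "Ipow n \<equiv> m.ext \<mm> [^]\<^bsub>ideals_set m.L\<^esub> (n::nat)"

lemma ideal_ext_m: "ideal (m.ext \<mm>) m.L"
  by (rule m.ideal_ext[OF m.P.is_ideal])

text \<open>Every factor in the maximal ideal has value at least 1, and sums are brought to a common
  denominator. One suitable representative is enough for this induction.\<close>

lemma Ipow_representative:
  "u \<in> Ipow n \<Longrightarrow> \<exists>r s. r \<in> carrier R \<and> s \<in> carrier R - \<mm> \<and> u = m.fr r s \<and> pW ^ n dvd HN r"
proof (induction n arbitrary: u)
  case 0
  then have "u \<in> carrier m.L" unfolding ideal_power_0 by simp
  then obtain r s where "r \<in> carrier R" "s \<in> carrier R - \<mm>" "u = m.fr r s" by (rule m.fraction_cases)
  then show ?case by (intro exI[of _ r] exI[of _ s]) simp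
next
  case (Suc n)
  from Suc.prems have "u \<in> Ipow n \<cdot>\<^bsub>m.L\<^esub> m.ext \<mm>" unfolding ideal_power_Suc .
  then show ?case
  proof (induction rule: ideal_prod.induct)
    case (prod i j)
    obtain r s where r: "r \<in> carrier R" "s \<in> carrier R - \<mm>" "i = m.fr r s" "pW ^ n dvd HN r"
      using Suc.IH[OF prod(1)] by blast
    obtain r' s' where r': "r' \<in> \<mm>" "s' \<in> carrier R - \<mm>" "j = m.fr r' s'" using prod(2) unfolding m.ext_def by blast
    have c: "r' \<in> carrier R" using r'(1) m.P.Icarr by blast
    have "i \<otimes>\<^bsub>m.L\<^esub> j = m.fr (r \<otimes> r') (s \<otimes> s')" unfolding r(3) r'(3) using r r' c by (intro m.fraction_mult)
    moreover have "pW ^ Suc n dvd HN (r \<otimes> r')"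
      unfolding HN_mult[OF r(1) c] power_Suc2 using r(4) r'(1) HN_m[OF c] by (intro mult_dvd_mono) auto
    moreover have "r \<otimes> r' \<in> carrier R" "s \<otimes> s' \<in> carrier R - \<mm>" using r r' c m.T_mult by auto
    ultimately show ?case by blast
  next
    case (sum u v)
    obtain r s where r: "r \<in> carrier R" "s \<in> carrier R - \<mm>" "u = m.fr r s" "pW ^ Suc n dvd HN r"
      using sum.IH(1) by blast
    obtain r' s' where r': "r' \<in> carrier R" "s' \<in> carrier R - \<mm>" "v = m.fr r' s'" "pW ^ Suc n dvd HN r'"
      using sum.IH(2) by blast
    have c: "s \<in> carrier R" "s' \<in> carrier R" using r r' by auto
    have "u \<oplus>\<^bsub>m.L\<^esub> v = m.fr (r \<otimes> s' \<oplus> r' \<otimes> s) (s \<otimes> s')" unfolding r(3) r'(3) using r r' by (intro m.fraction_add)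
    moreover have "pW ^ Suc n dvd HN (r \<otimes> s' \<oplus> r' \<otimes> s)"
      using r r' c by (intro HN_add) (simp_all add: HN_mult dvd_mult2 del: power_Suc)
    moreover have "r \<otimes> s' \<oplus> r' \<otimes> s \<in> carrier R" "s \<otimes> s' \<in> carrier R - \<mm>" using r r' c m.T_mult by auto
    ultimately show ?case by blast
  qed
qed

text \<open>Elements outside \<open>\<mm>\<close> have value 0, so the estimate passes from one
  representative to all others.\<close>

lemma Ipow_imp_dvd:
  assumes u: "m.fr r s \<in> Ipow n" and r: "r \<in> carrier R" "s \<in> carrier R - \<mm>"
  shows "pW ^ n dvd HN r"
proof -
  obtain r' s' where r': "r' \<in> carrier R" "s' \<in> carrier R - \<mm>" "m.fr r s = m.fr r' s'" "pW ^ n dvd HN r'"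
    using Ipow_representative[OF u] by blast
  then obtain t where t: "t \<in> carrier R - \<mm>" "t \<otimes> (r \<otimes> s') = t \<otimes> (r' \<otimes> s)"
    using m.fraction_eq[OF r(1) r'(1) r(2) r'(2)] by blast
  have c: "t \<in> carrier R" "s \<in> carrier R" "s' \<in> carrier R" using t r r' by auto
  have "HN t * (HN s' * HN r) = HN (t \<otimes> (r \<otimes> s'))" using c r(1) by (simp add: HN_mult)
  also have "\<dots> = HN t * (HN r' * HN s)" unfolding t(2) using c r'(1) by (simp add: HN_mult)
  finally have eq: "HN t * (HN s' * HN r) = HN t * (HN r' * HN s)" .
  have "pW ^ n dvd HN t * (HN s' * HN r)" unfolding eq using r'(4) by (intro dvd_mult dvd_mult2)
  then show ?thesis using HN_m t(1) r'(2) c by (metis DiffD2 pW_power_dvd_mult_cancel)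
qed

text \<open>Induction on n: x is split off from the part that is free of w, and w from the rest;
  both quotients have no monomials of degree below n.\<close>

lemma loc_iota_mem_Ipow:
  "(\<And>i j. i + j < n \<Longrightarrow> bcoeff p j i = 0) \<Longrightarrow> m.loc (\<iota> p) \<in> Ipow n"
proof (induction n arbitrary: p)
  case 0
  show ?case unfolding ideal_power_0 by simp
next
  case (Suc n)
  obtain f p' where p: "p = pCons f p'" by (cases p)
  obtain k f' where f: "f = pCons k f'" by (cases f)
  have "k = 0" using Suc.prems[of 0 0] by (simp add: p f)
  then have e: "p = [:f':] * pX + p' * pW" by (simp add: p f pX_def pW_def)
  have 1: "m.loc (\<iota> [:f':]) \<in> Ipow n"
  proof (rule Suc.IH)
    fix i j assume "i + j < n"
    then show "bcoeff [:f':] j i = 0"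
      using Suc.prems[of "Suc i" j] by (cases j) (auto simp: p f)
  qed
  have 2: "m.loc (\<iota> p') \<in> Ipow n"
  proof (rule Suc.IH)
    fix i j assume "i + j < n"
    then show "bcoeff p' j i = 0" using Suc.prems[of i "Suc j"] by (simp add: p)
  qed
  have 3: "m.loc (\<iota> pX) \<in> m.ext \<mm>" "m.loc (\<iota> pW) \<in> m.ext \<mm>"
    using m.fraction_mem_ext_P[of _ \<one>] m.T_one by (simp_all add: m.loc_def \<iota>_def emb_mem_m)
  have "m.loc (\<iota> p) = m.loc (\<iota> [:f':]) \<otimes>\<^bsub>m.L\<^esub> m.loc (\<iota> pX) \<oplus>\<^bsub>m.L\<^esub> m.loc (\<iota> p') \<otimes>\<^bsub>m.L\<^esub> m.loc (\<iota> pW)"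
    unfolding e by (simp only: iota_add iota_mult m.loc.hom_add m.loc.hom_mult iota_closed m_closed)
  then show ?case unfolding ideal_power_Suc using 1 2 3 by (metis ideal_prod.prod ideal_prod.sum)
qed

text \<open>The constant is chosen so that each coordinate has weighted order at least c n, after
  the weight of y^3 or z^3 is subtracted and the result divided by 3. As c i + j \<le> c (i + j),
  only monomials of degree at least n remain.\<close>

lemma dvd_imp_Ipow:
  assumes r: "r \<in> carrier R" "s \<in> carrier R - \<mm>" and d: "pW ^ (3 * (c * n) + ht_y + ht_z) dvd HN r"
  shows "m.fr r s \<in> Ipow n"
proof -
  interpret I: ideal "Ipow n" m.L by (rule m.L.ideal_power[OF ideal_ext_m])
  obtain p q t where e: "r = emb p q t" using r(1) by (rule emb_cases)
  have mem: "m.loc (\<iota> F) \<in> Ipow n" if "pW ^ k dvd H F" "c * n \<le> k" for F k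
  proof (rule loc_iota_mem_Ipow)
    fix i j assume "i + j < n"
    then have "c * i + j < c * n"
      using c_pos by (metis add_le_mono1 add.commute add_mult_distrib2 le_less_trans mult_le_mono1 mult_less_mono2 nat_mult_1 Suc_leI One_nat_def add_left_mono)
    then show "bcoeff F j i = 0"
      using that unfolding pW_power_dvd_subst_xw[OF c_pos] by simp
  qed
  have "m.loc (\<iota> p) \<in> Ipow n" "m.loc (\<iota> q) \<in> Ipow n" "m.loc (\<iota> t) \<in> Ipow n"
    using d unfolding e HN_emb pW_power_dvd_norm3 by (auto intro!: mem)
  moreover have "m.loc r = m.loc (\<iota> p) \<oplus>\<^bsub>m.L\<^esub> (m.loc (\<iota> q) \<otimes>\<^bsub>m.L\<^esub> m.loc (emb 0 1 0)
      \<oplus>\<^bsub>m.L\<^esub> m.loc (\<iota> t) \<otimes>\<^bsub>m.L\<^esub> m.loc (emb 0 0 1))"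
    unfolding e by (subst emb_decomp) simp
  ultimately have "m.loc r \<in> Ipow n" by (auto intro!: I.a_closed I.I_r_closed)
  then show ?thesis unfolding m.fraction_eq_loc(1)[OF r] using r m.T_one by (intro I.I_r_closed) auto
qed

lemma analytically_unramified_mL: "analytically_unramified m.L"
  unfolding analytically_unramified_def m.max_ideal_L
proof
  show "local_ring m.L" by (rule m.local_ring_L[OF noetherian])
  show "reduced_ring (adic_completion m.L (m.ext \<mm>))"
  proof (rule reduced_adic_completion[OF m.cring_L ideal_ext_m])
    fix n k :: nat
    \<comment> \<open>Outside the n-th power the value is below \<open>?T\<close>, so that of the
      k-th power is below \<open>k * ?T + 1\<close>: this is the exponent that the criterion asks
      for.\<close>
    let ?T = "3 * (c * n) + ht_y + ht_z"
    have "u [^]\<^bsub>m.L\<^esub> k \<notin> Ipow (k * ?T + 1)" if u: "u \<in> carrier m.L" "u \<notin> Ipow n" for u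
    proof
      obtain r s where r: "r \<in> carrier R" "s \<in> carrier R - \<mm>" "u = m.fr r s" using u(1) by (rule m.fraction_cases)
      assume "u [^]\<^bsub>m.L\<^esub> k \<in> Ipow (k * ?T + 1)"
      then have "m.fr (r [^] k) (s [^] k) \<in> Ipow (k * ?T + 1)" unfolding r(3) m.fraction_pow(2)[OF r(1,2)] .
      then have "pW ^ (k * ?T + 1) dvd HN (r [^] k)"
        by (rule Ipow_imp_dvd) (use r m.fraction_pow(1)[OF r(1,2)] in auto)
      then have "pW ^ (k * ?T + 1) dvd HN r ^ k" unfolding HN_pow[OF r(1)] .
      then have "pW ^ ?T dvd HN r" using not_pW_power_dvd_power by blast
      then show False using dvd_imp_Ipow[OF r(1,2)] u(2) unfolding r(3) by blast
    qed
    then show "\<exists>N. \<forall>u\<in>carrier m.L. u \<notin> Ipow n \<longrightarrow> u [^]\<^bsub>m.L\<^esub> k \<notin> Ipow N" by blast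
  qed
qed

end


section \<open>The monomials of the quotient ring\<close>

alias lookup = Poly_Mapping.lookup
alias single = Poly_Mapping.single
alias keys = Poly_Mapping.keys

lemma poly_mapping_sum_single: "p = (\<Sum>m\<in>keys p. single m (lookup p m))"
proof (rule poly_mapping_eqI)
  fix k
  have "lookup (\<Sum>m\<in>keys p. single m (lookup p m)) k
     = (\<Sum>m\<in>keys p. if m = k then lookup p k else 0)"
    unfolding lookup_sum by (intro sum.cong) (auto simp: lookup_single when_def)
  also have "\<dots> = lookup p k" by (simp add: in_keys_iff)
  finally show "lookup p k = lookup
      (\<Sum>m\<in>keys p. single m (lookup p m)) k" ..
qed

lemma lookup_single_mult:
  fixes g :: "'m::cancel_comm_monoid_add \<Rightarrow>\<^sub>0 'r::comm_semiring_1"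
  shows "lookup (single k 1 * g) l =
    (\<Sum>m\<in>keys g. if k + m = l then lookup g m else 0)"
proof -
  have "single k 1 * g =
      (\<Sum>m\<in>keys g. single (k + m) (lookup g m))"
    by (subst poly_mapping_sum_single[of g]) (simp add: sum_distrib_left mult_single)
  then show ?thesis by (simp add: lookup_sum lookup_single when_def)
qed

lemma lookup_single_mult_shift:
  fixes g :: "'m::cancel_comm_monoid_add \<Rightarrow>\<^sub>0 'r::comm_semiring_1"
  shows "lookup (single k 1 * g) (k + l) = lookup g l"
  unfolding lookup_single_mult by (simp add: in_keys_iff)

lemma lookup_single_mult_zero:
  fixes g :: "'m::cancel_comm_monoid_add \<Rightarrow>\<^sub>0 'r::comm_semiring_1"
  assumes "\<And>m. l = k + m \<Longrightarrow> lookup g m = 0"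
  shows "lookup (single k 1 * g) l = 0"
  unfolding lookup_single_mult by (intro sum.neutral) (use assms in auto)

text \<open>The map of monoid algebras induced by \<theta>: coefficients with the same image add up.
  It is multiplicative if \<theta> is additive.\<close>

definition push_keys :: "('m \<Rightarrow> 'n) \<Rightarrow> ('m \<Rightarrow>\<^sub>0 'r::comm_monoid_add) \<Rightarrow> 'n \<Rightarrow>\<^sub>0 'r" where
  "push_keys \<theta> p = (\<Sum>m\<in>keys p. single (\<theta> m) (lookup p m))"

lemma push_keys_superset:
  assumes "finite A" "keys p \<subseteq> A"
  shows "push_keys \<theta> p = (\<Sum>m\<in>A. single (\<theta> m) (lookup p m))"
  unfolding push_keys_def by (rule sum.mono_neutral_left) (use assms in \<open>auto simp: in_keys_iff\<close>)

lemma push_keys_add: "push_keys \<theta> (p + q) = push_keys \<theta> p + push_keys \<theta> q"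
proof -
  let ?A = "keys p \<union> keys q"
  have "push_keys \<theta> (p + q) = (\<Sum>m\<in>?A. single (\<theta> m) (lookup (p + q) m))"
    by (rule push_keys_superset) (use keys_add[of p q] in auto)
  also have "\<dots> = push_keys \<theta> p + push_keys \<theta> q"
    by (subst (1 2) push_keys_superset[of ?A]) (auto simp: lookup_add single_add sum.distrib)
  finally show ?thesis .
qed

lemma push_keys_0 [simp]: "push_keys \<theta> 0 = 0"
  by (simp add: push_keys_def)

lemma push_keys_single: "push_keys \<theta> (single m c) = single (\<theta> m) c"
  by (subst push_keys_superset[of "{m}"]) (auto simp: keys_single split: if_splits)

lemma push_keys_sum: "push_keys \<theta> (sum f A) = (\<Sum>i\<in>A. push_keys \<theta> (f i))"
  using sum_comp_morphism[of "push_keys \<theta>" f A] by (simp add: push_keys_add comp_def)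

lemma push_keys_mult:
  fixes \<theta> :: "'m::comm_monoid_add \<Rightarrow> 'n::comm_monoid_add" and p q :: "'m \<Rightarrow>\<^sub>0 'r::comm_semiring_1"
  assumes \<theta>: "\<And>m n. \<theta> (m + n) = \<theta> m + \<theta> n"
  shows "push_keys \<theta> (p * q) = push_keys \<theta> p * push_keys \<theta> q"
proof -
  have "p * q = (\<Sum>m\<in>keys p. single m (lookup p m))
     * (\<Sum>n\<in>keys q. single n (lookup q n))"
    by (simp flip: poly_mapping_sum_single)
  also have "\<dots> = (\<Sum>m\<in>keys p. \<Sum>n\<in>keys q.
      single (m + n) (lookup p m * lookup q n))"
    by (simp add: sum_product mult_single)
  finally have "push_keys \<theta> (p * q) = (\<Sum>m\<in>keys p. \<Sum>n\<in>keys q.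
      single (\<theta> m + \<theta> n) (lookup p m * lookup q n))"
    by (simp add: push_keys_sum push_keys_single \<theta>)
  also have "\<dots> = push_keys \<theta> p * push_keys \<theta> q"
    unfolding push_keys_def by (simp add: sum_product mult_single)
  finally show ?thesis .
qed

lemma push_keys_diff:
  fixes p q :: "'m \<Rightarrow>\<^sub>0 'r::comm_ring_1"
  shows "push_keys \<theta> (p - q) = push_keys \<theta> p - push_keys \<theta> q"
  using push_keys_add[of \<theta> "p - q" q] by simp

text \<open>With \<open>x = s\<^sup>3\<close>, \<open>w = t\<^sup>3\<close>, \<open>y = s\<^bsup>2a\<^esup> t\<^sup>b g\<close>, \<open>z = s\<^sup>a t\<^bsup>2b\<^esup> g\<^sup>2\<close> and \<open>g\<^sup>3 = 1\<close> the three
  relations hold; the last component is the exponent of \<open>g\<close>.\<close>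

definition exponent :: "nat \<Rightarrow> nat \<Rightarrow> (variable \<Rightarrow>\<^sub>0 nat) \<Rightarrow> nat \<times> nat \<times> 3" where
  "exponent a b m =
    (3 * lookup m Var_x + 2 * a * lookup m Var_y + a * lookup m Var_z,
     3 * lookup m Var_w + b * lookup m Var_y + 2 * b * lookup m Var_z,
     of_nat (lookup m Var_y) + 2 * of_nat (lookup m Var_z))"

lemma exponent_add: "exponent a b (m + n) = exponent a b m + exponent a b n"
  by (simp add: exponent_def lookup_add algebra_simps)

abbreviation param :: "nat \<Rightarrow> nat \<Rightarrow> 'k::field poly4 \<Rightarrow> (nat \<times> nat \<times> 3) \<Rightarrow>\<^sub>0 'k" where
  "param a b \<equiv> push_keys (exponent a b)"

lemmas param_mult = push_keys_mult[of "exponent a b" for a b, OF exponent_add]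

lemma param_const: "param a b (single 0 c) = single 0 c"
  by (simp add: push_keys_single exponent_def flip: zero_prod_def)

lemma param_1: "param a b 1 = 1"
  using param_const[of a b 1] by simp

lemma param_power: "param a b (p ^ n) = param a b p ^ n"
  by (induction n) (simp_all add: param_1 param_mult)

lemma param_polyvar:
  "param a b (polyvar Var_x) = single (3, 0, 0) 1"
  "param a b (polyvar Var_y) = single (2 * a, b, 1) 1"
  "param a b (polyvar Var_z) = single (a, 2 * b, 2) 1"
  "param a b (polyvar Var_w) = single (0, 3, 0) 1"
  by (simp_all add: polyvar_def push_keys_single exponent_def lookup_single)

lemma single_power: "single (n1, n2, n3) 1 ^ k
    = (single (k * n1, k * n2, of_nat k * n3) 1 :: (nat \<times> nat \<times> 3) \<Rightarrow>\<^sub>0 'k::field)"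
  by (induction k) (simp_all add: mult_single algebra_simps flip: zero_prod_def)

section \<open>The relations and the monomial parametrization\<close>

abbreviation P4 :: "'k::field poly4 ring" where "P4 \<equiv> ring_of_type_algebra"

lemma cring_P4: "cring (P4 :: 'k::field poly4 ring)"
  by (rule cring_from_type_algebra)

lemma P4_simps [simp]:
  "carrier P4 = UNIV" "p \<otimes>\<^bsub>P4\<^esub> q = p * q" "p \<oplus>\<^bsub>P4\<^esub> q = p + q" "\<zero>\<^bsub>P4\<^esub> = 0" "\<one>\<^bsub>P4\<^esub> = 1"
  by (simp_all add: ring_of_type_algebra_def)

lemma P4_minus: "\<ominus>\<^bsub>P4\<^esub> p = - (p :: 'k::field poly4)"
proof -
  interpret cring "P4 :: 'k poly4 ring" by (rule cring_P4)
  have "p \<oplus>\<^bsub>P4\<^esub> (- p) = \<zero>\<^bsub>P4\<^esub>" by simp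
  then show ?thesis using minus_unique[of "p" "-p"] by (simp add: minus_equality a_comm)
qed

abbreviation cls :: "nat \<Rightarrow> nat \<Rightarrow> 'k::field poly4 \<Rightarrow> 'k poly4 set" where
  "cls a b p \<equiv> relation_ideal a b +>\<^bsub>P4\<^esub> p"

lemma ideal_relation_ideal: "ideal (relation_ideal a b :: 'k::field poly4 set) P4"
proof -
  interpret cring "P4 :: 'k poly4 ring" by (rule cring_P4)
  show ?thesis unfolding relation_ideal_def Let_def by (rule genideal_ideal) simp
qed

lemma relation_ideal_gens:
  "polyvar Var_x ^ a * polyvar Var_z - polyvar Var_y ^ 2 \<in> relation_ideal a b"
  "polyvar Var_x ^ a * polyvar Var_w ^ b - polyvar Var_y * polyvar Var_z \<in> relation_ideal a b"
  "polyvar Var_w ^ b * polyvar Var_y - polyvar Var_z ^ 2 \<in> relation_ideal a b"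
  unfolding relation_ideal_def Let_def genideal_def by auto

lemma relation_ideal_param:
  assumes "p \<in> relation_ideal a b"
  shows "param a b p = 0"
proof -
  interpret cring "P4 :: 'a poly4 ring" by (rule cring_P4)
  have "ideal {p :: 'a poly4. param a b p = 0} P4"
    by (rule ideal_of_mult_closed) (simp_all add: push_keys_add param_mult)
  moreover have e3: "(3 :: 3) = 0" "(4 :: 3) = 1" by simp_all
  have "param a b (polyvar Var_x ^ a * polyvar Var_z - polyvar Var_y ^ 2 :: 'a poly4) = 0"
    "param a b (polyvar Var_x ^ a * polyvar Var_w ^ b - polyvar Var_y * polyvar Var_z :: 'a poly4) = 0"
    "param a b (polyvar Var_w ^ b * polyvar Var_y - polyvar Var_z ^ 2 :: 'a poly4) = 0"
    by (simp_all add: push_keys_diff param_mult param_power param_polyvar single_power mult_single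
        algebra_simps e3)
  ultimately have "relation_ideal a b \<subseteq> {p :: 'a poly4. param a b p = 0}"
    unfolding relation_ideal_def Let_def by (intro genideal_minimal) auto
  then show ?thesis using assms by blast
qed

section \<open>The subring K[x, w] and its image under the parametrization\<close>

definition coeffs_x :: "'k::field poly \<Rightarrow> 'k poly4" where
  "coeffs_x = evalp P4 (single 0) (polyvar Var_x)"

definition coeffs_xw :: "'k::field poly poly \<Rightarrow> 'k poly4" where
  "coeffs_xw = evalp P4 coeffs_x (polyvar Var_w)"

lemma ring_evaluation_coeffs_x:
  "ring_evaluation P4 (single 0) (polyvar Var_x :: 'k::field poly4)"
  by (intro ring_evaluation.intro cring_P4 ring_evaluation_axioms.intro)
     (simp_all add: single_add mult_single)

lemma ring_evaluation_coeffs_xw: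
  "ring_evaluation P4 coeffs_x (polyvar Var_w :: 'k::field poly4)"
  unfolding coeffs_x_def by (rule ring_evaluation.ring_evaluation_evalp[OF ring_evaluation_coeffs_x]) simp

lemma coeffs_x_pCons: "coeffs_x (pCons k f) = single 0 k + polyvar Var_x * coeffs_x f"
  using ring_evaluation.evalp_pCons[OF ring_evaluation_coeffs_x, of k f] by (simp add: coeffs_x_def)

lemma coeffs_xw_pCons: "coeffs_xw (pCons f p) = coeffs_x f + polyvar Var_w * coeffs_xw p"
  using ring_evaluation.evalp_pCons[OF ring_evaluation_coeffs_xw, of f p] by (simp add: coeffs_xw_def)

lemma coeffs_x_0 [simp]: "coeffs_x 0 = 0" and coeffs_xw_0 [simp]: "coeffs_xw 0 = 0"
  by (simp_all add: coeffs_x_def coeffs_xw_def)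

lemma coeffs_xw_add: "coeffs_xw (p + q) = coeffs_xw p + coeffs_xw q"
  using ring_evaluation.evalp_add[OF ring_evaluation_coeffs_xw, of p q] by (simp add: coeffs_xw_def)

lemma coeffs_xw_mult: "coeffs_xw (p * q) = coeffs_xw p * coeffs_xw q"
  using ring_evaluation.evalp_mult[OF ring_evaluation_coeffs_xw, of p q] by (simp add: coeffs_xw_def)

lemma coeffs_xw_1: "coeffs_xw 1 = 1"
  using ring_evaluation.evalp_one[OF ring_evaluation_coeffs_xw] by (simp add: coeffs_xw_def)

lemma coeffs_xw_power: "coeffs_xw (p ^ n) = coeffs_xw p ^ n"
  by (induction n) (simp_all add: coeffs_xw_1 coeffs_xw_mult)

lemma coeffs_xw_diff: "coeffs_xw (p - q) = coeffs_xw p - coeffs_xw q"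
  using coeffs_xw_add[of "p - q" q] by simp

lemma coeffs_x_1: "coeffs_x 1 = 1"
  by (simp add: one_pCons coeffs_x_pCons)

lemma coeffs_xw_const: "coeffs_xw [:[:k:]:] = single 0 k"
  by (simp add: coeffs_xw_pCons coeffs_x_pCons)

lemma coeffs_xw_pX: "coeffs_xw pX = polyvar Var_x"
  by (simp add: pX_def coeffs_xw_pCons coeffs_x_pCons)

lemma coeffs_xw_pW: "coeffs_xw pW = polyvar Var_w"
  by (simp add: pW_def coeffs_xw_pCons one_pCons coeffs_x_1[unfolded one_pCons])

lemma lookup_param_coeffs_x:
  "lookup (param a b (coeffs_x f)) (n, m, e)
    = (if e = 0 \<and> m = 0 \<and> 3 dvd n then poly.coeff f (n div 3) else 0)"
proof (induction f arbitrary: n)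
  case (pCons k f)
  have e: "param a b (coeffs_x (pCons k f))
      = single 0 k + single (3, 0, 0) 1 * param a b (coeffs_x f)"
    by (simp add: coeffs_x_pCons push_keys_add param_mult param_const param_polyvar)
  show ?case
  proof (cases "n \<ge> 3")
    case True
    then obtain n' where n: "n = 3 + n'" using le_Suc_ex by blast
    then have "(n, m, e) = (3, 0, 0) + (n', m, e)" by simp
    then show ?thesis unfolding e lookup_add
      using lookup_single_mult_shift[of "(3, 0, 0)" "param a b (coeffs_x f)" "(n', m, e)"] pCons.IH[of n'] n
      by (simp add: lookup_single when_def zero_prod_def)
  next
    case False
    then have "lookup (single (3, 0, 0) 1 * param a b (coeffs_x f)) (n, m, e) = 0"
      by (intro lookup_single_mult_zero) auto
    moreover have "3 dvd n \<longleftrightarrow> n = 0" using False by auto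
    ultimately show ?thesis unfolding e lookup_add
      by (auto simp: lookup_single when_def zero_prod_def)
  qed
qed simp

text \<open>x and w become s^3 and t^3, so the monomials of A occupy the exponents divisible by 3 in
  degree 0 of g, each exactly once.\<close>

lemma lookup_param_coeffs_xw:
  "lookup (param a b (coeffs_xw p)) (n, m, e)
    = (if e = 0 \<and> 3 dvd m \<and> 3 dvd n then bcoeff p (m div 3) (n div 3) else 0)"
proof (induction p arbitrary: m)
  case (pCons f p)
  have e: "param a b (coeffs_xw (pCons f p))
      = param a b (coeffs_x f) + single (0, 3, 0) 1 * param a b (coeffs_xw p)"
    by (simp add: coeffs_xw_pCons push_keys_add param_mult param_polyvar)
  show ?case
  proof (cases "m \<ge> 3")
    case True
    then obtain m' where m: "m = 3 + m'" using le_Suc_ex by blast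
    then have "(n, m, e) = (0, 3, 0) + (n, m', e)" by simp
    then show ?thesis unfolding e lookup_add
      using lookup_single_mult_shift[of "(0, 3, 0)" "param a b (coeffs_xw p)" "(n, m', e)"] pCons.IH[of m'] m
      by (simp add: lookup_param_coeffs_x)
  next
    case False
    then have "lookup (single (0, 3, 0) 1 * param a b (coeffs_xw p)) (n, m, e) = 0"
      by (intro lookup_single_mult_zero) auto
    moreover have "3 dvd m \<longleftrightarrow> m = 0" using False by auto
    ultimately show ?thesis unfolding e lookup_add
      by (auto simp: lookup_param_coeffs_x)
  qed
qed simp

text \<open>The image of A has degree 0 in g, so a monomial times it is concentrated in the g-degree
  of that monomial.\<close>

lemma lookup_single_mult_param:
  assumes "e \<noteq> k3"
  shows "lookup (single (k1, k2, k3) 1 * param a b (coeffs_xw p)) (n, m, e) = 0"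
proof (rule lookup_single_mult_zero)
  fix l assume l: "(n, m, e) = (k1, k2, k3) + l"
  obtain l1 l2 l3 where "l = (l1, l2, l3)" by (cases l)
  then show "lookup (param a b (coeffs_xw p)) l = 0"
    using l assms by (simp add: lookup_param_coeffs_xw)
qed

section \<open>Normal forms modulo the relations\<close>

definition normal_form :: "'k::field poly poly \<Rightarrow> 'k poly poly \<Rightarrow> 'k poly poly \<Rightarrow> 'k poly4" where
  "normal_form p q s = coeffs_xw p + coeffs_xw q * polyvar Var_y + coeffs_xw s * polyvar Var_z"

text \<open>The exponent of g is a grading by Z/3 in which 1, y, z have degrees 0, 1, 2. Hence the
  three summands cannot cancel, and the coefficients of each are read off at shifted
  exponents.\<close>

lemma normal_form_in_relation_ideal:
  assumes "normal_form p q s \<in> relation_ideal a b"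
  shows "p = 0 \<and> q = 0 \<and> s = 0"
proof -
  have z: "param a b (coeffs_xw p) + single (2 * a, b, 1) 1 * param a b (coeffs_xw q)
      + single (a, 2 * b, 2) 1 * param a b (coeffs_xw s) = 0" (is "?p + ?q + ?s = 0")
    using relation_ideal_param[OF assms]
    by (simp add: normal_form_def push_keys_add param_mult param_polyvar mult.commute)
  have ne: "(0::3) \<noteq> 1" "(0::3) \<noteq> 2" "(1::3) \<noteq> 0" "(1::3) \<noteq> 2" "(2::3) \<noteq> 0" "(2::3) \<noteq> 1" by simp_all
  have l: "lookup ?p l + lookup ?q l + lookup ?s l = 0" for l
    unfolding lookup_add[symmetric] z by simp
  have "bcoeff p j i = 0" for i j
    using l[of "(3 * i, 3 * j, 0)"]
    by (simp add: lookup_single_mult_param ne lookup_param_coeffs_xw)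
  moreover have "bcoeff q j i = 0" for i j
  proof -
    have "lookup ?q (2 * a + 3 * i, b + 3 * j, 1) = bcoeff q j i"
      using lookup_single_mult_shift[of "(2 * a, b, 1)" "param a b (coeffs_xw q)" "(3 * i, 3 * j, 0)"]
      by (simp add: lookup_param_coeffs_xw)
    then show ?thesis using l[of "(2 * a + 3 * i, b + 3 * j, 1)"]
      by (simp add: lookup_single_mult_param ne lookup_param_coeffs_xw)
  qed
  moreover have "bcoeff s j i = 0" for i j
  proof -
    have "lookup ?s (a + 3 * i, 2 * b + 3 * j, 2) = bcoeff s j i"
      using lookup_single_mult_shift[of "(a, 2 * b, 2)" "param a b (coeffs_xw s)" "(3 * i, 3 * j, 0)"]
      by (simp add: lookup_param_coeffs_xw)
    then show ?thesis using l[of "(a + 3 * i, 2 * b + 3 * j, 2)"]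
      by (simp add: lookup_single_mult_param ne lookup_param_coeffs_xw)
  qed
  ultimately show ?thesis by (simp add: poly_eq_iff)
qed

lemma poly4_induct:
  fixes G :: "'k::field poly4 set"
  assumes const: "\<And>c. single 0 c \<in> G" and var: "\<And>v. polyvar v \<in> G"
    and add: "\<And>p q. p \<in> G \<Longrightarrow> q \<in> G \<Longrightarrow> p + q \<in> G" and mult: "\<And>p q. p \<in> G \<Longrightarrow> q \<in> G \<Longrightarrow> p * q \<in> G"
  shows "p \<in> G"
proof -
  have one: "1 \<in> G" using const[of 1] by simp
  have pow: "single (single v n) 1 \<in> G" for v and n :: nat
  proof (induction n)
    case (Suc n)
    have "single v (Suc n) = single v n + single v 1"
      by (simp flip: single_add)
    then have "single (single v (Suc n)) (1::'k)
        = single (single v n) 1 * polyvar v"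
      by (simp add: polyvar_def mult_single)
    then show ?case using mult[OF Suc.IH var] by simp
  qed (use one in simp)
  have mono: "single m 1 \<in> G" for m :: "variable \<Rightarrow>\<^sub>0 nat"
  proof -
    have "m = single Var_x (lookup m Var_x) + single Var_y (lookup m Var_y)
      + single Var_z (lookup m Var_z) + single Var_w (lookup m Var_w)"
      (is "_ = ?x + ?y + ?z + ?w")
    proof (rule poly_mapping_eqI)
      show "lookup m v = lookup (?x + ?y + ?z + ?w) v" for v
        by (cases v) (simp_all add: lookup_add lookup_single when_def)
    qed
    then have "single m (1::'k) = single ?x 1 * single ?y 1
        * single ?z 1 * single ?w 1"
      by (metis mult_single mult_1)
    then show ?thesis using pow mult by simp
  qed
  have sing: "single m c \<in> G" for m c
    using mult[OF const[of c] mono[of m]] by (simp add: mult_single)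
  have "(\<Sum>m\<in>A. single m (lookup p m)) \<in> G" for A
    by (induction A rule: infinite_finite_induct) (use sing const[of 0] add in auto)
  then show ?thesis using poly_mapping_sum_single[of p] by metis
qed

section \<open>The quotient ring as a free module with basis 1, y, z\<close>

definition quotient_emb :: "nat \<Rightarrow> nat \<Rightarrow> 'k::field poly poly \<Rightarrow> 'k poly poly \<Rightarrow> 'k poly poly \<Rightarrow> 'k poly4 set" where
  "quotient_emb a b p q s = cls a b (normal_form p q s)"

lemma coset_eq_iff:
  "cls a b p = cls a b (q :: 'k::field poly4) \<longleftrightarrow> p - q \<in> relation_ideal a b"
proof -
  interpret cring "P4 :: 'k poly4 ring" by (rule cring_P4)
  show ?thesis using quotient_eq_iff_same_a_r_cos[OF ideal_relation_ideal, of p q a b]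
    by (simp add: a_minus_def P4_minus)
qed

lemma coset_add:
  "cls a b p \<oplus>\<^bsub>quotient_ring a b\<^esub> (cls a b (q :: 'k::field poly4))
    = cls a b (p + q)"
  and coset_mult:
  "cls a b p \<otimes>\<^bsub>quotient_ring a b\<^esub> (cls a b (q :: 'k::field poly4))
    = cls a b (p * q)"
  and coset_one: "\<one>\<^bsub>quotient_ring a b\<^esub> = cls a b (1 :: 'k poly4)"
proof -
  interpret I: ideal "relation_ideal a b :: 'k poly4 set" P4 by (rule ideal_relation_ideal)
  note h = I.rcos_ring_hom
  show "cls a b p \<oplus>\<^bsub>quotient_ring a b\<^esub> cls a b q
    = cls a b (p + q)"
    using ring_hom_add[OF h, of p q] unfolding quotient_ring_def by simp
  show "cls a b p \<otimes>\<^bsub>quotient_ring a b\<^esub> cls a b q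
    = cls a b (p * q)"
    using ring_hom_mult[OF h, of p q] unfolding quotient_ring_def by simp
  show "\<one>\<^bsub>quotient_ring a b\<^esub> = cls a b (1 :: 'k poly4)"
    using ring_hom_one[OF h] unfolding quotient_ring_def by simp
qed

lemma coset_carrier: "carrier (quotient_ring a b) = range (\<lambda>p :: 'k::field poly4. cls a b p)"
  by (auto simp: quotient_ring_def FactRing_def A_RCOSETS_def')

lemma cring_quotient_ring: "cring (quotient_ring a b :: 'k::field poly4 set ring)"
  unfolding quotient_ring_def by (rule ideal.quotient_is_cring[OF ideal_relation_ideal cring_P4])

lemma quotient_emb_add:
  "quotient_emb a b p q s \<oplus>\<^bsub>quotient_ring a b\<^esub> quotient_emb a b p' q' s'
    = quotient_emb a b (p + p') (q + q') (s + s')"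
  unfolding quotient_emb_def coset_add by (simp add: normal_form_def coeffs_xw_add algebra_simps)

lemma quotient_emb_mult:
  "quotient_emb a b p q s \<otimes>\<^bsub>quotient_ring a b\<^esub> quotient_emb a b p' q' s' =
   quotient_emb a b (p * p' + pX ^ a * pW ^ b * (q * s' + s * q'))
     (p * q' + q * p' + pW ^ b * s * s') (p * s' + s * p' + pX ^ a * q * q')"
proof -
  interpret I: ideal "relation_ideal a b :: 'a poly4 set" P4 by (rule ideal_relation_ideal)
  let ?I = "relation_ideal a b :: 'a poly4 set"
  let ?e = "coeffs_xw :: 'a poly poly \<Rightarrow> _"
  let ?x = "polyvar Var_x" and ?y = "polyvar Var_y" and ?z = "polyvar Var_z" and ?w = "polyvar Var_w"
  have add: "u + v \<in> ?I" if "u \<in> ?I" "v \<in> ?I" for u v 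
    using additive_subgroup.a_closed[OF ideal.axioms(1)[OF ideal_relation_ideal] that] by simp
  have mult: "u * v \<in> ?I" if "v \<in> ?I" for u v using I.I_l_closed[OF that, of u] by simp
  \<comment> \<open>Each of the products y^2, y z and z^2 is replaced by one relation; the
    coefficients on the right are those of these products.\<close>
  have "normal_form (p * p' + pX ^ a * pW ^ b * (q * s' + s * q'))
     (p * q' + q * p' + pW ^ b * s * s') (p * s' + s * p' + pX ^ a * q * q') - normal_form p q s * normal_form p' q' s'
    = ?e (q * q') * (?x ^ a * ?z - ?y ^ 2) + ?e (q * s' + s * q') * (?x ^ a * ?w ^ b - ?y * ?z)
      + ?e (s * s') * (?w ^ b * ?y - ?z ^ 2)"
    by (simp add: normal_form_def coeffs_xw_add coeffs_xw_mult coeffs_xw_power coeffs_xw_pX coeffs_xw_pW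
        algebra_simps power2_eq_square)
  also have "\<dots> \<in> ?I" by (intro add mult relation_ideal_gens)
  finally show ?thesis unfolding quotient_emb_def coset_mult by (simp add: coset_eq_iff[symmetric])
qed

lemma quotient_emb_eq:
  "quotient_emb a b p q s = quotient_emb a b p' q' s' \<longleftrightarrow> p = p' \<and> q = q' \<and> s = s'"
proof
  assume "quotient_emb a b p q s = quotient_emb a b p' q' s'"
  then have "normal_form p q s - normal_form p' q' s' \<in> relation_ideal a b"
    unfolding quotient_emb_def coset_eq_iff .
  moreover have "normal_form p q s - normal_form p' q' s' = normal_form (p - p') (q - q') (s - s')"
    by (simp add: normal_form_def coeffs_xw_diff algebra_simps)
  ultimately show "p = p' \<and> q = q' \<and> s = s'" using normal_form_in_relation_ideal by fastforce
qed simp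

lemma quotient_emb_simps:
  "quotient_emb a b [:[:c:]:] 0 0 = cls a b (single 0 c)"
  "quotient_emb a b pX 0 0 = quotient_var a b Var_x" "quotient_emb a b 0 1 0 = quotient_var a b Var_y"
  "quotient_emb a b 0 0 1 = quotient_var a b Var_z" "quotient_emb a b pW 0 0 = quotient_var a b Var_w"
  "quotient_emb a b 1 0 0 = \<one>\<^bsub>quotient_ring a b\<^esub>"
  by (simp_all add: quotient_emb_def normal_form_def quotient_var_def coeffs_xw_const coeffs_xw_pX
      coeffs_xw_pW coeffs_xw_1 coset_one)

lemma quotient_emb_surj:
  fixes u :: "'k::field poly4 set"
  assumes "u \<in> carrier (quotient_ring a b)"
  shows "\<exists>p q s. u = quotient_emb a b p q s"
proof -
  obtain t where t: "u = cls a b t" using assms unfolding coset_carrier by blast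
  let ?G = "{t. \<exists>p q s. cls a b t = quotient_emb a b p q s}"
  have "t \<in> ?G"
  proof (rule poly4_induct)
    show "single 0 c \<in> ?G" for c
      using quotient_emb_simps(1)[of a b c] by (intro CollectI exI) (rule sym)
    show "polyvar v \<in> ?G" for v
      using quotient_emb_simps(2-5)[of a b, symmetric] unfolding quotient_var_def by (cases v) blast+
    fix p q :: "'k poly4" assume "p \<in> ?G" "q \<in> ?G"
    then obtain p1 p2 p3 q1 q2 q3 where e: "cls a b p = quotient_emb a b p1 p2 p3"
      "cls a b q = quotient_emb a b q1 q2 q3" by blast
    show "p + q \<in> ?G" using coset_add[of a b p q] unfolding e quotient_emb_add by (metis (mono_tags) mem_Collect_eq)
    show "p * q \<in> ?G" using coset_mult[of a b p q] unfolding e quotient_emb_mult by (metis (mono_tags) mem_Collect_eq)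
  qed
  then show ?thesis unfolding t by blast
qed

lemma cubic_ring_quotient:
  assumes "a > 0" "b > 0"
  shows "cubic_ring (quotient_ring a b) (quotient_emb a b) a b"
proof (intro cubic_ring.intro cring_quotient_ring cubic_ring_axioms.intro)
  show "quotient_emb a b p q s \<in> carrier (quotient_ring a b)" for p q s :: "'a poly poly"
    unfolding coset_carrier quotient_emb_def by blast
  show "quotient_emb a b p q s \<oplus>\<^bsub>quotient_ring a b\<^esub> quotient_emb a b p' q' s'
    = quotient_emb a b (p + p') (q + q') (s + s')" for p q s p' q' s' :: "'a poly poly"
    by (rule quotient_emb_add)
qed (fact assms quotient_emb_eq quotient_emb_mult quotient_emb_simps(6) | erule quotient_emb_surj)+

theorem mainTheorem5:
  fixes a b :: nat
    and R :: "'k::field poly4 set ring"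
    and x y z w :: "'k poly4 set"
    and \<mm> :: "'k poly4 set set"
    and S :: "('k poly4 set \<times> 'k poly4 set) set ring"
    and xwS :: "('k poly4 set \<times> 'k poly4 set) set set"
  assumes a_pos: "a > 0" and b_pos: "b > 0"
    and R_def: "R = quotient_ring a b"
    and x_def: "x = quotient_var a b Var_x"
    and y_def: "y = quotient_var a b Var_y"
    and z_def: "z = quotient_var a b Var_z"
    and w_def: "w = quotient_var a b Var_w"
    and m_def: "\<mm> = Idl\<^bsub>R\<^esub> {x, y, z, w}"
    and S_def: "S = localization_at R \<mm>"
    and xwS_def: "xwS = Idl\<^bsub>S\<^esub> {localization_at_map R \<mm> x, localization_at_map R \<mm> w}"
  shows
    "(krull_dim R = 2 \<and> cohen_macaulay_ring R \<and>
        \<mm> \<cdot>\<^bsub>R\<^esub> \<mm> = (Idl\<^bsub>R\<^esub> {x, w}) \<cdot>\<^bsub>R\<^esub> \<mm> \<and> (Idl\<^bsub>R\<^esub> {x, w}) \<cdot>\<^bsub>R\<^esub> \<mm> \<subseteq> Idl\<^bsub>R\<^esub> {x, w})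
     \<and> (\<not> 3 dvd a \<or> \<not> 3 dvd b \<longrightarrow>
        domain R \<and> domain S \<and> cohen_macaulay_local S \<and> analytically_unramified S)
     \<and> (a \<ge> 3 \<and> b \<ge> 3 \<longrightarrow>
        parameter_ideal S xwS \<and>
        conductor S \<subseteq> total_fractions_map S ` xwS \<and>
        (ring_char R > 0 \<longrightarrow> parameter_test_ideal S \<subseteq> xwS))"
proof -
  interpret C: cubic_ring R "quotient_emb a b" a b
    unfolding R_def by (rule cubic_ring_quotient[OF a_pos b_pos])
  have gens: "x = C.\<iota> pX" "w = C.\<iota> pW" "y = quotient_emb a b 0 1 0" "z = quotient_emb a b 0 0 1"
    unfolding x_def w_def y_def z_def C.\<iota>_def by (simp_all add: quotient_emb_simps)
  have m: "\<mm> = C.\<mm>" unfolding m_def C.\<mm>_def gens ..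
  have S: "S = C.m.L" unfolding S_def m C.localization_at_m ..
  have xwS: "xwS = C.pair_ideal (Suc 0) (Suc 0)"
    unfolding xwS_def S m C.localization_at_m C.pair_ideal_def gens by simp
  have cm: "cohen_macaulay_local S"
    using C.maximalideal_localization(1)[OF C.maximalideal_m] unfolding S_def m .
  have "domain R \<and> domain S \<and> analytically_unramified S" if "\<not> 3 dvd a \<or> \<not> 3 dvd b"
  proof -
    \<comment> \<open>If 3 does not divide b, then c = 3 leaves the residue of b. Otherwise 3 does
      not divide a, and c = 1 leaves that of 2a.\<close>
    define c :: nat where "c = (if 3 dvd b then 1 else 3)"
    have "(2 * (a * c) + b) mod 3 \<noteq> 0" "c > 0" using that unfolding c_def by (auto; presburger)+
    then interpret V: weighted_cubic_ring R "quotient_emb a b" a b c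
      by unfold_locales
    show ?thesis unfolding S using V.domain_R V.domain_mL V.analytically_unramified_mL by blast
  qed
  moreover have "parameter_ideal S xwS" unfolding S xwS by (rule C.parameter_ideal_pair) simp_all
  ultimately show ?thesis
    using C.krull_dim_R C.cohen_macaulay_R C.m_square cm C.conductor_subset C.parameter_test_ideal_subset
    unfolding m gens xwS S by blast
qed

end
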